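(* Let $n\ge2$ and $g\ge2$ be integers. The free group $F_n$ of rank $n$ and the surface group $\pi_1(\Sigma_g)$, the fundamental group of the closed orientable surface $\Sigma_g$ of genus $g$, are not $L^1$-measure equivalent.
   Context: Two countable discrete groups $\Gamma,\Lambda$ are measure equivalent if there is a nonzero $\sigma$-finite measure space $(X,\mu)$ with commuting, free, $\mu$-preserving actions of $\Gamma$ and $\Lambda$, each having a finite-measure fundamental domain $X_\Gamma$, resp. $X_\Lambda$: $X=\bigsqcup_{\gamma\in\Gamma}\gamma X_\Gamma=\bigsqcup_{\lambda\in\Lambda}\lambda X_\Lambda$. The associated cocycles $\alpha:\Gamma\times X_\Lambda\to\Lambda$ and $\beta:\Lambda\times X_\Gamma\to\Gamma$ are defined by $\alpha(\gamma,x)\gamma x\in X_\Lambda$ for $x\in X_\Lambda$ and $\beta(\lambda,y)\lambda y\in X_\Gamma$ for $y\in X_\Gamma$. For finitely generated groups with word lengths $|\cdot|$, they are $L^1$-measure equivalent if such a coupling can be chosen with $\int_{X_\Lambda}|\alpha(\gamma,x)|\,d\mu(x)<\infty$ for all $\gamma\in\Gamma$ and $\int_{X_\Gamma}|\beta(\lambda,y)|\,d\mu(y)<\infty$ for all $\lambda\in\Lambda$. *)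

theory Defs
  imports "HOL-Analysis.Analysis" "HOL-Algebra.Group_Action" "HOL-Algebra.Generated_Groups"
begin

section \<open>Word lengths\<close>

definition finite_generating_set :: "('a, 'm) monoid_scheme \<Rightarrow> 'a set \<Rightarrow> bool" where
  "finite_generating_set G S \<longleftrightarrow> finite S \<and> S \<subseteq> carrier G \<and> generate G S = carrier G"

definition word_length :: "('a, 'm) monoid_scheme \<Rightarrow> 'a set \<Rightarrow> 'a \<Rightarrow> nat" where
  "word_length G S g =
     (LEAST k. \<exists>ws. length ws = k \<and> set ws \<subseteq> S \<union> m_inv G ` S \<and>
                    foldr (mult G) ws (one G) = g)"


section \<open>\<open>L\<^sup>1\<close>-measure equivalence\<close>

definition measure_preserving_action ::
    "('a, 'm) monoid_scheme \<Rightarrow> 'x measure \<Rightarrow> ('a \<Rightarrow> 'x \<Rightarrow> 'x) \<Rightarrow> bool" where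
  "measure_preserving_action G M \<phi> \<longleftrightarrow>
     group_action G (space M) \<phi> \<and>
     (\<forall>g\<in>carrier G. \<phi> g \<in> measurable M M \<and> distr M M (\<phi> g) = M)"

definition free_action ::
    "('a, 'm) monoid_scheme \<Rightarrow> 'x set \<Rightarrow> ('a \<Rightarrow> 'x \<Rightarrow> 'x) \<Rightarrow> bool" where
  "free_action G E \<phi> \<longleftrightarrow> (\<forall>g\<in>carrier G. \<forall>x\<in>E. \<phi> g x = x \<longrightarrow> g = one G)"

definition finite_fundamental_domain ::
    "('a, 'm) monoid_scheme \<Rightarrow> 'x measure \<Rightarrow> ('a \<Rightarrow> 'x \<Rightarrow> 'x) \<Rightarrow> 'x set \<Rightarrow> bool" where
  "finite_fundamental_domain G M \<phi> D \<longleftrightarrow>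
     D \<in> sets M \<and> emeasure M D < \<infinity> \<and>
     disjoint_family_on (\<lambda>g. \<phi> g ` D) (carrier G) \<and>
     (\<Union>g\<in>carrier G. \<phi> g ` D) = space M"

definition measure_equivalence_coupling ::
    "('a, 'm) monoid_scheme \<Rightarrow> ('b, 'n) monoid_scheme \<Rightarrow> 'x measure \<Rightarrow>
     ('a \<Rightarrow> 'x \<Rightarrow> 'x) \<Rightarrow> ('b \<Rightarrow> 'x \<Rightarrow> 'x) \<Rightarrow> 'x set \<Rightarrow> 'x set \<Rightarrow> bool" where
  "measure_equivalence_coupling G H M \<phi> \<psi> X\<^sub>G X\<^sub>H \<longleftrightarrow>
     countable (carrier G) \<and> countable (carrier H) \<and>
     sigma_finite_measure M \<and> emeasure M (space M) \<noteq> 0 \<and>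
     measure_preserving_action G M \<phi> \<and> measure_preserving_action H M \<psi> \<and>
     (\<forall>g\<in>carrier G. \<forall>h\<in>carrier H. \<forall>x\<in>space M. \<phi> g (\<psi> h x) = \<psi> h (\<phi> g x)) \<and>
     free_action G (space M) \<phi> \<and> free_action H (space M) \<psi> \<and>
     finite_fundamental_domain G M \<phi> X\<^sub>G \<and> finite_fundamental_domain H M \<psi> X\<^sub>H"

text \<open>
  Here \<open>D\<close> is a fundamental domain of the \<open>H\<close>-action \<open>\<psi>\<close>, so that the element selected is unique;
  \<open>\<phi>\<close> is the action of the other group.
\<close>

definition coupling_cocycle ::
    "('b, 'n) monoid_scheme \<Rightarrow> ('b \<Rightarrow> 'x \<Rightarrow> 'x) \<Rightarrow> 'x set \<Rightarrow> ('a \<Rightarrow> 'x \<Rightarrow> 'x) \<Rightarrow> 'a \<Rightarrow> 'x \<Rightarrow> 'b" where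
  "coupling_cocycle H \<psi> D \<phi> g x = (THE h. h \<in> carrier H \<and> \<psi> h (\<phi> g x) \<in> D)"

text \<open>
  Word lengths for two finite generating sets of a group bound each other up to a multiplicative
  constant, so integrability does not depend on the generating sets. The type argument is the
  type of the points of the coupling space; HOL cannot quantify over it inside a definition, and
  statements are meant to be read for all types \<open>'x\<close>.
\<close>

definition L1_measure_equivalent ::
    "'x itself \<Rightarrow> ('a, 'm) monoid_scheme \<Rightarrow> ('b, 'n) monoid_scheme \<Rightarrow> bool" where
  "L1_measure_equivalent (T :: 'x itself) G H \<longleftrightarrow>
     (\<exists>S\<^sub>G S\<^sub>H. finite_generating_set G S\<^sub>G \<and> finite_generating_set H S\<^sub>H \<and>
       (\<exists>(M :: 'x measure) \<phi> \<psi> X\<^sub>G X\<^sub>H.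
          measure_equivalence_coupling G H M \<phi> \<psi> X\<^sub>G X\<^sub>H \<and>
          (\<forall>g\<in>carrier G.
             (\<integral>\<^sup>+x\<in>X\<^sub>H. of_nat (word_length H S\<^sub>H (coupling_cocycle H \<psi> X\<^sub>H \<phi> g x)) \<partial>M) < \<infinity>) \<and>
          (\<forall>h\<in>carrier H.
             (\<integral>\<^sup>+y\<in>X\<^sub>G. of_nat (word_length G S\<^sub>G (coupling_cocycle G \<phi> X\<^sub>G \<psi> h y)) \<partial>M) < \<infinity>)))"


section \<open>Free groups\<close>

text \<open>
  The letter \<open>(i, True)\<close> is the \<open>i\<close>-th free generator and \<open>(i, False)\<close> its inverse. Elements are
  freely reduced words; since \<^term>\<open>fg_cons\<close> keeps a word reduced, folding it over the left factor
  yields the reduced form of the concatenation.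
\<close>

type_synonym letter = "nat \<times> bool"

definition inv_letter :: "letter \<Rightarrow> letter" where
  "inv_letter a = (fst a, \<not> snd a)"

definition reduced_word :: "letter list \<Rightarrow> bool" where
  "reduced_word w \<longleftrightarrow> successively (\<lambda>a b. b \<noteq> inv_letter a) w"

fun fg_cons :: "letter \<Rightarrow> letter list \<Rightarrow> letter list" where
  "fg_cons a [] = [a]"
| "fg_cons a (b # w) = (if b = inv_letter a then w else a # b # w)"

definition free_group :: "nat \<Rightarrow> letter list monoid" where
  "free_group n =
     \<lparr>carrier = {w. set w \<subseteq> {..<n} \<times> UNIV \<and> reduced_word w},
      mult = (\<lambda>u v. foldr fg_cons u v),
      one = []\<rparr>"

lemma inv_letter_inv_letter [simp]: "inv_letter (inv_letter a) = a"
  by (simp add: inv_letter_def)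

lemma fg_cons_reduced: "reduced_word w \<Longrightarrow> reduced_word (fg_cons a w)"
  by (cases w) (auto simp: reduced_word_def successively_Cons)

lemma foldr_fg_cons_reduced: "reduced_word w \<Longrightarrow> reduced_word (foldr fg_cons u w)"
  by (induction u) (auto simp: fg_cons_reduced)

lemma foldr_fg_cons_letters: "set (foldr fg_cons u w) \<subseteq> set u \<union> set w"
proof (induction u)
  case (Cons a u)
  have "set (fg_cons a v) \<subseteq> insert a (set v)" for v
    by (cases v) auto
  with Cons show ?case by fastforce
qed simp

lemma fg_cons_inv: 
  assumes "reduced_word w" 
  shows "fg_cons a (fg_cons (inv_letter a) w) = w"
  using assms by (cases w; cases "tl w") (auto simp: reduced_word_def)

lemma foldr_fg_cons_fg_cons:
  "reduced_word w \<Longrightarrow> foldr fg_cons (fg_cons a v) w = fg_cons a (foldr fg_cons v w)"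
  by (cases v) (auto simp: fg_cons_inv foldr_fg_cons_reduced)

lemma foldr_fg_cons_assoc:
  "reduced_word w \<Longrightarrow>
     foldr fg_cons (foldr fg_cons u v) w = foldr fg_cons u (foldr fg_cons v w)"
  by (induction u) (auto simp: foldr_fg_cons_fg_cons)

lemma foldr_fg_cons_Nil: "reduced_word w \<Longrightarrow> foldr fg_cons w [] = w"
proof (induction w)
  case (Cons a w)
  then show ?case by (cases w) (auto simp: reduced_word_def)
qed simp

lemma foldr_fg_cons_inverse:
  "reduced_word w \<Longrightarrow> foldr fg_cons (rev (map inv_letter w)) w = []"
proof (induction w)
  case (Cons a w)
  have "reduced_word w" using Cons.prems by (auto simp: reduced_word_def successively_Cons)
  with Cons.IH show ?case by simp
qed simp

lemma reduced_word_inverse: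
  assumes "reduced_word w"
  shows "reduced_word (rev (map inv_letter w))"
  using assms unfolding reduced_word_def successively_rev successively_map
  by (rule successively_mono) (metis inv_letter_inv_letter)

lemma group_free_group: "group (free_group n)"
proof (rule groupI)
  show "\<one>\<^bsub>free_group n\<^esub> \<in> carrier (free_group n)"
    by (simp add: free_group_def reduced_word_def)
next
  fix u v assume "u \<in> carrier (free_group n)" "v \<in> carrier (free_group n)"
  then show "u \<otimes>\<^bsub>free_group n\<^esub> v \<in> carrier (free_group n)"
    using foldr_fg_cons_letters[of u v] by (auto simp: free_group_def foldr_fg_cons_reduced)
next
  fix w assume w: "w \<in> carrier (free_group n)"
  have "set (rev (map inv_letter w)) \<subseteq> {..<n} \<times> UNIV"
    using w by (auto simp: free_group_def inv_letter_def)
  with w show "\<exists>v\<in>carrier (free_group n). v \<otimes>\<^bsub>free_group n\<^esub> w = \<one>\<^bsub>free_group n\<^esub>"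
    by (intro bexI[of _ "rev (map inv_letter w)"])
      (auto simp: free_group_def foldr_fg_cons_inverse reduced_word_inverse)
qed (auto simp: free_group_def foldr_fg_cons_assoc)


section \<open>Fundamental groups\<close>

text \<open>
  The path operations of the library are tied to the class \<open>topological_space\<close>, hence the
  versions below for abstract topologies. Values of a loop outside the unit interval are
  irrelevant, and loops differing only there are identified by \<open>loop_homotopy\<close>.
\<close>

definition loops_at :: "'a topology \<Rightarrow> 'a \<Rightarrow> (real \<Rightarrow> 'a) set" where
  "loops_at X x = {p. pathin X p \<and> p 0 = x \<and> p 1 = x}"

definition loop_homotopy :: "'a topology \<Rightarrow> 'a \<Rightarrow> ((real \<Rightarrow> 'a) \<times> (real \<Rightarrow> 'a)) set" where
  "loop_homotopy X x =
     {(p, q). homotopic_with (\<lambda>r. r 0 = x \<and> r 1 = x) (top_of_set {0..1}) X p q}"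

definition loop_join :: "(real \<Rightarrow> 'a) \<Rightarrow> (real \<Rightarrow> 'a) \<Rightarrow> real \<Rightarrow> 'a" where
  "loop_join p q = (\<lambda>t. if t \<le> 1/2 then p (2 * t) else q (2 * t - 1))"

definition fundamental_group :: "'a topology \<Rightarrow> 'a \<Rightarrow> (real \<Rightarrow> 'a) set monoid" where
  "fundamental_group X x =
     \<lparr>carrier = loops_at X x // loop_homotopy X x,
      mult = (\<lambda>A B. \<Union>p\<in>A. \<Union>q\<in>B. loop_homotopy X x `` {loop_join p q}),
      one = loop_homotopy X x `` {\<lambda>_. x}\<rparr>"

lemma equiv_loop_homotopy: "equiv (loops_at X x) (loop_homotopy X x)"
proof (rule equivI)
  show "loop_homotopy X x \<subseteq> loops_at X x \<times> loops_at X x"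
    by (auto simp: loop_homotopy_def loops_at_def pathin_def
        dest: homotopic_with_imp_continuous_maps homotopic_with_imp_property)
  show "refl_on (loops_at X x) (loop_homotopy X x)"
    by (auto simp: refl_on_def loop_homotopy_def loops_at_def pathin_def)
  show "sym (loop_homotopy X x)"
    by (auto simp: sym_def loop_homotopy_def homotopic_with_sym)
  show "trans (loop_homotopy X x)"
    by (auto simp: trans_def loop_homotopy_def intro: homotopic_with_trans)
qed

lemma loop_join_homotopy:
  assumes "(p, p') \<in> loop_homotopy X x" "(q, q') \<in> loop_homotopy X x"
  shows "(loop_join p q, loop_join p' q') \<in> loop_homotopy X x"
proof -
  let ?I = "top_of_set {0..1::real}"
  obtain h where h: "continuous_map (prod_topology ?I ?I) X h" "\<And>t. h (0, t) = p t"
      "\<And>t. h (1, t) = p' t" "\<And>s. s \<in> {0..1} \<Longrightarrow> h (s, 0) = x \<and> h (s, 1) = x"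
    using assms(1) unfolding loop_homotopy_def homotopic_with_def by auto
  obtain k where k: "continuous_map (prod_topology ?I ?I) X k" "\<And>t. k (0, t) = q t"
      "\<And>t. k (1, t) = q' t" "\<And>s. s \<in> {0..1} \<Longrightarrow> k (s, 0) = x \<and> k (s, 1) = x"
    using assms(2) unfolding loop_homotopy_def homotopic_with_def by auto
  let ?H = "\<lambda>z. if snd z \<le> 1/2 then h (fst z, 2 * snd z) else k (fst z, 2 * snd z - 1)"
  have sq: "prod_topology ?I ?I = top_of_set ({0..1} \<times> {0..1})"
    by (simp add: prod_topology_subtopology_eu)
  have "continuous_map (top_of_set ({0..1} \<times> {0..1})) X ?H"
  proof (rule continuous_map_cases_le)
    show "continuous_map (subtopology (top_of_set ({0..1} \<times> {0..1}))
        {z \<in> topspace (top_of_set ({0..1} \<times> {0..1})). snd z \<le> 1/2}) X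
        (\<lambda>z. h (fst z, 2 * snd z))"
      by (rule continuous_map_compose[of _ _ "\<lambda>z. (fst z, 2 * snd z)", OF _ h(1)[unfolded sq],
            unfolded o_def])
        (auto simp: subtopology_subtopology intro!: continuous_intros)
    show "continuous_map (subtopology (top_of_set ({0..1} \<times> {0..1}))
        {z \<in> topspace (top_of_set ({0..1} \<times> {0..1})). 1/2 \<le> snd z}) X
        (\<lambda>z. k (fst z, 2 * snd z - 1))"
      by (rule continuous_map_compose[of _ _ "\<lambda>z. (fst z, 2 * snd z - 1)", OF _ k(1)[unfolded sq],
            unfolded o_def])
        (auto simp: subtopology_subtopology intro!: continuous_intros)
    fix z :: "real \<times> real"
    assume z: "z \<in> topspace (top_of_set ({0..1} \<times> {0..1}))" "snd z = 1/2"
    then have "fst z \<in> {0..1}" "2 * snd z = 1" "2 * snd z - 1 = 0" by auto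
    then show "h (fst z, 2 * snd z) = k (fst z, 2 * snd z - 1)"
      using h(4) k(4) by metis
  qed (auto intro!: continuous_intros)
  then show ?thesis
    unfolding loop_homotopy_def homotopic_with_def mem_Collect_eq case_prod_conv sq
    by (intro exI[of _ ?H]) (use h k in \<open>auto simp: loop_join_def\<close>)
qed

lemma loop_join_loops_at:
  assumes "p \<in> loops_at X x" "q \<in> loops_at X x"
  shows "loop_join p q \<in> loops_at X x"
proof -
  have "(p, p) \<in> loop_homotopy X x" "(q, q) \<in> loop_homotopy X x"
    using assms by (auto simp: loop_homotopy_def loops_at_def pathin_def)
  from loop_join_homotopy[OF this] show ?thesis
    by (auto simp: loop_homotopy_def loops_at_def pathin_def
        dest: homotopic_with_imp_continuous_maps homotopic_with_imp_property)
qed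

lemma loop_reparametrize_homotopy:
  assumes p: "p \<in> loops_at X x"
    and f: "path f" "path_image f \<subseteq> {0..1::real}" and g: "path g" "path_image g \<subseteq> {0..1}"
    and e: "pathstart f = pathstart g" "pathfinish f = pathfinish g"
    and s: "pathstart f \<in> {0, 1}" "pathfinish f \<in> {0, 1}"
  shows "(p \<circ> f, p \<circ> g) \<in> loop_homotopy X x"
proof -
  have "homotopic_paths {0..1} f g"
  proof (rule homotopic_paths_linear)
    fix t :: real assume "t \<in> {0..1}"
    then have "f t \<in> {0..1}" "g t \<in> {0..1}"
      using f(2) g(2) unfolding path_image_def by blast+
    then show "closed_segment (f t) (g t) \<subseteq> {0..1}"
      by (simp add: closed_segment_subset)
  qed (use f g e in auto)
  then have "homotopic_with (\<lambda>r. r 0 = pathstart f \<and> r 1 = pathfinish f)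
      (top_of_set {0..1}) (top_of_set {0..1}) f g"
    by (simp add: homotopic_paths_def pathstart_def pathfinish_def)
  then have "homotopic_with (\<lambda>r. r 0 = x \<and> r 1 = x) (top_of_set {0..1}) X (p \<circ> f) (p \<circ> g)"
    by (rule homotopic_with_compose_continuous_map_left)
      (use p s in \<open>auto simp: loops_at_def pathin_def\<close>)
  then show ?thesis by (simp add: loop_homotopy_def)
qed

lemma fundamental_group_mult_class:
  assumes "p \<in> loops_at X x" "q \<in> loops_at X x"
  shows "(loop_homotopy X x `` {p}) \<otimes>\<^bsub>fundamental_group X x\<^esub> (loop_homotopy X x `` {q})
         = loop_homotopy X x `` {loop_join p q}"
proof -
  let ?r = "loop_homotopy X x"
  have "?r `` {loop_join p' q'} = ?r `` {loop_join p q}"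
    if "(p, p') \<in> ?r" "(q, q') \<in> ?r" for p' q'
    using equiv_class_eq[OF equiv_loop_homotopy loop_join_homotopy[OF that]] by simp
  moreover have "(p, p) \<in> ?r" "(q, q) \<in> ?r"
    using assms equiv_loop_homotopy[of X x] by (auto simp: equiv_def refl_on_def)
  ultimately have "(\<Union>p'\<in>?r `` {p}. \<Union>q'\<in>?r `` {q}. ?r `` {loop_join p' q'})
      = ?r `` {loop_join p q}"
    by blast
  then show ?thesis by (simp add: fundamental_group_def)
qed

lemma loop_reparametrizes:
  assumes "p \<in> loops_at X x"
    and f: "path f" "path_image f \<subseteq> {0..1::real}" and g: "path g" "path_image g \<subseteq> {0..1}"
    and "pathstart f = pathstart g" "pathfinish f = pathfinish g"
    and "pathstart f \<in> {0, 1}" "pathfinish f \<in> {0, 1}"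
    and "\<And>t. t \<in> {0..1} \<Longrightarrow> a t = p (f t)" "\<And>t. t \<in> {0..1} \<Longrightarrow> b t = p (g t)"
  shows "loop_homotopy X x `` {a} = loop_homotopy X x `` {b}"
proof -
  have eq: "loop_homotopy X x `` {c} = loop_homotopy X x `` {p \<circ> h}"
    if "(p \<circ> h, p \<circ> h) \<in> loop_homotopy X x" "\<And>t. t \<in> {0..1} \<Longrightarrow> c t = p (h t)" for h c
  proof -
    have "homotopic_with (\<lambda>r. r 0 = x \<and> r 1 = x) (top_of_set {0..1}) X (p \<circ> h) c"
      using that by (intro homotopic_with_equal) (auto simp: loop_homotopy_def)
    then have "(p \<circ> h, c) \<in> loop_homotopy X x" by (simp add: loop_homotopy_def)
    from equiv_class_eq[OF equiv_loop_homotopy this] show ?thesis by simp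
  qed
  have fg: "(p \<circ> f, p \<circ> g) \<in> loop_homotopy X x"
    by (rule loop_reparametrize_homotopy) (use assms in simp_all)
  have ff: "(p \<circ> f, p \<circ> f) \<in> loop_homotopy X x"
    by (rule loop_reparametrize_homotopy) (use assms in simp_all)
  have gg: "(p \<circ> g, p \<circ> g) \<in> loop_homotopy X x"
    by (rule loop_reparametrize_homotopy) (use assms in simp_all)
  show ?thesis
    using eq[OF ff assms(10)] eq[OF gg assms(11)] equiv_class_eq[OF equiv_loop_homotopy fg]
    by simp
qed

lemma group_fundamental_group:
  assumes x: "x \<in> topspace X"
  shows "group (fundamental_group X x)"
proof -
  let ?G = "fundamental_group X x" and ?r = "loop_homotopy X x" and ?L = "loops_at X x"
  have c: "carrier ?G = ?L // ?r" by (simp add: fundamental_group_def)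
  have const: "(\<lambda>_. x) \<in> ?L" using x by (simp add: loops_at_def pathin_def)
  have one: "\<one>\<^bsub>?G\<^esub> = ?r `` {\<lambda>_. x}" by (simp add: fundamental_group_def)
  show ?thesis
  proof (rule groupI)
    show "\<one>\<^bsub>?G\<^esub> \<in> carrier ?G" using const by (auto simp: fundamental_group_def quotientI)
  next
    fix A B assume "A \<in> carrier ?G" "B \<in> carrier ?G"
    then show "A \<otimes>\<^bsub>?G\<^esub> B \<in> carrier ?G"
      unfolding c by (auto elim!: quotientE simp: fundamental_group_mult_class
          intro!: quotientI loop_join_loops_at)
  next
    fix A B C assume "A \<in> carrier ?G" "B \<in> carrier ?G" "C \<in> carrier ?G"
    then obtain p q s where L: "p \<in> ?L" "q \<in> ?L" "s \<in> ?L"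
      and ABC: "A = ?r `` {p}" "B = ?r `` {q}" "C = ?r `` {s}"
      unfolding c by (auto elim!: quotientE)
    let ?u = "loop_join (loop_join p q) s"
    let ?f = "linepath 0 (1/4) +++ (linepath (1/4) (1/2) +++ linepath (1/2) (1::real))"
    have ends: "p 1 = x" "q 0 = x" "q 1 = x" "s 0 = x" using L by (auto simp: loops_at_def)
    have "?r `` {?u} = ?r `` {loop_join p (loop_join q s)}"
    proof (rule loop_reparametrizes[where p = ?u and f = "linepath 0 1" and g = ?f])
      show "path_image ?f \<subseteq> {0..1}"
        by (auto simp: path_image_join closed_segment_eq_real_ivl)
      fix t :: real assume t: "t \<in> {0..1}"
      then show "?u t = ?u (linepath 0 1 t)" by (simp add: linepath_def)
      consider "t \<le> 1/2" | "1/2 < t" "t \<le> 3/4" | "3/4 < t" by linarith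
      then show "loop_join p (loop_join q s) t = ?u (?f t)"
      proof cases
        case 1
        then show ?thesis by (simp add: loop_join_def joinpaths_def linepath_def)
      next
        case 2
        then have "?f t = t - 1/4"
          by (simp add: joinpaths_def linepath_def field_simps)
        moreover have "2 * (2 * (t - 1/4)) - 1 = 2 * (2 * t - 1)" by simp
        ultimately show ?thesis using 2 ends by (simp add: loop_join_def)
      next
        case 3
        then have "?f t = 2 * t - 1"
          by (simp add: joinpaths_def linepath_def field_simps)
        then show ?thesis using 3 ends by (simp add: loop_join_def)
      qed
    qed (use L in \<open>auto simp: loop_join_loops_at closed_segment_eq_real_ivl\<close>)
    then show "(A \<otimes>\<^bsub>?G\<^esub> B) \<otimes>\<^bsub>?G\<^esub> C = A \<otimes>\<^bsub>?G\<^esub> (B \<otimes>\<^bsub>?G\<^esub> C)"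
      using L by (simp add: ABC fundamental_group_mult_class loop_join_loops_at)
  next
    fix A assume "A \<in> carrier ?G"
    then obtain p where p: "p \<in> ?L" and A: "A = ?r `` {p}"
      unfolding c by (auto elim!: quotientE)
    have ends: "p 0 = x" "p 1 = x" using p by (auto simp: loops_at_def)
    have "?r `` {loop_join (\<lambda>_. x) p} = ?r `` {p}"
    proof (rule loop_reparametrizes[where p = p and f = "linepath 0 0 +++ linepath 0 1"
            and g = "linepath 0 1"])
      show "loop_join (\<lambda>_. x) p t = p ((linepath 0 0 +++ linepath 0 1) t)" for t
        by (simp add: loop_join_def joinpaths_def linepath_def ends)
    qed (use p in \<open>auto simp: path_image_join closed_segment_eq_real_ivl\<close>)
    then show "\<one>\<^bsub>?G\<^esub> \<otimes>\<^bsub>?G\<^esub> A = A"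
      using p const by (simp add: A one fundamental_group_mult_class)
    let ?q = "\<lambda>t. p (1 - t)"
    have q: "?q \<in> ?L"
      using p unfolding loops_at_def pathin_def
      by (auto intro!: continuous_map_compose[of _ "top_of_set {0..1}" "\<lambda>t. 1 - t" X p, unfolded o_def]
          continuous_intros)
    have "?r `` {loop_join ?q p} = ?r `` {\<lambda>_. x}"
    proof (rule loop_reparametrizes[where p = p and f = "linepath 1 0 +++ linepath 0 1"
            and g = "linepath 1 1"])
      show "loop_join ?q p t = p ((linepath 1 0 +++ linepath 0 1) t)" for t
        by (simp add: loop_join_def joinpaths_def linepath_def)
    qed (use p in \<open>auto simp: ends path_image_join closed_segment_eq_real_ivl
        simp del: linepath_refl\<close>)
    then show "\<exists>B\<in>carrier ?G. B \<otimes>\<^bsub>?G\<^esub> A = \<one>\<^bsub>?G\<^esub>"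
      using p q by (intro bexI[of _ "?r `` {?q}"])
        (simp_all add: A one c fundamental_group_mult_class quotientI)
  qed
qed


section \<open>Closed orientable surfaces\<close>

definition quotient_topology :: "'a topology \<Rightarrow> ('a \<times> 'a) set \<Rightarrow> 'a set topology" where
  "quotient_topology X r = topology (\<lambda>U. U \<subseteq> topspace X // r \<and> openin X (\<Union>U))"

lemma openin_quotient_topology:
  assumes "equiv (topspace X) r"
  shows "openin (quotient_topology X r) U \<longleftrightarrow> U \<subseteq> topspace X // r \<and> openin X (\<Union>U)"
proof -
  have "istopology (\<lambda>U. U \<subseteq> topspace X // r \<and> openin X (\<Union>U))"
    unfolding istopology_def
  proof (intro conjI allI impI; (elim conjE)?)
    fix S T assume S: "S \<subseteq> topspace X // r" "openin X (\<Union>S)"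
      and T: "T \<subseteq> topspace X // r" "openin X (\<Union>T)"
    show "S \<inter> T \<subseteq> topspace X // r" using S by blast
    have "\<Union>(S \<inter> T) = \<Union>S \<inter> \<Union>T"
      using quotient_disj[OF assms] S T by blast
    then show "openin X (\<Union>(S \<inter> T))" using S T by auto
  next
    fix K assume K: "\<forall>S\<in>K. S \<subseteq> topspace X // r \<and> openin X (\<Union>S)"
    show "\<Union>K \<subseteq> topspace X // r" using K by blast
    have "\<Union>(\<Union>K) = (\<Union>S\<in>K. \<Union>S)" by blast
    then show "openin X (\<Union>(\<Union>K))" using K by auto
  qed
  then show ?thesis by (simp add: quotient_topology_def topology_inverse')
qed

lemma topspace_quotient_topology:
  assumes "equiv (topspace X) r"
  shows "topspace (quotient_topology X r) = topspace X // r"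
proof
  show "topspace (quotient_topology X r) \<subseteq> topspace X // r"
    using iffD1[OF openin_quotient_topology[OF assms] openin_topspace] by simp
  have "openin (quotient_topology X r) (topspace X // r)"
    by (simp add: openin_quotient_topology[OF assms] Union_quotient[OF assms])
  then show "topspace X // r \<subseteq> topspace (quotient_topology X r)"
    by (rule openin_subset)
qed

lemma quotient_map_quotient_topology:
  assumes "equiv (topspace X) r"
  shows "quotient_map X (quotient_topology X r) (\<lambda>x. r `` {x})"
proof -
  have "{x \<in> topspace X. r `` {x} \<in> U} = \<Union>U" if U: "U \<subseteq> topspace X // r" for U
  proof
    show "{x \<in> topspace X. r `` {x} \<in> U} \<subseteq> \<Union>U"
      using equiv_class_self[OF assms] by blast
    show "\<Union>U \<subseteq> {x \<in> topspace X. r `` {x} \<in> U}"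
    proof
      fix x assume "x \<in> \<Union>U"
      then obtain C where C: "C \<in> U" "x \<in> C" by blast
      then obtain y where y: "y \<in> topspace X" "C = r `` {y}"
        using U by (meson quotientE subsetD)
      then have yx: "(y, x) \<in> r" using C by simp
      then have "x \<in> topspace X" using assms by (auto simp: equiv_def refl_on_def)
      moreover have "r `` {x} = C" using equiv_class_eq[OF assms yx] y(2) by simp
      ultimately show "x \<in> {x \<in> topspace X. r `` {x} \<in> U}" using C by simp
    qed
  qed
  then have "openin X {x \<in> topspace X. r `` {x} \<in> U} \<longleftrightarrow>
      openin (quotient_topology X r) U" if "U \<subseteq> topspace X // r" for U
    using that by (simp add: openin_quotient_topology[OF assms])
  moreover have "(\<lambda>x. r `` {x}) ` topspace X = topspace X // r"
    by (auto simp: quotient_def)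
  ultimately show ?thesis
    by (simp add: quotient_map_def topspace_quotient_topology[OF assms])
qed

text \<open>
  The surface of genus \<open>g \<ge> 1\<close> is obtained from the closed unit disc, viewed as a \<open>4g\<close>-gon whose
  sides are arcs of the unit circle, by gluing the sides according to the word
  \<open>a\<^sub>1 b\<^sub>1 a\<^sub>1\<^sup>-\<^sup>1 b\<^sub>1\<^sup>-\<^sup>1 \<dots> a\<^sub>g b\<^sub>g a\<^sub>g\<^sup>-\<^sup>1 b\<^sub>g\<^sup>-\<^sup>1\<close>: with sides numbered from \<open>0\<close>, side \<open>k\<close>
  with \<open>k mod 4 \<in> {0, 1}\<close> is glued to side \<open>k + 2\<close> with reversed orientation.
  For \<open>g = 0\<close> nothing is glued, and the result is a disc rather than a sphere.
\<close>

definition polygon_side :: "nat \<Rightarrow> nat \<Rightarrow> real \<Rightarrow> complex" where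
  "polygon_side g k t = cis (2 * pi * (real k + t) / real (4 * g))"

definition side_pairing :: "nat \<Rightarrow> (complex \<times> complex) set" where
  "side_pairing g =
     {(polygon_side g k t, polygon_side g (k + 2) (1 - t)) | k t.
        k < 4 * g \<and> k mod 4 \<in> {0, 1} \<and> t \<in> {0..1}}"

definition surface_gluing :: "nat \<Rightarrow> (complex \<times> complex) set" where
  "surface_gluing g =
     (side_pairing g \<union> (side_pairing g)\<inverse>)\<^sup>* \<inter> (cball 0 1 \<times> cball 0 1)"

definition closed_orientable_surface :: "nat \<Rightarrow> complex set topology" where
  "closed_orientable_surface g = quotient_topology (top_of_set (cball 0 1)) (surface_gluing g)"

lemma equiv_surface_gluing: "equiv (cball 0 1) (surface_gluing g)"
proof (rule equivI)
  have "sym ((side_pairing g \<union> (side_pairing g)\<inverse>)\<^sup>*)"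
    by (intro sym_rtrancl) (auto simp: sym_def)
  then show "sym (surface_gluing g)"
    by (auto simp: surface_gluing_def sym_def)
  show "trans (surface_gluing g)"
    unfolding surface_gluing_def trans_def by (blast intro: rtrancl_trans)
qed (auto simp: surface_gluing_def refl_on_def)

lemma quotient_map_closed_orientable_surface:
  "quotient_map (top_of_set (cball 0 1)) (closed_orientable_surface g)
     (\<lambda>z. surface_gluing g `` {z})"
  unfolding closed_orientable_surface_def
  by (rule quotient_map_quotient_topology) (simp add: equiv_surface_gluing)

end

theory Submission
  imports Defs
begin

text \<open>
  Suppose that the free group \<open>F\<close> and the surface group \<open>\<Gamma>\<close> are \<open>L\<^sup>1\<close>-measure equivalent, and
  let \<open>e\<close> be a bounded real 2-cocycle of \<open>\<Gamma>\<close>. On each \<open>F\<close>-orbit of the coupling space \<open>e\<close>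
  becomes a bounded cocycle on a tree, so it has a primitive growing at most linearly in the word
  length. Evaluating this primitive on the cocycle \<open>\<beta>\<close> with values in \<open>F\<close> gives an integrable
  function, and its integral over the fundamental domain of \<open>F\<close> exhibits \<open>e\<close> as the coboundary of
  a real function on \<open>\<Gamma>\<close>. Hence all bounded classes of \<open>\<Gamma>\<close> vanish in \<open>H\<^sup>2(\<Gamma>; \<real>)\<close>.

  The bounded Euler class contradicts this: if the genus is at least two, there is a representation
  of \<open>\<Gamma>\<close> in \<open>SL\<^sub>2(\<real>)\<close> with nonzero Euler number, and the orientation of triples of
  lines in the plane pulls back to a bounded cocycle that is not a coboundary. The representation is
  the holonomy of a flat bundle glued from the polygon.
\<close>

section \<open>Cocycles on orbits of a free group\<close>

text \<open>The primitive on a tree is a fan of triangles with apex \<open>x\<close> over the path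
  from \<open>x\<close> to \<open>w x\<close>, one triangle per letter of \<open>w\<close>. A
  bounded cocycle therefore costs a constant per letter, and L^1-integrability of \<beta> controls
  exactly this cost. So the class used against the surface group has to be bounded as well as
  nonzero; the orientation of lines takes only the values -1, 0 and 1.

  The surface group enters without a presentation. Homomorphisms out of it come from parallel
  transport over short distances, for which a homotopy of loops is all that has to be followed.
  Elements of it are loops that run straight to a boundary point of the polygon, pass to a point
  glued to it and run straight back. They satisfy the side relations because a glued pair can be
  slid along its two sides, and their holonomy is read off from the gauge at the two points. The
  base point is arbitrary and may lie on the boundary of the polygon, so the gauge at the base point
  is carried along throughout.\<close>

locale free_group_orbit_cocycle =
  group_action "free_group n" X \<phi> for n X and \<phi> :: "letter list \<Rightarrow> 'x \<Rightarrow> 'x" +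
  fixes c :: "'x \<Rightarrow> 'x \<Rightarrow> 'x \<Rightarrow> real"
  assumes cocycle: "\<lbrakk>x \<in> X; y \<in> X; z \<in> X; w \<in> X\<rbrakk> \<Longrightarrow> c y z w - c x z w + c x y w - c x y z = 0"
    and alternating: "\<lbrakk>x \<in> X; y \<in> X; z \<in> X\<rbrakk> \<Longrightarrow> c x z y = - c x y z"
begin

text \<open>A fan of triangles with common vertex \<open>x\<close> over the edges of the path from
  \<open>x\<close> to \<open>\<phi> w x\<close>. Letters act from the left, so the path reads the
  word from its end.\<close>

primrec primitive :: "letter list \<Rightarrow> 'x \<Rightarrow> real" where
  "primitive [] x = 0"
| "primitive (a # w) x = primitive w x - c x (\<phi> w x) (\<phi> (a # w) x)"

lemma reduced_tl:
  assumes "a # w \<in> carrier (free_group n)"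
  shows "w \<in> carrier (free_group n)" "[a] \<in> carrier (free_group n)"
  using assms by (cases w; auto simp: free_group_def reduced_word_def)+

lemma closed: "g \<in> carrier (free_group n) \<Longrightarrow> x \<in> X \<Longrightarrow> \<phi> g x \<in> X"
  using element_image by blast

text \<open>If \<open>a\<close> cancels against the head of \<open>w\<close>, the new triangle is
  the last triangle of the fan with two vertices exchanged, and alternation removes it. Backtracking
  is thus harmless.\<close>

lemma primitive_fg_cons:
  assumes w: "w \<in> carrier (free_group n)" and a: "[a] \<in> carrier (free_group n)" and x: "x \<in> X"
  shows "primitive (fg_cons a w) x = primitive w x - c x (\<phi> w x) (\<phi> (fg_cons a w) x)"
proof (cases w)
  case (Cons b v)
  have v: "v \<in> carrier (free_group n)" using reduced_tl w Cons by blast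
  show ?thesis
    using alternating[of x "\<phi> v x" "\<phi> w x"] w v x by (auto simp: Cons closed)
qed simp

text \<open>Since backtracking is harmless, the path may be led through \<open>\<phi> w x\<close>.
  Each letter of \<open>u\<close> then adds a tetrahedron with vertices \<open>x\<close>,
  \<open>\<phi> w x\<close> and the two ends of an edge, to which the cocycle identity applies.
  Along the orbit, \<open>c\<close> is the coboundary of \<open>primitive\<close>.\<close>

lemma primitive_mult:
  assumes "u \<in> carrier (free_group n)" and w: "w \<in> carrier (free_group n)" and x: "x \<in> X"
  shows "primitive (u \<otimes>\<^bsub>free_group n\<^esub> w) x
    = primitive w x + primitive u (\<phi> w x) - c x (\<phi> w x) (\<phi> (u \<otimes>\<^bsub>free_group n\<^esub> w) x)"
  using assms(1)
proof (induction u)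
  case Nil
  have "c x (\<phi> w x) (\<phi> w x) = 0"
    using alternating[OF x closed[OF w x] closed[OF w x]] by linarith
  then show ?case by (simp add: free_group_def)
next
  case (Cons a u)
  let ?F = "free_group n"
  interpret F: group ?F by (rule group_free_group)
  note u = reduced_tl[OF Cons.prems]
  have uw: "u \<otimes>\<^bsub>?F\<^esub> w \<in> carrier ?F" using u w by simp
  have eq: "(a # u) \<otimes>\<^bsub>?F\<^esub> w = fg_cons a (u \<otimes>\<^bsub>?F\<^esub> w)"
    by (simp add: free_group_def)
  have "primitive ((a # u) \<otimes>\<^bsub>?F\<^esub> w) x = primitive (u \<otimes>\<^bsub>?F\<^esub> w) x
      - c x (\<phi> (u \<otimes>\<^bsub>?F\<^esub> w) x) (\<phi> ((a # u) \<otimes>\<^bsub>?F\<^esub> w) x)"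
    unfolding eq using primitive_fg_cons[OF uw u(2) x] .
  moreover have "primitive (a # u) (\<phi> w x) = primitive u (\<phi> w x)
      - c (\<phi> w x) (\<phi> (u \<otimes>\<^bsub>?F\<^esub> w) x) (\<phi> ((a # u) \<otimes>\<^bsub>?F\<^esub> w) x)"
    by (simp add: composition_rule[OF x Cons.prems w] composition_rule[OF x u(1) w])
  moreover note Cons.IH[OF u(1)] cocycle[OF x, of "\<phi> w x" "\<phi> (u \<otimes>\<^bsub>?F\<^esub> w) x" "\<phi> ((a # u) \<otimes>\<^bsub>?F\<^esub> w) x"]
  moreover have "\<phi> w x \<in> X" "\<phi> (u \<otimes>\<^bsub>?F\<^esub> w) x \<in> X" "\<phi> ((a # u) \<otimes>\<^bsub>?F\<^esub> w) x \<in> X"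
    using x w uw Cons.prems by (auto intro: closed)
  ultimately show ?case by simp
qed

text \<open>One triangle per letter: the linear growth that integrability of word lengths can
  absorb.\<close>

lemma abs_primitive_le:
  assumes "\<And>x y z. \<bar>c x y z\<bar> \<le> C"
  shows "\<bar>primitive w x\<bar> \<le> C * length w"
proof (induction w)
  case (Cons a w)
  then show ?case
    using assms[of x "\<phi> w x" "\<phi> (a # w) x"] by (simp add: algebra_simps)
qed simp

text \<open>Meant for \<open>s\<close> from the other action of a coupling, which commutes with the
  free group.\<close>

lemma primitive_invariant:
  assumes "\<And>g. g \<in> carrier (free_group n) \<Longrightarrow> \<phi> g (s x) = s (\<phi> g x)"
    and "\<And>y z. y \<in> X \<Longrightarrow> z \<in> X \<Longrightarrow> c (s x) (s y) (s z) = c x y z"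
    and "w \<in> carrier (free_group n)" "x \<in> X"
  shows "primitive w (s x) = primitive w x"
  using assms(3)
proof (induction w)
  case (Cons a w)
  then show ?case
    using reduced_tl(1)[OF Cons.prems] assms by (simp add: closed)
qed simp

end

text \<open>Integrability is given for some finite generating set, whereas the primitive is bounded
  through the number of standard letters. Length is subadditive, so the greatest length of a
  generator or its inverse serves as \<open>K\<close>.\<close>

lemma length_le_word_length:
  assumes "finite_generating_set (free_group n) S"
  obtains K where "\<And>w. w \<in> carrier (free_group n) \<Longrightarrow> length w \<le> K * word_length (free_group n) S w"
proof -
  let ?F = "free_group n"
  interpret F: group ?F by (rule group_free_group)
  let ?S = "S \<union> m_inv ?F ` S"
  define K where "K = Max (insert 0 (length ` ?S))"
  have fin: "finite S" and gen: "generate ?F S = carrier ?F" and S: "S \<subseteq> carrier ?F"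
    using assms by (auto simp: finite_generating_set_def)
  have K: "length s \<le> K" if "s \<in> ?S" for s
    unfolding K_def using that fin by (intro Max_ge) auto
  have cons: "length (fg_cons a v) \<le> Suc (length v)" for a v by (cases v) auto
  have mult: "length (u \<otimes>\<^bsub>?F\<^esub> v) \<le> length u + length v" for u v
  proof -
    have "length (foldr fg_cons u v) \<le> length u + length v"
    proof (induction u)
      case (Cons a u)
      then show ?case using cons[of a "foldr fg_cons u v"] by simp
    qed simp
    then show ?thesis by (simp add: free_group_def)
  qed
  have words: "length (foldr (mult ?F) ws (one ?F)) \<le> K * length ws" if "set ws \<subseteq> ?S" for ws
    using that
  proof (induction ws)
    case (Cons s ws)
    then show ?case
      using mult[of s "foldr (mult ?F) ws (one ?F)"] K[of s] by fastforce
  qed (simp add: free_group_def)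
  have closed: "foldr (mult ?F) ws (one ?F) \<in> carrier ?F" if "set ws \<subseteq> ?S" for ws
    using that S by (induction ws) auto
  have app: "foldr (mult ?F) (us @ vs) (one ?F) = foldr (mult ?F) us (one ?F) \<otimes>\<^bsub>?F\<^esub> foldr (mult ?F) vs (one ?F)"
    if "set us \<subseteq> ?S" "set vs \<subseteq> ?S" for us vs
    using that
  proof (induction us)
    case Nil
    then show ?case using closed[of vs] by simp
  next
    case (Cons s us)
    then have "s \<in> carrier ?F" using S by auto
    with Cons closed[of us] closed[of vs] show ?case by (simp add: F.m_assoc)
  qed
  \<comment> \<open>\<open>word_length\<close> is a least number, whose defining property is
    available only once some word for the element exists.\<close>
  have ex: "\<exists>ws. set ws \<subseteq> ?S \<and> foldr (mult ?F) ws (one ?F) = w" if "w \<in> generate ?F S" for w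
    using that
  proof induction
    case one
    show ?case by (rule exI[of _ "[]"]) simp
  next
    case (incl h)
    then show ?case using S by (intro exI[of _ "[h]"]) auto
  next
    case (inv h)
    then show ?case using S by (intro exI[of _ "[inv\<^bsub>?F\<^esub> h]"]) auto
  next
    case (eng h1 h2)
    then obtain us vs where "set us \<subseteq> ?S" "set vs \<subseteq> ?S"
      "foldr (mult ?F) us (one ?F) = h1" "foldr (mult ?F) vs (one ?F) = h2" by blast
    then show ?case using app[of us vs] by (intro exI[of _ "us @ vs"]) auto
  qed
  show ?thesis
  proof
    fix w assume "w \<in> carrier ?F"
    then obtain ws0 where ws0: "set ws0 \<subseteq> ?S" "foldr (mult ?F) ws0 (one ?F) = w"
      using ex gen by blast
    let ?P = "\<lambda>k. \<exists>ws. length ws = k \<and> set ws \<subseteq> ?S \<and> foldr (mult ?F) ws (one ?F) = w"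
    have "?P (word_length ?F S w)"
      unfolding word_length_def by (rule LeastI[of ?P "length ws0"]) (use ws0 in blast)
    then show "length w \<le> K * word_length ?F S w" using words by metis
  qed
qed


section \<open>Fundamental domains\<close>

text \<open>The group coordinate of \<open>x\<close> in the tiling by translates of
  \<open>D\<close>, up to inversion: \<open>x\<close> lies in the translate by the inverse of this
  element.\<close>

definition return_element :: "('a, 'm) monoid_scheme \<Rightarrow> ('a \<Rightarrow> 'x \<Rightarrow> 'x) \<Rightarrow> 'x set \<Rightarrow> 'x \<Rightarrow> 'a" where
  "return_element G \<phi> D x = (THE g. g \<in> carrier G \<and> \<phi> g x \<in> D)"

lemma coupling_cocycle_return_element:
  "coupling_cocycle H \<psi> D \<phi> g x = return_element H \<psi> D (\<phi> g x)"
  by (simp add: coupling_cocycle_def return_element_def)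

locale fundamental_domain =
  fixes G :: "('a, 'm) monoid_scheme" (structure) and M :: "'x measure" and \<phi> D
  assumes countable_carrier: "countable (carrier G)"
    and preserving: "measure_preserving_action G M \<phi>"
    and domain: "finite_fundamental_domain G M \<phi> D"

sublocale fundamental_domain \<subseteq> group_action G "space M" \<phi>
  using preserving by (simp add: measure_preserving_action_def)

sublocale fundamental_domain \<subseteq> group G
  using group_hom by (simp add: group_hom_def)

context fundamental_domain
begin

abbreviation ret :: "'x \<Rightarrow> 'a" where "ret \<equiv> return_element G \<phi> D"

lemma D_sets: "D \<in> sets M" and D_finite: "emeasure M D < \<infinity>" and D_subset: "D \<subseteq> space M"
  using domain sets.sets_into_space by (auto simp: finite_fundamental_domain_def)

lemma action_closed: "g \<in> carrier G \<Longrightarrow> x \<in> space M \<Longrightarrow> \<phi> g x \<in> space M"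
  using element_image by blast

lemma action_measurable [measurable (raw)]: "g \<in> carrier G \<Longrightarrow> \<phi> g \<in> measurable M M"
  and action_distr: "g \<in> carrier G \<Longrightarrow> distr M M (\<phi> g) = M"
  using preserving by (auto simp: measure_preserving_action_def)

lemma action_inv: "g \<in> carrier G \<Longrightarrow> x \<in> space M \<Longrightarrow> \<phi> (inv g) (\<phi> g x) = x"
  "g \<in> carrier G \<Longrightarrow> x \<in> space M \<Longrightarrow> \<phi> g (\<phi> (inv g) x) = x"
  using orbit_sym_aux[of g x] orbit_sym_aux[of "inv g" x] by simp_all

lemma return_unique:
  assumes "x \<in> space M" and g: "g \<in> carrier G" "\<phi> g x \<in> D" and h: "h \<in> carrier G" "\<phi> h x \<in> D"
  shows "g = h"
proof -
  have "x \<in> \<phi> (inv k) ` D" if "k \<in> carrier G" "\<phi> k x \<in> D" for k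
    using that action_inv(1)[of k x] assms(1) by (metis imageI)
  with g h have "x \<in> \<phi> (inv g) ` D \<inter> \<phi> (inv h) ` D" by blast
  then have "inv g = inv h"
    using domain g h unfolding finite_fundamental_domain_def disjoint_family_on_def
    by (metis empty_iff inv_closed)
  then show ?thesis using g h inv_inj by (metis inv_inv)
qed

lemma return_element_properties:
  assumes x: "x \<in> space M"
  shows "ret x \<in> carrier G" "\<phi> (ret x) x \<in> D"
proof -
  obtain k y where k: "k \<in> carrier G" "y \<in> D" "x = \<phi> k y"
    using x domain unfolding finite_fundamental_domain_def by blast
  then have "\<phi> (inv k) x \<in> D" using action_inv(1) D_subset by auto
  then have "\<exists>!g. g \<in> carrier G \<and> \<phi> g x \<in> D"
    using k(1) return_unique[OF x] by (intro ex1I[of _ "inv k"]) auto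
  from theI'[OF this] show "ret x \<in> carrier G" "\<phi> (ret x) x \<in> D"
    by (simp_all add: return_element_def)
qed

lemma return_element_eq_iff:
  assumes "x \<in> space M" "g \<in> carrier G"
  shows "ret x = g \<longleftrightarrow> \<phi> g x \<in> D"
  using assms return_unique return_element_properties by metis

text \<open>Undo \<open>k\<close>, then return. Hence the inverse of the return element transforms
  by left multiplication.\<close>

lemma return_element_action:
  assumes x: "x \<in> space M" and k: "k \<in> carrier G"
  shows "ret (\<phi> k x) = ret x \<otimes> inv k"
proof -
  have "\<phi> (ret x \<otimes> inv k) (\<phi> k x) \<in> D"
    using composition_rule[of "\<phi> k x" "ret x" "inv k"] x k
    by (simp add: action_closed return_element_properties action_inv)
  then show ?thesis
    using return_element_eq_iff x k by (simp add: action_closed return_element_properties)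
qed

lemma return_element_measurable [measurable]: "ret \<in> measurable M (count_space (carrier G))"
proof (subst measurable_count_space_eq_countable[OF countable_carrier], intro conjI ballI)
  show "ret \<in> space M \<rightarrow> carrier G" using return_element_properties by blast
  fix g assume g: "g \<in> carrier G"
  then have "ret -` {g} \<inter> space M = \<phi> g -` D \<inter> space M"
    using return_element_eq_iff by blast
  then show "ret -` {g} \<inter> space M \<in> sets M"
    using measurable_sets[OF action_measurable[OF g] D_sets] by simp
qed

text \<open>Countably many preimages of \<open>D\<close>, all of the measure of \<open>D\<close>,
  cover the space. Positive measure is needed to take averages over \<open>D\<close>.\<close>

lemma emeasure_domain_nonzero:
  assumes "emeasure M (space M) \<noteq> 0"
  shows "emeasure M D \<noteq> 0"
proof
  assume D: "emeasure M D = 0"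
  let ?A = "\<lambda>g. \<phi> g -` D \<inter> space M"
  have A: "?A g \<in> null_sets M" if g: "g \<in> carrier G" for g
  proof (rule null_setsI)
    show "?A g \<in> sets M" using g D_sets by (rule measurable_sets[OF action_measurable])
    show "emeasure M (?A g) = 0"
      using emeasure_distr[OF action_measurable[OF g] D_sets] D by (simp add: action_distr g)
  qed
  have "space M \<subseteq> (\<Union>g\<in>carrier G. ?A g)"
    using return_element_properties by blast
  moreover have "(\<Union>g\<in>carrier G. ?A g) \<in> null_sets M"
    using countable_carrier A by (rule null_sets_UN')
  ultimately have "space M \<in> null_sets M"
    by (meson null_sets_subset sets.top)
  with assms show False by auto
qed

end

lemma measurable_countable_ternary:
  fixes e :: "'b \<Rightarrow> 'b \<Rightarrow> 'b \<Rightarrow> real"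
  assumes "countable A" and "p \<in> measurable M (count_space A)" "q \<in> measurable M (count_space A)"
    "r \<in> measurable M (count_space A)"
  shows "(\<lambda>x. e (p x) (q x) (r x)) \<in> borel_measurable M"
  by (rule measurable_compose_countable'[OF _ assms(2,1)],
      rule measurable_compose_countable'[OF _ assms(3,1)],
      rule measurable_compose_countable'[OF _ assms(4,1)]) simp


section \<open>Bounded cocycles of groups coupled to a free group\<close>

text \<open>The cocycle is homogeneous, a function of triples of vertices rather than of pairs of
  group elements, so that it can be pulled back along an equivariant map.\<close>

locale free_group_coupling =
  fixes n :: nat and H :: "('b, 'm) monoid_scheme" and M :: "'x measure" and \<phi> \<psi> D E
    and e :: "'b \<Rightarrow> 'b \<Rightarrow> 'b \<Rightarrow> real" and C :: real
  assumes coupling: "measure_equivalence_coupling (free_group n) H M \<phi> \<psi> D E"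
    and bounded: "\<And>x y z. \<bar>e x y z\<bar> \<le> C"
    and alternating: "\<And>x y z. e x z y = - e x y z"
    and cocycle: "\<And>x y z w. \<lbrakk>x \<in> carrier H; y \<in> carrier H; z \<in> carrier H; w \<in> carrier H\<rbrakk> \<Longrightarrow>
        e y z w - e x z w + e x y w - e x y z = 0"
    and invariant: "\<And>h x y z. \<lbrakk>h \<in> carrier H; x \<in> carrier H; y \<in> carrier H; z \<in> carrier H\<rbrakk> \<Longrightarrow>
        e (h \<otimes>\<^bsub>H\<^esub> x) (h \<otimes>\<^bsub>H\<^esub> y) (h \<otimes>\<^bsub>H\<^esub> z) = e x y z"

sublocale free_group_coupling \<subseteq> F: fundamental_domain "free_group n" M \<phi> D
  using coupling by (simp add: measure_equivalence_coupling_def fundamental_domain_def)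

sublocale free_group_coupling \<subseteq> H: fundamental_domain H M \<psi> E
  using coupling by (simp add: measure_equivalence_coupling_def fundamental_domain_def)

context free_group_coupling
begin

abbreviation "F \<equiv> free_group n"

lemma commute: "g \<in> carrier F \<Longrightarrow> h \<in> carrier H \<Longrightarrow> x \<in> space M \<Longrightarrow> \<phi> g (\<psi> h x) = \<psi> h (\<phi> g x)"
  using coupling by (simp add: measure_equivalence_coupling_def)

text \<open>The \<open>H\<close>-coordinate: \<open>x\<close> lies in the translate of
  \<open>E\<close> by \<open>d x\<close>. By equivariance the pullback of \<open>e\<close> along
  \<open>d\<close> is invariant under \<psi>.\<close>

definition d :: "'x \<Rightarrow> 'b" where "d x = inv\<^bsub>H\<^esub> (H.ret x)"

lemma d_closed: "x \<in> space M \<Longrightarrow> d x \<in> carrier H"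
  by (simp add: d_def H.return_element_properties)

lemma d_action: "x \<in> space M \<Longrightarrow> h \<in> carrier H \<Longrightarrow> d (\<psi> h x) = h \<otimes>\<^bsub>H\<^esub> d x"
  by (simp add: d_def H.return_element_action H.return_element_properties H.inv_mult_group)

lemma d_measurable [measurable]: "d \<in> measurable M (count_space (carrier H))"
proof -
  have "m_inv H \<in> measurable (count_space (carrier H)) (count_space (carrier H))"
    by simp
  from measurable_compose[OF H.return_element_measurable this] show ?thesis
    by (simp add: d_def[abs_def])
qed

section \<open>The induced measure-preserving action on the fundamental domain\<close>

definition \<beta> :: "'b \<Rightarrow> 'x \<Rightarrow> letter list" where "\<beta> h y = F.ret (\<psi> h y)"

text \<open>The action of \<open>H\<close> on the space of orbits of the free group, each orbit
  being represented by its point in \<open>D\<close>.\<close>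

definition induced :: "'b \<Rightarrow> 'x \<Rightarrow> 'x" where "induced h y = \<phi> (\<beta> h y) (\<psi> h y)"

lemma \<beta>_closed: "h \<in> carrier H \<Longrightarrow> y \<in> space M \<Longrightarrow> \<beta> h y \<in> carrier F"
  by (simp add: \<beta>_def F.return_element_properties H.action_closed)

lemma induced_in_D: "h \<in> carrier H \<Longrightarrow> y \<in> space M \<Longrightarrow> induced h y \<in> D"
  by (simp add: \<beta>_def induced_def F.return_element_properties H.action_closed)

lemma induced_closed: "h \<in> carrier H \<Longrightarrow> y \<in> space M \<Longrightarrow> induced h y \<in> space M"
  using induced_in_D F.D_subset by blast

text \<open>Because the actions commute, returning to \<open>D\<close> after \<open>k\<close> and
  again after \<open>h\<close> is a single return after the product; uniqueness of the return
  element identifies it.\<close>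

lemma \<beta>_mult:
  assumes "h \<in> carrier H" "k \<in> carrier H" "y \<in> space M"
  shows "\<beta> (h \<otimes>\<^bsub>H\<^esub> k) y = \<beta> h (induced k y) \<otimes>\<^bsub>F\<^esub> \<beta> k y"
    and "induced (h \<otimes>\<^bsub>H\<^esub> k) y = induced h (induced k y)"
proof -
  let ?g = "\<beta> h (induced k y)" and ?g' = "\<beta> k y"
  have c: "?g \<in> carrier F" "?g' \<in> carrier F" "\<psi> k y \<in> space M" "induced k y \<in> space M"
    using assms by (simp_all add: \<beta>_closed induced_closed H.action_closed)
  have "\<phi> (?g \<otimes>\<^bsub>F\<^esub> ?g') (\<psi> (h \<otimes>\<^bsub>H\<^esub> k) y) = \<phi> ?g (\<phi> ?g' (\<psi> h (\<psi> k y)))"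
    using assms c by (simp add: H.composition_rule F.composition_rule H.action_closed)
  also have "\<dots> = induced h (induced k y)"
    using assms c by (simp add: commute induced_def)
  finally have eq: "\<phi> (?g \<otimes>\<^bsub>F\<^esub> ?g') (\<psi> (h \<otimes>\<^bsub>H\<^esub> k) y) = induced h (induced k y)" .
  then have "\<phi> (?g \<otimes>\<^bsub>F\<^esub> ?g') (\<psi> (h \<otimes>\<^bsub>H\<^esub> k) y) \<in> D"
    using assms by (simp add: induced_in_D induced_closed)
  then show 1: "\<beta> (h \<otimes>\<^bsub>H\<^esub> k) y = ?g \<otimes>\<^bsub>F\<^esub> ?g'"
    unfolding \<beta>_def[of "h \<otimes>\<^bsub>H\<^esub> k"] using assms c
    by (subst F.return_element_eq_iff) (simp_all add: H.action_closed)
  show "induced (h \<otimes>\<^bsub>H\<^esub> k) y = induced h (induced k y)"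
    unfolding induced_def[of "h \<otimes>\<^bsub>H\<^esub> k"] 1 by (rule eq)
qed

abbreviation N :: "'x measure" where "N \<equiv> restrict_space M D"

lemma space_N: "space N = D"
  using F.D_subset by (simp add: space_restrict_space Int_absorb2)

lemma sets_N: "A \<in> sets N \<longleftrightarrow> A \<in> sets M \<and> A \<subseteq> D"
  using F.D_sets by (subst sets_restrict_space_iff) (auto simp: Int_absorb2 F.D_subset)

lemma \<beta>_measurable: "h \<in> carrier H \<Longrightarrow> \<beta> h \<in> measurable M (count_space (carrier F))"
  unfolding \<beta>_def[abs_def]
  by (rule measurable_compose[OF H.action_measurable F.return_element_measurable])

lemma induced_measurable: "h \<in> carrier H \<Longrightarrow> induced h \<in> measurable M M"
  unfolding induced_def[abs_def]
  by (rule measurable_compose_countable'[OF _ \<beta>_measurable F.countable_carrier])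
    (auto intro: measurable_compose[OF H.action_measurable F.action_measurable])

text \<open>On each set where \<beta> is constant, \<open>induced h\<close> is a composite of two
  measure-preserving maps. Cutting \<open>A\<close> and its preimage into the countably many
  corresponding pieces gives pairs of equal measure.\<close>

lemma induced_distr:
  assumes h: "h \<in> carrier H"
  shows "induced h \<in> measurable N N" "distr N N (induced h) = N"
proof -
  show meas: "induced h \<in> measurable N N"
    using h by (intro measurable_restrict_space3 induced_measurable)
      (auto simp: induced_in_D F.D_subset[THEN subsetD])
  show "distr N N (induced h) = N"
  proof (rule measure_eqI)
    fix A assume "A \<in> sets (distr N N (induced h))"
    then have A: "A \<in> sets M" "A \<subseteq> D" "A \<in> sets N" by (simp_all add: sets_N)
    \<comment> \<open>\<open>?T g\<close> carries \<open>?P g\<close> onto \<open>?Q g\<close>, with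
      inverse \<open>?S g\<close>.\<close>
    let ?T = "\<lambda>g x. \<phi> g (\<psi> h x)" and ?S = "\<lambda>g x. \<phi> (inv\<^bsub>F\<^esub> g) (\<psi> (inv\<^bsub>H\<^esub> h) x)"
    let ?P = "\<lambda>g. D \<inter> (?T g -` A \<inter> space M)" and ?Q = "\<lambda>g. A \<inter> (?S g -` D \<inter> space M)"
    have T: "?T g \<in> measurable M M" "?S g \<in> measurable M M" "distr M M (?T g) = M"
      if g: "g \<in> carrier F" for g
    proof -
      show "?T g \<in> measurable M M" "?S g \<in> measurable M M"
        using g h by (auto intro!: measurable_compose[OF H.action_measurable F.action_measurable])
      have "distr M M (?T g) = distr (distr M M (\<psi> h)) M (\<phi> g)"
        using g h by (subst distr_distr) (auto simp: o_def F.action_measurable H.action_measurable)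
      then show "distr M M (?T g) = M" using g h by (simp add: F.action_distr H.action_distr)
    qed
    have PQ: "?P g \<in> sets M" "?Q g \<in> sets M" "emeasure M (?P g) = emeasure M (?Q g)"
      if g: "g \<in> carrier F" for g
    proof -
      show *: "?P g \<in> sets M" "?Q g \<in> sets M"
        using measurable_sets[OF T(1)[OF g] A(1)] measurable_sets[OF T(2)[OF g] F.D_sets]
          A F.D_sets by auto
      have ST: "?S g (?T g x) = x" if "x \<in> space M" for x
        using that g h
        by (simp add: commute F.action_closed H.action_closed F.action_inv H.action_inv)
      have "emeasure M (?Q g) = emeasure (distr M M (?T g)) (?Q g)" using T g by simp
      also have "\<dots> = emeasure M (?T g -` ?Q g \<inter> space M)"
        by (rule emeasure_distr[OF T(1)[OF g] *(2)])
      also have "?T g -` ?Q g \<inter> space M = ?P g"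
        using ST g h F.D_subset by (auto simp: F.action_closed H.action_closed)
      finally show "emeasure M (?P g) = emeasure M (?Q g)" by simp
    qed
    have P: "?P g = {y \<in> D. \<beta> h y = g \<and> induced h y \<in> A}" if g: "g \<in> carrier F" for g
    proof -
      have "?T g y \<in> A \<longleftrightarrow> \<beta> h y = g \<and> induced h y \<in> A" if "y \<in> D" for y
      proof -
        have "\<psi> h y \<in> space M" using that h F.D_subset by (auto simp: H.action_closed)
        from F.return_element_eq_iff[OF this g] show ?thesis
          using A(2) by (auto simp: \<beta>_def induced_def)
      qed
      then show ?thesis using F.D_subset by auto
    qed
    have Q: "?Q g = {y \<in> A. F.ret (\<psi> (inv\<^bsub>H\<^esub> h) y) = inv\<^bsub>F\<^esub> g}" if g: "g \<in> carrier F" for g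
      using A(2) g h F.D_subset
      by (auto simp: F.return_element_eq_iff H.action_closed)
    have "emeasure (distr N N (induced h)) A = emeasure N (induced h -` A \<inter> D)"
      using emeasure_distr[OF meas A(3)] by (simp add: space_N)
    also have "\<dots> = emeasure M (induced h -` A \<inter> D)"
      using F.D_sets F.D_subset by (intro emeasure_restrict_space) auto
    also have "induced h -` A \<inter> D = (\<Union>g\<in>carrier F. ?P g)"
      using P \<beta>_closed[OF h] F.D_subset by auto
    also have "emeasure M \<dots> = (\<integral>\<^sup>+g. emeasure M (?P g) \<partial>count_space (carrier F))"
      using PQ P F.countable_carrier
      by (intro emeasure_UN_countable) (auto simp: disjoint_family_on_def)
    also have "\<dots> = (\<integral>\<^sup>+g. emeasure M (?Q g) \<partial>count_space (carrier F))"
      using PQ by (intro nn_integral_cong) auto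
    also have "\<dots> = emeasure M (\<Union>g\<in>carrier F. ?Q g)"
      using PQ Q F.countable_carrier
      by (intro emeasure_UN_countable[symmetric])
        (auto simp: disjoint_family_on_def dest!: F.inv_inj[THEN inj_onD])
    also have "(\<Union>g\<in>carrier F. ?Q g) = A"
    proof -
      have "y \<in> ?Q (inv\<^bsub>F\<^esub> (F.ret (\<psi> (inv\<^bsub>H\<^esub> h) y)))" if "y \<in> A" for y
        using that A(2) F.D_subset h
        by (subst Q) (auto simp: F.return_element_properties H.action_closed subset_iff)
      moreover have "inv\<^bsub>F\<^esub> (F.ret (\<psi> (inv\<^bsub>H\<^esub> h) y)) \<in> carrier F" if "y \<in> A" for y
        using that A(2) F.D_subset h
        by (auto simp: F.return_element_properties H.action_closed subset_iff)
      ultimately show ?thesis by blast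
    qed
    also have "emeasure M A = emeasure N A"
      using A F.D_sets F.D_subset by (subst emeasure_restrict_space) (auto simp: Int_absorb2)
    finally show "emeasure (distr N N (induced h)) A = emeasure N A" .
  qed simp
qed

text \<open>
  The primitive of the cocycle along the tree moves \<open>\<psi> h y\<close> to \<open>induced h y\<close>; the bounded correction
  is the prism operator comparing \<open>d\<close> with the constant map to the unit.
\<close>

sublocale tree: free_group_orbit_cocycle n "space M" \<phi> "\<lambda>x y z. e (d x) (d y) (d z)"
  by unfold_locales (simp add: cocycle d_closed, rule alternating)

definition transfer :: "'b \<Rightarrow> 'x \<Rightarrow> real" where
  "transfer h y = tree.primitive (\<beta> h y) (\<psi> h y)
     - (e h (h \<otimes>\<^bsub>H\<^esub> d y) (d (induced h y)) - e h \<one>\<^bsub>H\<^esub> (d (induced h y)))"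

text \<open>The primitive contributes \<open>e\<close> on the triangle \<open>?q0 ?q1 ?q2\<close> of
  values of \<open>d\<close>; the corrections are the walls of a prism from this triangle to
  \<open>?p0 ?p1 ?p2\<close>. The outcome no longer depends on \<open>y\<close>, so integration over
  \<open>D\<close> keeps it up to a factor.\<close>

lemma transfer_mult:
  assumes h: "h \<in> carrier H" and k: "k \<in> carrier H" and y: "y \<in> space M"
  shows "transfer k y + transfer h (induced k y) - transfer (h \<otimes>\<^bsub>H\<^esub> k) y = e (h \<otimes>\<^bsub>H\<^esub> k) h \<one>\<^bsub>H\<^esub>"
proof -
  let ?z = "induced k y" and ?x = "\<psi> (h \<otimes>\<^bsub>H\<^esub> k) y"
  have c: "\<beta> h ?z \<in> carrier F" "\<beta> k y \<in> carrier F" "\<psi> k y \<in> space M" "?z \<in> space M"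
    "?x \<in> space M" "\<psi> h ?z \<in> space M" "induced h ?z \<in> space M"
    using assms by (simp_all add: \<beta>_closed induced_closed H.action_closed)
  have x: "?x = \<psi> h (\<psi> k y)" using assms by (simp add: H.composition_rule)
  have xz: "\<phi> (\<beta> k y) ?x = \<psi> h ?z"
    using c h by (simp add: x commute induced_def)
  have iz: "\<phi> (\<beta> h ?z \<otimes>\<^bsub>F\<^esub> \<beta> k y) ?x = induced h ?z"
    using c by (simp add: F.composition_rule xz induced_def[of h])
  \<comment> \<open>\<open>transfer k y\<close> starts its path at \<open>\<psi> k y\<close>, the
    multiplication rule starts it at \<open>?x\<close>; the two starting points differ by
    \<open>\<psi> h\<close>.\<close>
  have "tree.primitive (\<beta> k y) ?x = tree.primitive (\<beta> k y) (\<psi> k y)"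
    unfolding x using c h
    by (intro tree.primitive_invariant[where s = "\<psi> h"])
      (auto simp: commute d_action invariant d_closed)
  then have "tree.primitive (\<beta> (h \<otimes>\<^bsub>H\<^esub> k) y) ?x
      = tree.primitive (\<beta> k y) (\<psi> k y) + tree.primitive (\<beta> h ?z) (\<psi> h ?z)
        - e (d ?x) (d (\<psi> h ?z)) (d (induced h ?z))"
    using tree.primitive_mult[OF c(1,2,5)] assms by (simp add: \<beta>_mult(1) xz iz)
  moreover
  let ?p0 = "h \<otimes>\<^bsub>H\<^esub> k" and ?p1 = h and ?p2 = "\<one>\<^bsub>H\<^esub>"
  let ?q0 = "(h \<otimes>\<^bsub>H\<^esub> k) \<otimes>\<^bsub>H\<^esub> d y" and ?q1 = "h \<otimes>\<^bsub>H\<^esub> d ?z" and ?q2 = "d (induced h ?z)"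
  have m: "?p0 \<in> carrier H" "?p1 \<in> carrier H" "?p2 \<in> carrier H"
    "?q0 \<in> carrier H" "?q1 \<in> carrier H" "?q2 \<in> carrier H"
    using assms c by (simp_all add: d_closed)
  have q: "d ?x = ?q0" "d (\<psi> h ?z) = ?q1"
    using assms c by (simp_all add: d_action)
  have i: "e k (k \<otimes>\<^bsub>H\<^esub> d y) (d ?z) = e ?p0 ?q0 ?q1" "e k \<one>\<^bsub>H\<^esub> (d ?z) = e ?p0 ?p1 ?q1"
    using invariant[of h k "k \<otimes>\<^bsub>H\<^esub> d y" "d ?z"] invariant[of h k "\<one>\<^bsub>H\<^esub>" "d ?z"] assms c
    by (simp_all add: d_closed H.m_assoc)
  \<comment> \<open>The prism is cut into the tetrahedra \<open>p0 q0 q1 q2\<close>,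
    \<open>p0 p1 q1 q2\<close> and \<open>p0 p1 p2 q2\<close>.\<close>
  have "e ?q0 ?q1 ?q2 - e ?p0 ?p1 ?p2 = (e ?p0 ?q0 ?q1 - e ?p0 ?p1 ?q1)
      + (e ?p1 ?q1 ?q2 - e ?p1 ?p2 ?q2) - (e ?p0 ?q0 ?q2 - e ?p0 ?p2 ?q2)"
    using cocycle[OF m(1,4,5,6)] cocycle[OF m(1,2,5,6)] cocycle[OF m(1,2,3,6)] by simp
  ultimately show ?thesis
    using assms by (simp add: transfer_def \<beta>_mult(2) i q)
qed

lemma transfer_measurable:
  assumes h: "h \<in> carrier H"
  shows "transfer h \<in> borel_measurable M"
proof -
  have ternary: "(\<lambda>x. e (p x) (q x) (r x)) \<in> borel_measurable M"
    if "p \<in> measurable M (count_space (carrier H))" "q \<in> measurable M (count_space (carrier H))"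
      "r \<in> measurable M (count_space (carrier H))" for p q r
    using H.countable_carrier that by (rule measurable_countable_ternary)
  have prim: "tree.primitive w \<in> borel_measurable M" if "w \<in> carrier F" for w
    using that
  proof (induction w)
    case Nil
    then show ?case by (simp add: tree.primitive.simps(1)[abs_def])
  next
    case (Cons a w)
    note w = tree.reduced_tl(1)[OF Cons.prems]
    have "(\<lambda>x. e (d x) (d (\<phi> w x)) (d (\<phi> (a # w) x))) \<in> borel_measurable M"
      using w Cons.prems
      by (intro ternary measurable_compose[OF F.action_measurable d_measurable] d_measurable)
    with Cons.IH[OF w] show ?case
      by (simp add: tree.primitive.simps(2)[abs_def])
  qed
  have "(\<lambda>y. tree.primitive (\<beta> h y) (\<psi> h y)) \<in> borel_measurable M"
    by (rule measurable_compose_countable'[where f = "\<lambda>w y. tree.primitive w (\<psi> h y)",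
          OF _ \<beta>_measurable[OF h] F.countable_carrier])
      (rule measurable_compose[OF H.action_measurable[OF h] prim])
  moreover have "(\<lambda>y. d (induced h y)) \<in> measurable M (count_space (carrier H))"
    by (rule measurable_compose[OF induced_measurable[OF h] d_measurable])
  moreover have "(\<lambda>y. h \<otimes>\<^bsub>H\<^esub> d y) \<in> measurable M (count_space (carrier H))"
    by (rule measurable_compose[OF d_measurable]) (use h in auto)
  ultimately show ?thesis
    unfolding transfer_def[abs_def] using h
    by (intro borel_measurable_diff ternary measurable_const) auto
qed

text \<open>Here the L^1 condition is spent: the primitive is at most \<open>C * K\<close> times the
  word length of \<beta>, the prism correction at most \<open>2 * C\<close>, and \<open>D\<close>
  has finite measure.\<close>

lemma transfer_integrable:
  assumes S: "finite_generating_set F S" and h: "h \<in> carrier H"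
    and int: "(\<integral>\<^sup>+y\<in>D. of_nat (word_length F S (coupling_cocycle F \<phi> D \<psi> h y)) \<partial>M) < \<infinity>"
  shows "integrable N (transfer h)"
proof -
  obtain K where K: "\<And>w. w \<in> carrier F \<Longrightarrow> length w \<le> K * word_length F S w"
    using length_le_word_length[OF S] by blast
  have C: "0 \<le> C" using bounded[of undefined undefined undefined] by linarith
  let ?l = "\<lambda>y. word_length F S (\<beta> h y)"
  have le: "\<bar>transfer h y\<bar> \<le> C * K * ?l y + 2 * C" if y: "y \<in> D" for y
  proof -
    have "y \<in> space M" using y F.D_subset by blast
    then have "real (length (\<beta> h y)) \<le> real (K * ?l y)"
      using K[OF \<beta>_closed[OF h]] by (intro of_nat_mono)
    then have "\<bar>tree.primitive (\<beta> h y) (\<psi> h y)\<bar> \<le> C * real (K * ?l y)"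
      using tree.abs_primitive_le[of C "\<beta> h y" "\<psi> h y"] bounded C
      by (meson mult_left_mono order_trans)
    then show ?thesis
      using bounded[of h "h \<otimes>\<^bsub>H\<^esub> d y" "d (induced h y)"] bounded[of h "\<one>\<^bsub>H\<^esub>" "d (induced h y)"]
      by (simp add: transfer_def mult.assoc)
  qed
  have meas: "(\<lambda>y. ennreal (real (?l y))) \<in> borel_measurable N"
    by (rule measurable_restrict_space1, rule measurable_compose[OF \<beta>_measurable[OF h]]) simp
  have "(\<integral>\<^sup>+y. ennreal (norm (transfer h y)) \<partial>N)
      \<le> (\<integral>\<^sup>+y. ennreal (C * K) * ennreal (?l y) + ennreal (2 * C) \<partial>N)"
    using le C by (intro nn_integral_mono)
      (simp add: space_N ennreal_mult[symmetric] ennreal_plus[symmetric] del: ennreal_plus)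
  also have "\<dots> = ennreal (C * K) * (\<integral>\<^sup>+y. ennreal (?l y) \<partial>N) + ennreal (2 * C) * emeasure N D"
  proof -
    have "(\<lambda>y. ennreal (C * K) * ennreal (?l y)) \<in> borel_measurable N" using meas by simp
    then show ?thesis by (simp add: nn_integral_add nn_integral_cmult[OF meas] space_N)
  qed
  also have "(\<integral>\<^sup>+y. ennreal (?l y) \<partial>N) = (\<integral>\<^sup>+y\<in>D. of_nat (?l y) \<partial>M)"
    using F.D_sets F.D_subset
    by (subst nn_integral_restrict_space) (auto simp: Int_absorb2 ennreal_of_nat_eq_real_of_nat)
  also have "\<dots> = (\<integral>\<^sup>+y\<in>D. of_nat (word_length F S (coupling_cocycle F \<phi> D \<psi> h y)) \<partial>M)"
    by (simp add: \<beta>_def coupling_cocycle_return_element)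
  also have "emeasure N D = emeasure M D"
    using F.D_sets F.D_subset by (intro emeasure_restrict_space) (auto simp: Int_absorb2)
  finally have "(\<integral>\<^sup>+y. ennreal (norm (transfer h y)) \<partial>N) < \<infinity>"
    using int F.D_finite by (auto simp: ennreal_mult_less_top elim!: order.strict_trans1)
  then show ?thesis
    using measurable_restrict_space1[OF transfer_measurable[OF h]] by (intro integrableI_bounded)
qed

text \<open>The mean of \<open>transfer\<close> over \<open>D\<close> serves as \<open>b\<close>:
  since \<open>induced k\<close> preserves the measure, \<open>transfer h\<close> and its composite
  with \<open>induced k\<close> have the same mean.\<close>

lemma bounded_cocycle_is_coboundary:
  assumes S: "finite_generating_set F S"
    and int: "\<And>h. h \<in> carrier H \<Longrightarrow>
        (\<integral>\<^sup>+y\<in>D. of_nat (word_length F S (coupling_cocycle F \<phi> D \<psi> h y)) \<partial>M) < \<infinity>"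
  obtains b where "\<And>h k. h \<in> carrier H \<Longrightarrow> k \<in> carrier H \<Longrightarrow>
      e (h \<otimes>\<^bsub>H\<^esub> k) h \<one>\<^bsub>H\<^esub> = b h + b k - b (h \<otimes>\<^bsub>H\<^esub> k)"
proof
  let ?I = "\<lambda>h. \<integral>y. transfer h y \<partial>N" and ?m = "measure N D"
  have "emeasure N D = emeasure M D"
    using F.D_sets F.D_subset by (intro emeasure_restrict_space) (auto simp: Int_absorb2)
  moreover have "emeasure M D \<noteq> 0"
    using coupling F.emeasure_domain_nonzero by (simp add: measure_equivalence_coupling_def)
  ultimately have m: "?m \<noteq> 0"
    using F.D_finite by (auto simp: measure_def enn2real_eq_0_iff)
  fix h k assume h: "h \<in> carrier H" and k: "k \<in> carrier H"
  have hk: "h \<otimes>\<^bsub>H\<^esub> k \<in> carrier H" using h k by simp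
  have i: "integrable N (transfer g)" if "g \<in> carrier H" for g
    using transfer_integrable[OF S that int[OF that]] .
  have "integrable (distr N N (induced k)) (transfer h)"
    using i[OF h] by (simp add: induced_distr k)
  then have ik: "integrable N (\<lambda>y. transfer h (induced k y))"
    using integrable_distr_eq[OF induced_distr(1)[OF k], of "transfer h"] i[OF h] by auto
  have "?I h = (\<integral>y. transfer h (induced k y) \<partial>N)"
    using integral_distr[OF induced_distr(1)[OF k], of "transfer h"] i[OF h]
    by (simp add: induced_distr k)
  then have "?I k + ?I h - ?I (h \<otimes>\<^bsub>H\<^esub> k)
      = (\<integral>y. transfer k y + transfer h (induced k y) - transfer (h \<otimes>\<^bsub>H\<^esub> k) y \<partial>N)"
    using i[OF h] i[OF k] i[OF hk] ik by simp
  also have "\<dots> = (\<integral>y. e (h \<otimes>\<^bsub>H\<^esub> k) h \<one>\<^bsub>H\<^esub> \<partial>N)"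
    using h k F.D_subset by (intro Bochner_Integration.integral_cong) (auto simp: transfer_mult space_N)
  also have "\<dots> = ?m * e (h \<otimes>\<^bsub>H\<^esub> k) h \<one>\<^bsub>H\<^esub>" by (simp add: space_N)
  finally show "e (h \<otimes>\<^bsub>H\<^esub> k) h \<one>\<^bsub>H\<^esub> = ?I h / ?m + ?I k / ?m - ?I (h \<otimes>\<^bsub>H\<^esub> k) / ?m"
    using m by (simp add: field_simps)
qed

end


section \<open>Holonomy\<close>

text \<open>
  Parallel transport along short paths only: \<open>T x y\<close> transports from \<open>x\<close> to a point \<open>y\<close> of the
  neighbourhood \<open>U x\<close>. Such data describe a principal bundle with discrete structure group.
\<close>

locale local_transport = group G for G :: "('g, 'm) monoid_scheme" (structure) +
  fixes X :: "'a topology" and U :: "'a \<Rightarrow> 'a set" and T :: "'a \<Rightarrow> 'a \<Rightarrow> 'g"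
  assumes open_nhd: "x \<in> topspace X \<Longrightarrow> openin X (U x) \<and> x \<in> U x"
    and T_closed: "x \<in> topspace X \<Longrightarrow> y \<in> U x \<Longrightarrow> T x y \<in> carrier G"
    and T_compatible: "x \<in> topspace X \<Longrightarrow> y \<in> U x \<Longrightarrow>
        \<exists>W. openin X W \<and> y \<in> W \<and> (\<forall>z\<in>W. z \<in> U x \<and> z \<in> U y \<and> T x z = T x y \<otimes> T y z)"
begin

text \<open>A parallel section along \<open>f\<close>, written in the group. The filter omits the
  point \<open>s\<close> itself, where \<open>T_self\<close> supplies the equation.\<close>

definition flat :: "'t::topological_space set \<Rightarrow> ('t \<Rightarrow> 'a) \<Rightarrow> ('t \<Rightarrow> 'g) \<Rightarrow> bool" where
  "flat K f \<psi> \<longleftrightarrow> \<psi> \<in> K \<rightarrow> carrier G \<and>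
     (\<forall>s\<in>K. eventually (\<lambda>t. \<psi> t = \<psi> s \<otimes> T (f s) (f t)) (at s within K))"

lemma flat_closed: "flat K f \<psi> \<Longrightarrow> s \<in> K \<Longrightarrow> \<psi> s \<in> carrier G"
  by (auto simp: flat_def)

text \<open>Compatibility at \<open>y = z = x\<close> makes \<open>T x x\<close> idempotent.\<close>

lemma T_self:
  assumes "x \<in> topspace X"
  shows "T x x = \<one>"
  using open_nhd[OF assms] T_closed[OF assms, of x] T_compatible[OF assms, of x]
  by (metis l_cancel_one')

lemma eventually_in_openin:
  assumes f: "continuous_map (top_of_set K) X f" and V: "openin X V" "f s \<in> V" and "s \<in> K"
  shows "eventually (\<lambda>t. f t \<in> V) (at s within K)"
proof -
  have "openin (top_of_set K) {t \<in> K. f t \<in> V}"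
    using openin_continuous_map_preimage[OF f V(1)] by simp
  then obtain S where "open S" "{t \<in> K. f t \<in> V} = K \<inter> S"
    by (auto simp: openin_open)
  with assms(3,4) show ?thesis
    unfolding eventually_at_topological by blast
qed

lemma continuous_closed: "continuous_map (top_of_set K) X f \<Longrightarrow> s \<in> K \<Longrightarrow> f s \<in> topspace X"
  by (auto simp: continuous_map_def)

lemma eventually_nhd:
  assumes "continuous_map (top_of_set K) X f" "s \<in> K"
  shows "eventually (\<lambda>t. f t \<in> U (f s)) (at s within K)"
  using assms eventually_in_openin[of K f "U (f s)" s] open_nhd continuous_closed by blast

lemma flat_cong:
  assumes "flat K f \<psi>" "\<And>s. s \<in> K \<Longrightarrow> f s = g s" "\<And>s. s \<in> K \<Longrightarrow> \<psi> s = \<zeta> s"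
  shows "flat K g \<zeta>"
proof -
  have "eventually (\<lambda>t. \<zeta> t = \<zeta> s \<otimes> T (g s) (g t)) (at s within K)" if s: "s \<in> K" for s
  proof -
    have "eventually (\<lambda>t. \<psi> t = \<psi> s \<otimes> T (f s) (f t)) (at s within K)"
      using assms(1) s by (simp add: flat_def)
    moreover have "eventually (\<lambda>t. t \<in> K) (at s within K)"
      by (simp add: eventually_at_filter)
    ultimately show ?thesis
      by eventually_elim (use assms s in metis)
  qed
  moreover have "\<zeta> s \<in> carrier G" if "s \<in> K" for s
    using flat_closed[OF assms(1) that] assms(3)[OF that] by simp
  ultimately show ?thesis by (auto simp: flat_def)
qed

lemma flat_subset: "flat K f \<psi> \<Longrightarrow> L \<subseteq> K \<Longrightarrow> flat L f \<psi>"
  unfolding flat_def using at_le[of L K] by (blast intro: filter_leD)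

lemma flat_left_mult:
  assumes "flat K f \<psi>" "c \<in> carrier G" and f: "continuous_map (top_of_set K) X f"
  shows "flat K f (\<lambda>s. c \<otimes> \<psi> s)"
proof -
  have "eventually (\<lambda>t. c \<otimes> \<psi> t = c \<otimes> \<psi> s \<otimes> T (f s) (f t)) (at s within K)" if s: "s \<in> K" for s
  proof -
    have "eventually (\<lambda>t. \<psi> t = \<psi> s \<otimes> T (f s) (f t)) (at s within K)"
      using assms(1) s by (simp add: flat_def)
    with eventually_nhd[OF f s] show ?thesis
      by eventually_elim
        (use assms(2) s flat_closed[OF assms(1)] T_closed continuous_closed[OF f s]
          in \<open>simp add: m_assoc\<close>)
  qed
  then show ?thesis using assms by (auto simp: flat_def)
qed

text \<open>Transport acts from the right and cancels in this quotient, which is therefore locally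
  constant.\<close>

lemma flat_unique:
  assumes \<psi>: "flat K f \<psi>" and \<zeta>: "flat K f \<zeta>" and f: "continuous_map (top_of_set K) X f"
    and K: "connected K" and s: "s \<in> K" "t \<in> K"
  shows "\<zeta> s \<otimes> inv \<psi> s = \<zeta> t \<otimes> inv \<psi> t"
proof (rule connected_local_const[OF K s], intro ballI)
  fix a assume a: "a \<in> K"
  have "eventually (\<lambda>b. \<psi> b = \<psi> a \<otimes> T (f a) (f b)) (at a within K)"
    "eventually (\<lambda>b. \<zeta> b = \<zeta> a \<otimes> T (f a) (f b)) (at a within K)"
    using \<psi> \<zeta> a by (simp_all add: flat_def)
  with eventually_nhd[OF f a]
  show "eventually (\<lambda>b. \<zeta> a \<otimes> inv \<psi> a = \<zeta> b \<otimes> inv \<psi> b) (at a within K)"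
  proof eventually_elim
    case (elim b)
    have "\<psi> a \<in> carrier G" "\<zeta> a \<in> carrier G" "T (f a) (f b) \<in> carrier G"
      using a elim(1) flat_closed[OF \<psi>] flat_closed[OF \<zeta>] T_closed continuous_closed[OF f] by auto
    then show ?case
      unfolding elim by (simp add: inv_mult_group m_assoc inv_solve_left)
        (simp add: m_assoc[symmetric])
  qed
qed

text \<open>A point outside a closed set has a neighbourhood missing it, so that at each point only
  the sets containing it impose a condition.\<close>

lemma flat_Un:
  assumes "flat A f \<psi>" "flat B f \<psi>" "closed A" "closed B"
  shows "flat (A \<union> B) f \<psi>"
proof -
  have "eventually (\<lambda>t. \<psi> t = \<psi> s \<otimes> T (f s) (f t)) (at s within C)"
    if "flat C f \<psi>" "closed C" for s C
  proof (cases "s \<in> C")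
    case False
    then show ?thesis
      using that(2) unfolding eventually_at_topological by (intro exI[of _ "- C"]) auto
  qed (use that(1) in \<open>simp add: flat_def\<close>)
  from this[OF assms(1,3)] this[OF assms(2,4)] show ?thesis
    using assms by (auto simp: flat_def at_within_union eventually_sup)
qed

text \<open>On the connected overlap the two sections differ by a constant left factor, which the
  second one can absorb.\<close>

lemma flat_glue:
  assumes \<psi>: "flat A f \<psi>" and \<zeta>: "flat B f \<zeta>" and "closed A" "closed B"
    and f: "continuous_map (top_of_set (A \<union> B)) X f" and "connected (A \<inter> B)"
  shows "\<exists>\<omega>. flat (A \<union> B) f \<omega>"
proof -
  obtain c where c: "c \<in> carrier G" and eq: "\<And>s. s \<in> A \<inter> B \<Longrightarrow> \<psi> s = c \<otimes> \<zeta> s"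
  proof (cases "A \<inter> B = {}")
    case True
    then show ?thesis using that[of \<one>] by blast
  next
    case False
    then obtain s0 where s0: "s0 \<in> A \<inter> B" by blast
    let ?c = "\<psi> s0 \<otimes> inv \<zeta> s0"
    have f': "continuous_map (top_of_set (A \<inter> B)) X f"
      using f by (rule continuous_map_from_subtopology_mono) blast
    have "\<psi> s = ?c \<otimes> \<zeta> s" if s: "s \<in> A \<inter> B" for s
      using flat_unique[OF flat_subset[OF \<zeta>] flat_subset[OF \<psi>] f' assms(6) s0 s]
        flat_closed[OF \<zeta>, of s] flat_closed[OF \<psi>, of s] s
      by (simp add: m_assoc)
    then show ?thesis
      using that[of ?c] s0 flat_closed[OF \<zeta>, of s0] flat_closed[OF \<psi>, of s0] by blast
  qed
  have "flat B f (\<lambda>s. c \<otimes> \<zeta> s)"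
    using \<zeta> c by (rule flat_left_mult) (rule continuous_map_from_subtopology_mono[OF f], blast)
  then have "flat B f (\<lambda>s. if s \<in> A then \<psi> s else c \<otimes> \<zeta> s)"
    by (rule flat_cong) (use eq in auto)
  moreover have "flat A f (\<lambda>s. if s \<in> A then \<psi> s else c \<otimes> \<zeta> s)"
    using \<psi> by (rule flat_cong) auto
  ultimately show ?thesis using flat_Un assms by blast
qed

lemma flat_local:
  assumes f: "continuous_map (top_of_set K) X f" and s: "s \<in> K"
  shows "\<exists>N \<psi>. open N \<and> s \<in> N \<and> flat (K \<inter> N) f \<psi>"
proof -
  have "openin (top_of_set K) {t \<in> K. f t \<in> U (f s)}"
    using openin_continuous_map_preimage[OF f, of "U (f s)"] open_nhd continuous_closed[OF f s]
    by simp
  then obtain N where N: "open N" "{t \<in> K. f t \<in> U (f s)} = K \<inter> N"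
    by (auto simp: openin_open)
  have fN: "continuous_map (top_of_set (K \<inter> N)) X f"
    using f by (rule continuous_map_from_subtopology_mono) blast
  have "flat (K \<inter> N) f (\<lambda>t. T (f s) (f t))"
    unfolding flat_def
  proof (intro conjI ballI)
    show "(\<lambda>t. T (f s) (f t)) \<in> K \<inter> N \<rightarrow> carrier G"
      using N(2) T_closed continuous_closed[OF f s] by blast
    fix t assume t: "t \<in> K \<inter> N"
    then obtain W where W: "openin X W" "f t \<in> W" "\<forall>z\<in>W. T (f s) z = T (f s) (f t) \<otimes> T (f t) z"
      using T_compatible[of "f s" "f t"] N(2) continuous_closed[OF f s] by blast
    from eventually_in_openin[OF fN W(1,2) t]
    show "\<forall>\<^sub>F u in at t within K \<inter> N. T (f s) (f u) = T (f s) (f t) \<otimes> T (f t) (f u)"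
      by eventually_elim (use W in blast)
  qed
  moreover have "s \<in> N" using N(2) s open_nhd continuous_closed[OF f s] by blast
  ultimately show ?thesis using N(1) by blast
qed

lemma flat_compose:
  assumes \<psi>: "flat K f \<psi>" and f: "continuous_map (top_of_set K) X f"
    and g: "continuous_on L g" "g \<in> L \<rightarrow> K"
  shows "flat L (f \<circ> g) (\<psi> \<circ> g)"
proof -
  have "eventually (\<lambda>t. \<psi> (g t) = \<psi> (g s) \<otimes> T (f (g s)) (f (g t))) (at s within L)"
    if s: "s \<in> L" for s
  proof -
    have gs: "g s \<in> K" using g s by blast
    have "eventually (\<lambda>t. \<psi> t = \<psi> (g s) \<otimes> T (f (g s)) (f t)) (at (g s) within K)"
      using \<psi> gs by (simp add: flat_def)
    then obtain S where S: "open S" "g s \<in> S"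
      "\<And>t. t \<in> S \<Longrightarrow> t \<noteq> g s \<Longrightarrow> t \<in> K \<Longrightarrow> \<psi> t = \<psi> (g s) \<otimes> T (f (g s)) (f t)"
      unfolding eventually_at_topological by blast
    \<comment> \<open>\<open>g\<close> may take the value \<open>g s\<close> again, a point that the
      punctured filter at \<open>g s\<close> says nothing about.\<close>
    have near: "\<psi> t = \<psi> (g s) \<otimes> T (f (g s)) (f t)" if "t \<in> S" "t \<in> K" for t
      using S(3)[OF that(1)] that(2) T_self[OF continuous_closed[OF f gs]] flat_closed[OF \<psi> gs]
      by (cases "t = g s") auto
    have "eventually (\<lambda>t. g t \<in> S) (at s within L)"
      using g(1) s S(1,2) unfolding continuous_on_def by (blast intro: topological_tendstoD)
    moreover have "eventually (\<lambda>t. t \<in> L) (at s within L)"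
      by (simp add: eventually_at_filter)
    ultimately show ?thesis
      by eventually_elim (use g(2) near in blast)
  qed
  moreover have "\<psi> (g s) \<in> carrier G" if "s \<in> L" for s
    using flat_closed[OF \<psi>] g(2) that by blast
  ultimately show ?thesis by (auto simp: flat_def)
qed

text \<open>Sections exist locally and extend over adjacent rectangles, whose overlap is convex and
  hence connected; bisection in each coordinate then reaches the whole square.\<close>

lemma flat_exists_square:
  fixes f :: "real \<times> real \<Rightarrow> 'a"
  assumes f: "continuous_map (top_of_set ({0..1} \<times> {0..1})) X f"
  shows "\<exists>\<psi>. flat ({0..1} \<times> {0..1}) f \<psi>"
proof -
  let ?I = "{0..1::real}"
  let ?R = "\<lambda>a b c d. ({a..b} \<inter> ?I) \<times> ({c..d} \<inter> ?I)"
  let ?P = "\<lambda>A. \<exists>\<psi>. flat A f \<psi>"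
  have glue: "?P (A \<union> B)" if "?P A" "?P B" "closed A" "closed B" "A \<union> B \<subseteq> ?I \<times> ?I" "convex (A \<inter> B)"
    for A B
  proof -
    have "continuous_map (top_of_set (A \<union> B)) X f"
      using f that(5) by (rule continuous_map_from_subtopology_mono)
    with that show ?thesis
      using flat_glue convex_connected by blast
  qed
  have mono: "?P A" if "?P B" "A \<subseteq> B" for A B using that flat_subset by blast
  have closed: "closed (?R a b c d)" for a b c d by (intro closed_Times closed_Int closed_atLeastAtMost)
  have convex: "convex (?R a b c d)" for a b c d
    by (intro convex_Times convex_Int convex_closed_interval convex_real_interval)
  \<comment> \<open>The width is left existential: before gluing, two stacked rectangles are trimmed
    to the smaller of their widths, which stays positive.\<close>
  have strip: "\<exists>\<delta>>0. ?P (?R (x - \<delta>) (x + \<delta>) 0 1)" if x: "x \<in> ?I" for x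
  proof (rule Bolzano[of 0 1 "\<lambda>c d. \<exists>\<delta>>0. ?P (?R (x - \<delta>) (x + \<delta>) c d)"])
    fix a b c :: real
    assume trans: "a \<le> b" "b \<le> c"
    assume "\<exists>\<delta>>0. ?P (?R (x - \<delta>) (x + \<delta>) a b)" "\<exists>\<delta>>0. ?P (?R (x - \<delta>) (x + \<delta>) b c)"
    then obtain \<delta> \<epsilon> where pos: "\<delta> > 0" "\<epsilon> > 0"
      and P: "?P (?R (x - \<delta>) (x + \<delta>) a b)" "?P (?R (x - \<epsilon>) (x + \<epsilon>) b c)"
      by blast
    let ?m = "min \<delta> \<epsilon>"
    have "?P (?R (x - ?m) (x + ?m) a b \<union> ?R (x - ?m) (x + ?m) b c)"
    proof (rule glue)
      show "?P (?R (x - ?m) (x + ?m) a b)"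
        by (rule mono[OF P(1)], intro Sigma_mono Int_mono order_refl) simp
      show "?P (?R (x - ?m) (x + ?m) b c)"
        by (rule mono[OF P(2)], intro Sigma_mono Int_mono order_refl) simp
    qed (blast | intro closed convex_Int convex)+
    also have "?R (x - ?m) (x + ?m) a b \<union> ?R (x - ?m) (x + ?m) b c = ?R (x - ?m) (x + ?m) a c"
      using trans by auto
    finally show "\<exists>\<delta>>0. ?P (?R (x - \<delta>) (x + \<delta>) a c)" using pos by (intro exI[of _ ?m]) simp
  next
    fix y :: real
    assume "0 \<le> y" "y \<le> 1"
    then obtain N \<psi> where N: "open N" "(x, y) \<in> N" "flat ((?I \<times> ?I) \<inter> N) f \<psi>"
      using flat_local[OF f, of "(x, y)"] x by auto
    obtain A B where AB: "open A" "open B" "(x, y) \<in> A \<times> B" "A \<times> B \<subseteq> N"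
      using open_prod_elim[OF N(1,2)] by metis
    obtain \<delta> where \<delta>: "\<delta> > 0" "cball x \<delta> \<subseteq> A" using AB open_contains_cball by blast
    obtain \<epsilon> where \<epsilon>: "\<epsilon> > 0" "ball y \<epsilon> \<subseteq> B" using AB open_contains_ball by blast
    have near: "?P (?R (x - \<delta>) (x + \<delta>) a b)" if "a \<le> y" "y \<le> b" "b - a < \<epsilon>" for a b
    proof (rule mono)
      show "?P ((?I \<times> ?I) \<inter> N)" using N(3) by blast
      have "{x - \<delta>..x + \<delta>} \<subseteq> A" using \<delta>(2) by (simp add: cball_eq_atLeastAtMost)
      moreover have "{a..b} \<subseteq> B" using that \<epsilon>(2) by (auto simp: ball_eq_greaterThanLessThan subset_iff)
      ultimately have "{x - \<delta>..x + \<delta>} \<times> {a..b} \<subseteq> N"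
        using AB(4) by (meson Sigma_mono order_trans)
      then show "?R (x - \<delta>) (x + \<delta>) a b \<subseteq> (?I \<times> ?I) \<inter> N"
        unfolding Times_Int_Times[symmetric] by (rule le_infI[OF inf.cobounded2 le_infI1])
    qed
    show "\<exists>\<epsilon>>0. \<forall>a b. a \<le> y \<and> y \<le> b \<and> b - a < \<epsilon> \<longrightarrow> (\<exists>\<delta>>0. ?P (?R (x - \<delta>) (x + \<delta>) a b))"
    proof (rule exI[of _ \<epsilon>], intro conjI \<epsilon>(1) allI impI)
      fix a b assume "a \<le> y \<and> y \<le> b \<and> b - a < \<epsilon>"
      then show "\<exists>\<delta>>0. ?P (?R (x - \<delta>) (x + \<delta>) a b)"
        by (intro exI[of _ \<delta>] conjI \<delta>(1) near) auto
    qed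
  qed simp
  have "?P (?R 0 1 0 1)"
  proof (rule Bolzano[of 0 1 "\<lambda>a b. ?P (?R a b 0 1)"])
    fix a b c :: real
    assume trans: "a \<le> b" "b \<le> c" and "?P (?R a b 0 1)" "?P (?R b c 0 1)"
    then have "?P (?R a b 0 1 \<union> ?R b c 0 1)"
      by (intro glue closed convex_Int convex) auto
    also have "?R a b 0 1 \<union> ?R b c 0 1 = ?R a c 0 1"
      using trans by auto
    finally show "?P (?R a c 0 1)" .
  next
    fix x :: real
    assume "0 \<le> x" "x \<le> 1"
    then obtain \<delta> where \<delta>: "\<delta> > 0" "?P (?R (x - \<delta>) (x + \<delta>) 0 1)" using strip[of x] by auto
    have "?P (?R a b 0 1)" if "a \<le> x" "x \<le> b" "b - a < \<delta>" for a b
      by (rule mono[OF \<delta>(2)]) (use that in auto)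
    then show "\<exists>d>0. \<forall>a b. a \<le> x \<and> x \<le> b \<and> b - a < d \<longrightarrow> ?P (?R a b 0 1)"
      using \<delta>(1) by blast
  qed simp
  then show ?thesis by simp
qed

lemma flat_exists_path:
  assumes "pathin X p"
  shows "\<exists>\<psi>. flat {0..1::real} p \<psi>"
proof -
  let ?I = "{0..1::real}"
  have p: "continuous_map (top_of_set ?I) X p" using assms by (simp add: pathin_def)
  have f: "continuous_map (top_of_set (?I \<times> ?I)) X (p \<circ> snd)"
    by (rule continuous_map_compose[OF _ p]) (auto intro!: continuous_intros)
  from flat_exists_square[OF this] obtain \<psi> where \<psi>: "flat (?I \<times> ?I) (p \<circ> snd) \<psi>" ..
  have cont: "continuous_on ?I (\<lambda>t. (0::real, t))" by (intro continuous_intros)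
  have "flat ?I (p \<circ> snd \<circ> (\<lambda>t. (0::real, t))) (\<psi> \<circ> (\<lambda>t. (0, t)))"
    by (rule flat_compose[OF \<psi> f cont]) auto
  then show ?thesis by (auto simp: o_def)
qed

section \<open>Holonomy as a homomorphism on loop classes\<close>

definition holonomy :: "(real \<Rightarrow> 'a) \<Rightarrow> 'g" where
  "holonomy p = (let \<psi> = SOME \<psi>. flat {0..1::real} p \<psi> in inv (\<psi> 0) \<otimes> \<psi> 1)"

text \<open>Two flat sections differ by a left factor \<open>c\<close>, which cancels between the
  inverse at 0 and the value at 1.\<close>

lemma holonomy_eq:
  assumes p: "pathin X p" and \<psi>: "flat {0..1} p \<psi>"
  shows "holonomy p = inv (\<psi> 0) \<otimes> \<psi> 1"
proof -
  define \<zeta> where "\<zeta> = (SOME \<psi>. flat {0..1::real} p \<psi>)"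
  have \<zeta>: "flat {0..1} p \<zeta>"
    unfolding \<zeta>_def using flat_exists_path[OF p] by (rule someI_ex)
  define c where "c = \<zeta> 0 \<otimes> inv \<psi> 0"
  have mem: "\<psi> 0 \<in> carrier G" "\<psi> 1 \<in> carrier G" "\<zeta> 0 \<in> carrier G" "\<zeta> 1 \<in> carrier G" "c \<in> carrier G"
    using flat_closed[OF \<psi>] flat_closed[OF \<zeta>] by (auto simp: c_def)
  have "c = \<zeta> 1 \<otimes> inv \<psi> 1"
    unfolding c_def by (rule flat_unique[OF \<psi> \<zeta>]) (use p in \<open>auto simp: pathin_def\<close>)
  then have "\<zeta> 0 = c \<otimes> \<psi> 0" "\<zeta> 1 = c \<otimes> \<psi> 1"
    using inv_solve_right[of c "\<zeta> 0" "\<psi> 0"] inv_solve_right[of c "\<zeta> 1" "\<psi> 1"] mem c_def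
    by blast+
  then have "inv \<zeta> 0 \<otimes> \<zeta> 1 = inv \<psi> 0 \<otimes> (inv c \<otimes> (c \<otimes> \<psi> 1))"
    using mem by (simp add: inv_mult_group m_assoc)
  also have "\<dots> = inv \<psi> 0 \<otimes> \<psi> 1"
    using mem by (simp add: m_assoc[symmetric])
  finally have "inv \<zeta> 0 \<otimes> \<zeta> 1 = inv \<psi> 0 \<otimes> \<psi> 1" .
  then show ?thesis by (simp add: holonomy_def Let_def \<zeta>_def)
qed

lemma holonomy_closed: "pathin X p \<Longrightarrow> holonomy p \<in> carrier G"
  using flat_exists_path[of p] holonomy_eq[of p] flat_closed[of "{0..1}" p] by fastforce

lemma flat_const:
  assumes "x \<in> topspace X" "c \<in> carrier G"
  shows "flat K (\<lambda>_. x) (\<lambda>_. c)"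
  using assms by (simp add: flat_def T_self)

text \<open>A flat section over the whole homotopy is constant along the two edges that rest at the
  base point, so it has the same end values on both loops.\<close>

lemma holonomy_homotopy:
  assumes "(p, q) \<in> loop_homotopy X x"
  shows "holonomy p = holonomy q"
proof -
  let ?I = "{0..1::real}"
  have pq: "pathin X p" "pathin X q" and px: "p 0 = x"
    using assms equiv_loop_homotopy[of X x]
    by (auto simp: equiv_def refl_on_def loops_at_def dest!: equivE)
  then have x: "x \<in> topspace X"
    using continuous_closed[of ?I p 0] by (simp add: pathin_def)
  obtain h where h: "continuous_map (top_of_set (?I \<times> ?I)) X h" "\<And>t. h (0, t) = p t"
      "\<And>t. h (1, t) = q t" "\<And>s. s \<in> ?I \<Longrightarrow> h (s, 0) = x \<and> h (s, 1) = x"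
    using assms unfolding loop_homotopy_def homotopic_with_def
    by (auto simp: prod_topology_subtopology_eu)
  from flat_exists_square[OF h(1)] obtain \<psi> where \<psi>: "flat (?I \<times> ?I) h \<psi>" ..
  have slice: "flat ?I (h \<circ> g) (\<psi> \<circ> g)" if "continuous_on ?I g" "g \<in> ?I \<rightarrow> ?I \<times> ?I" for g
    using flat_compose[OF \<psi> h(1) that] .
  have side: "\<psi> (0, e) = \<psi> (1, e)" if e: "e \<in> {0, 1}" for e
  proof -
    have fl: "flat ?I (\<lambda>_. x) (\<lambda>s. \<psi> (s, e))"
      by (rule flat_cong[OF slice[of "\<lambda>s. (s, e)"]])
        (use e h(4) in \<open>auto intro!: continuous_intros\<close>)
    show ?thesis
      using flat_unique[OF flat_const[OF x one_closed] fl, of 0 1] x flat_closed[OF \<psi>, of "(0, e)"]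
        flat_closed[OF \<psi>, of "(1, e)"] e
      by auto
  qed
  have "continuous_on ?I (\<lambda>t. (c, t))" for c :: real by (intro continuous_intros)
  from slice[OF this, of 0] slice[OF this, of 1]
  have "flat ?I p (\<lambda>t. \<psi> (0, t))" "flat ?I q (\<lambda>t. \<psi> (1, t))"
    using h(2,3) by (auto simp: o_def)
  then have "holonomy p = inv \<psi> (0, 0) \<otimes> \<psi> (0, 1)" "holonomy q = inv \<psi> (1, 0) \<otimes> \<psi> (1, 1)"
    using holonomy_eq pq by simp_all
  then show ?thesis using side by simp
qed

text \<open>Both loops inherit their sections from one section over the joined loop, and its value
  at \<open>1/2\<close> cancels.\<close>

lemma holonomy_join:
  assumes "p \<in> loops_at X x" "q \<in> loops_at X x"
  shows "holonomy (loop_join p q) = holonomy p \<otimes> holonomy q"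
proof -
  let ?I = "{0..1::real}" and ?r = "loop_join p q"
  have r: "pathin X ?r" and pq: "pathin X p" "pathin X q" "p 1 = q 0"
    using loop_join_loops_at[OF assms] assms by (auto simp: loops_at_def)
  from flat_exists_path[OF r] obtain \<psi> where \<psi>: "flat ?I ?r \<psi>" ..
  have r': "continuous_map (top_of_set ?I) X ?r" using r by (simp add: pathin_def)
  have "flat ?I p (\<lambda>t. \<psi> (t / 2))"
    by (rule flat_cong[OF flat_compose[OF \<psi> r', of ?I "\<lambda>t. t / 2"]])
      (auto simp: loop_join_def intro!: continuous_intros)
  moreover have "flat ?I q (\<lambda>t. \<psi> ((t + 1) / 2))"
    by (rule flat_cong[OF flat_compose[OF \<psi> r', of ?I "\<lambda>t. (t + 1) / 2"]])
      (auto simp: loop_join_def field_simps pq(3) intro!: continuous_intros)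
  ultimately have "holonomy p = inv \<psi> 0 \<otimes> \<psi> (1/2)" "holonomy q = inv \<psi> (1/2) \<otimes> \<psi> 1"
    using holonomy_eq pq by simp_all
  moreover have "holonomy ?r = inv \<psi> 0 \<otimes> \<psi> 1" using holonomy_eq[OF r \<psi>] .
  moreover have "\<psi> 0 \<in> carrier G" "\<psi> (1/2) \<in> carrier G" "\<psi> 1 \<in> carrier G"
    using flat_closed[OF \<psi>] by auto
  moreover from this have "\<psi> (1/2) \<otimes> (inv \<psi> (1/2) \<otimes> \<psi> 1) = \<psi> 1"
    by (simp add: m_assoc[symmetric])
  ultimately show ?thesis by (simp add: m_assoc)
qed

lemma holonomy_hom:
  obtains \<rho> where "\<rho> \<in> hom (fundamental_group X x) G"
    "\<And>p. p \<in> loops_at X x \<Longrightarrow> \<rho> (loop_homotopy X x `` {p}) = holonomy p"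
proof
  let ?r = "loop_homotopy X x"
  let ?\<rho> = "\<lambda>A. holonomy (SOME p. p \<in> A)"
  show eq: "?\<rho> (?r `` {p}) = holonomy p" if "p \<in> loops_at X x" for p
  proof -
    have "p \<in> ?r `` {p}" using equiv_class_self[OF equiv_loop_homotopy that] .
    then have "(SOME q. q \<in> ?r `` {p}) \<in> ?r `` {p}"
      by (rule someI[where P = "\<lambda>q. q \<in> ?r `` {p}"])
    then show ?thesis using holonomy_homotopy[of p] by simp
  qed
  show "?\<rho> \<in> hom (fundamental_group X x) G"
  proof (rule homI)
    fix A assume "A \<in> carrier (fundamental_group X x)"
    then show "?\<rho> A \<in> carrier G"
      using eq holonomy_closed
      by (fastforce simp: fundamental_group_def loops_at_def elim!: quotientE)
  next
    fix A B assume "A \<in> carrier (fundamental_group X x)" "B \<in> carrier (fundamental_group X x)"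
    then obtain p q where pq: "p \<in> loops_at X x" "q \<in> loops_at X x" "A = ?r `` {p}" "B = ?r `` {q}"
      by (auto simp: fundamental_group_def elim!: quotientE)
    then show "?\<rho> (A \<otimes>\<^bsub>fundamental_group X x\<^esub> B) = ?\<rho> A \<otimes> ?\<rho> B"
      by (simp only: pq(3,4) fundamental_group_mult_class eq loop_join_loops_at holonomy_join)
  qed
qed

end


section \<open>Flat bundles over the surface\<close>

text \<open>\<open>v k\<close> belongs to vertex \<open>k\<close>. Side \<open>k\<close> runs from
  vertex \<open>k\<close> to vertex \<open>k + 1\<close> and is glued to side \<open>k + 2\<close>
  reversed, so \<open>k\<close> meets \<open>k + 3\<close> and \<open>k + 1\<close> meets
  \<open>k + 2\<close>. \<open>v_relation\<close> makes the jumps at these two ends agree.\<close>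

locale surface_bundle = group G for G :: "('g, 'm) monoid_scheme" (structure) +
  fixes g :: nat and v :: "nat \<Rightarrow> 'g"
  assumes genus: "g > 0"
    and v_closed: "v k \<in> carrier G"
    and v_cyclic: "v (4 * g) = v 0"
    and v_relation: "k < 4 * g \<Longrightarrow> k mod 4 \<in> {0, 1} \<Longrightarrow>
        inv v k \<otimes> v (k + 3) = inv v (k + 1) \<otimes> v (k + 2)"
begin

text \<open>
  A gauge, trivial inside the polygon: two sides glued to each other have constant holonomy
  \<open>inv \<kappa> z \<otimes> \<kappa> w\<close>, and the values \<open>v k\<close> at the vertices make this consistent at the vertex of the
  surface.
\<close>

definition \<kappa> :: "complex \<Rightarrow> 'g" where
  "\<kappa> z = (let x = real (4 * g) * Arg2pi z / (2 * pi); k = nat \<lfloor>x\<rfloor> in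
     if cmod z < 1 then \<one>
     else if x = real k then v k
     else if k mod 4 \<in> {2, 3} then inv v (k - 2) \<otimes> v (k + 1)
     else \<one>)"

lemma \<kappa>_closed [simp]: "\<kappa> z \<in> carrier G"
  by (simp add: \<kappa>_def Let_def v_closed)

text \<open>\<open>t < 1\<close> keeps the end of the last side away, where the angle falls back to
  zero.\<close>

lemma Arg2pi_polygon_side:
  assumes "k < 4 * g" "0 \<le> t" "t < 1"
  shows "real (4 * g) * Arg2pi (polygon_side g k t) / (2 * pi) = k + t"
proof -
  have "real k + 1 \<le> real (4 * g)" using assms(1) by linarith
  then have "real k + t < real (4 * g)" using assms(3) by linarith
  then have "Arg2pi (polygon_side g k t) = 2 * pi * (real k + t) / real (4 * g)"
    using assms genus
    by (intro Arg2pi_unique[of 1]) (auto simp: polygon_side_def cis_conv_exp divide_simps mult_less_cancel_left)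
  then show ?thesis using genus by simp
qed

lemma \<kappa>_polygon_side:
  assumes "k < 4 * g" "0 \<le> t" "t < 1"
  shows "\<kappa> (polygon_side g k t) = (if t = 0 then v k
    else if k mod 4 \<in> {2, 3} then inv v (k - 2) \<otimes> v (k + 1) else \<one>)"
proof -
  have floor: "nat \<lfloor>real k + t\<rfloor> = k"
    using assms by (simp add: nat_eq_iff floor_eq_iff)
  have norm: "cmod (polygon_side g k t) = 1" by (simp add: polygon_side_def)
  show ?thesis
    unfolding \<kappa>_def Let_def Arg2pi_polygon_side[OF assms] floor norm by simp
qed

lemma polygon_side_1: "polygon_side g k 1 = polygon_side g (Suc k) 0"
  by (simp add: polygon_side_def add.commute)

lemma polygon_side_cyclic: "polygon_side g (4 * g) 0 = polygon_side g 0 0"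
  using genus by (simp add: polygon_side_def)

lemma \<kappa>_vertex: "k \<le> 4 * g \<Longrightarrow> \<kappa> (polygon_side g k 0) = v k"
  using \<kappa>_polygon_side[of k 0] \<kappa>_polygon_side[of 0 0] genus polygon_side_cyclic v_cyclic
  by (cases "k = 4 * g") auto

lemma side_index:
  assumes "k < 4 * g" "k mod 4 \<in> {0, 1}"
  shows "k + 3 \<le> 4 * g"
proof -
  have "k = 4 * (k div 4) + k mod 4" by simp
  moreover have "k div 4 < g" using assms(1) by (simp add: less_mult_imp_div_less mult.commute)
  moreover have "k mod 4 \<le> 1" using assms(2) by auto
  ultimately show ?thesis by linarith
qed

text \<open>One right factor serves the whole side: inside the side by the choice of \<kappa> there,
  at \<open>t = 0\<close> by the vertex values, at \<open>t = 1\<close> by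
  \<open>v_relation\<close>.\<close>

lemma \<kappa>_side_pairing:
  assumes k: "k < 4 * g" "k mod 4 \<in> {0, 1}" and t: "t \<in> {0..1}"
  shows "\<kappa> (polygon_side g (k + 2) (1 - t)) = \<kappa> (polygon_side g k t) \<otimes> (inv v k \<otimes> v (k + 3))"
proof -
  have k3: "k + 3 \<le> 4 * g" using k by (rule side_index)
  consider "t = 0" | "t = 1" | "0 < t" "t < 1" using t by fastforce
  then show ?thesis
  proof cases
    case 1
    then show ?thesis
      using \<kappa>_vertex[of k] \<kappa>_vertex[of "k + 3"] k k3 polygon_side_1[of "k + 2"]
      by (simp add: v_closed m_assoc[symmetric] numeral_3_eq_3)
  next
    case 2
    then show ?thesis
      using \<kappa>_vertex[of "k + 1"] \<kappa>_vertex[of "k + 2"] k k3 polygon_side_1[of k] v_relation[OF k]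
      by (simp add: v_closed m_assoc[symmetric])
  next
    case 3
    have "(k + 2) mod 4 \<in> {2, 3}" "k mod 4 \<notin> {2, 3}" using k(2) by (auto; presburger)+
    then show ?thesis
      using \<kappa>_polygon_side[of k t] \<kappa>_polygon_side[of "k + 2" "1 - t"] 3 k k3
      by (simp add: v_closed numeral_3_eq_3)
  qed
qed

abbreviation \<Sigma> :: "complex set topology" where "\<Sigma> \<equiv> closed_orientable_surface g"

abbreviation \<pi> :: "complex \<Rightarrow> complex set" where "\<pi> z \<equiv> surface_gluing g `` {z}"

lemma polygon_side_cball: "polygon_side g k t \<in> cball 0 1"
  by (simp add: polygon_side_def)

text \<open>Gluing two sides is a reflection followed by a rotation, hence an isometry.\<close>

lemma polygon_side_reflect:
  "polygon_side g (k + 2) (1 - t) = cis (2 * pi * (2 * k + 3) / real (4 * g)) * cnj (polygon_side g k t)"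
  unfolding polygon_side_def cis_cnj cis_mult
  by (rule arg_cong[where f = cis]) (use genus in \<open>simp add: field_simps\<close>)

lemma side_pairingE:
  assumes "(w, w') \<in> side_pairing g"
  obtains k t where "k < 4 * g" "k mod 4 \<in> {0, 1}" "t \<in> {0..1}"
    "w = polygon_side g k t" "w' = polygon_side g (k + 2) (1 - t)"
  using assms unfolding side_pairing_def mem_Collect_eq prod.inject
  by (elim exE conjE) (rule that)

lemma dist_polygon_side:
  "dist (polygon_side g (k + 2) (1 - s)) (polygon_side g (k + 2) (1 - t))
    = dist (polygon_side g k s) (polygon_side g k t)"
proof -
  have "cmod (cis a * cnj z - cis a * cnj w) = cmod (z - w)" for a z w
    by (metis complex_cnj_diff complex_mod_cnj mult_1 norm_cis norm_mult right_diff_distrib)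
  then show ?thesis unfolding polygon_side_reflect dist_norm .
qed

lemma topspace_\<Sigma>: "topspace \<Sigma> = \<pi> ` cball 0 1"
  unfolding closed_orientable_surface_def
  by (subst topspace_quotient_topology) (auto simp: equiv_surface_gluing quotient_def)

lemma class_elements:
  assumes "x \<in> topspace \<Sigma>" "z \<in> x"
  shows "z \<in> cball 0 1" "x = \<pi> z"
proof -
  obtain y where y: "x = \<pi> y" using assms(1) by (auto simp: topspace_\<Sigma>)
  then have "(y, z) \<in> surface_gluing g" using assms(2) by simp
  then show "z \<in> cball 0 1" "x = \<pi> z"
    using equiv_class_eq[OF equiv_surface_gluing] y by (auto simp: surface_gluing_def)
qed

lemma class_iff: "x \<in> topspace \<Sigma> \<Longrightarrow> z \<in> x \<Longrightarrow> w \<in> x \<longleftrightarrow> (z, w) \<in> surface_gluing g"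
  using class_elements(2)[of x z] by auto

text \<open>Gluing replaces the \<open>4g\<close>-th power of a boundary point by its complex conjugate.\<close>

lemma finite_class:
  assumes "x \<in> topspace \<Sigma>"
  shows "finite x"
proof -
  obtain z where z: "z \<in> cball 0 1" "x = \<pi> z" using assms by (auto simp: topspace_\<Sigma>)
  let ?n = "4 * g"
  have side: "polygon_side g k t ^ ?n = cis (2 * pi * t)" for k t
  proof -
    have "polygon_side g k t ^ ?n = cis (2 * pi * (real k + t))"
      using genus by (simp add: polygon_side_def Complex.DeMoivre mult.assoc)
    also have "\<dots> = cis (2 * pi * t)"
      by (simp add: ring_distribs cis_mult[symmetric] cis_multiple_2pi)
    finally show ?thesis .
  qed
  have pair: "w ^ ?n = cnj (z ^ ?n)" if "(z, w) \<in> side_pairing g \<union> (side_pairing g)\<inverse>" for z w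
  proof -
    have "cis (2 * pi * (1 - t)) = cnj (cis (2 * pi * t))" for t
      by (simp add: complex_eq_iff right_diff_distrib cos_diff sin_diff)
    with that show ?thesis
      by (auto simp: side_pairing_def side simp del: complex_cnj_power)
  qed
  have "w ^ ?n \<in> {z ^ ?n, cnj (z ^ ?n)}" if "(z, w) \<in> (side_pairing g \<union> (side_pairing g)\<inverse>)\<^sup>*" for w
    using that
  proof (induction rule: rtrancl_induct)
    case (step y u)
    then show ?case using pair[of y u] by (auto simp del: complex_cnj_power)
  qed simp
  then have "x \<subseteq> {w. w ^ ?n = z ^ ?n} \<union> {w. w ^ ?n = cnj (z ^ ?n)}"
    unfolding z(2) surface_gluing_def by blast
  moreover have "finite ({w. w ^ ?n = z ^ ?n} \<union> {w. w ^ ?n = cnj (z ^ ?n)})"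
    by (intro finite_UnI finite_nth_roots) (use genus in simp_all)
  ultimately show ?thesis by (rule finite_subset)
qed

section \<open>Radii adapted to a gluing class\<close>

text \<open>A representative near a point of a side must lie on that side, so that a gluing of the
  side moves both points. The separation by \<open>2 * \<delta>\<close> makes the representative
  within \<delta> of a given point unique.\<close>

definition good_radius :: "complex set \<Rightarrow> real \<Rightarrow> bool" where
  "good_radius x \<delta> \<longleftrightarrow> \<delta> > 0 \<and>
     (\<forall>z\<in>x. \<forall>k<4 * g. \<forall>t\<in>{0..1}. dist z (polygon_side g k t) < \<delta> \<longrightarrow> z \<in> polygon_side g k ` {0..1}) \<and>
     (\<forall>z\<in>x. \<forall>w\<in>x. z \<noteq> w \<longrightarrow> 2 * \<delta> \<le> dist z w)"

lemma good_radius_mono: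
  assumes "good_radius x \<delta>" "0 < \<epsilon>" "\<epsilon> \<le> \<delta>"
  shows "good_radius x \<epsilon>"
  unfolding good_radius_def
proof (intro conjI ballI allI impI)
  fix z k t assume "z \<in> x" "k < 4 * g" "t \<in> {0..1}" "dist z (polygon_side g k t) < \<epsilon>"
  moreover from this have "dist z (polygon_side g k t) < \<delta>" using assms(3) by linarith
  ultimately show "z \<in> polygon_side g k ` {0..1}"
    using assms(1) unfolding good_radius_def by blast
next
  fix z w assume "z \<in> x" "w \<in> x" "z \<noteq> w"
  then have "2 * \<delta> \<le> dist z w" using assms(1) unfolding good_radius_def by blast
  then show "2 * \<epsilon> \<le> dist z w" using assms(3) by linarith
qed (rule assms(2))

lemma uniform_positive:
  assumes "finite A" "\<And>a. a \<in> A \<Longrightarrow> \<exists>\<delta>>0::real. P a \<delta>"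
    and "\<And>a \<delta> \<epsilon>. P a \<delta> \<Longrightarrow> 0 < \<epsilon> \<Longrightarrow> \<epsilon> \<le> \<delta> \<Longrightarrow> P a \<epsilon>"
  shows "\<exists>\<delta>>0. \<forall>a\<in>A. P a \<delta>"
  using assms(1,2)
proof (induction A)
  case empty
  show ?case by (rule exI[of _ 1]) simp
next
  case (insert a A)
  then obtain \<delta> \<epsilon> where "\<delta> > 0" "P a \<delta>" "\<epsilon> > 0" "\<forall>b\<in>A. P b \<epsilon>" by blast
  then show ?case
    by (intro exI[of _ "min \<delta> \<epsilon>"]) (auto intro: assms(3))
qed

lemma good_radius_exists:
  assumes x: "x \<in> topspace \<Sigma>"
  shows "\<exists>\<delta>. good_radius x \<delta>"
proof -
  define P where "P p \<delta> \<longleftrightarrow> (\<forall>t\<in>{0..1}. dist (fst p) (polygon_side g (snd p) t) < \<delta> \<longrightarrow>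
      fst p \<in> polygon_side g (snd p) ` {0..1})" for p \<delta>
  define Q where "Q p \<delta> \<longleftrightarrow> (fst p \<noteq> snd p \<longrightarrow> 2 * \<delta> \<le> dist (fst p) (snd p))" for p :: "complex \<times> complex" and \<delta>
  have "\<exists>\<delta>>0. \<forall>p\<in>x \<times> {..<4 * g}. P p \<delta>"
  proof (rule uniform_positive)
    fix p :: "complex \<times> nat"
    let ?S = "polygon_side g (snd p) ` {0..1}"
    have "closed ?S"
      unfolding polygon_side_def[abs_def]
      by (intro compact_imp_closed compact_continuous_image continuous_intros compact_Icc)
        (use genus in auto)
    show "\<exists>\<delta>>0. P p \<delta>"
    proof (cases "fst p \<in> ?S")
      case True
      then show ?thesis by (intro exI[of _ 1]) (simp add: P_def)
    next
      case False
      from separate_point_closed[OF \<open>closed ?S\<close> False]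
      obtain \<delta> where \<delta>: "0 < \<delta> \<and> (\<forall>y\<in>?S. \<delta> \<le> dist (fst p) y)" ..
      then have "\<not> dist (fst p) (polygon_side g (snd p) t) < \<delta>" if "t \<in> {0..1}" for t
        using that by (simp add: not_less)
      then show ?thesis using \<delta> unfolding P_def by blast
    qed
  next
    fix p \<delta> \<epsilon> assume "P p \<delta>" "\<epsilon> \<le> \<delta>"
    then show "P p \<epsilon>" unfolding P_def by (meson order_less_le_trans)
  qed (use finite_class[OF x] in simp)
  then obtain \<delta> where \<delta>: "\<delta> > 0" "\<forall>p\<in>x \<times> {..<4 * g}. P p \<delta>" by blast
  have "\<exists>\<epsilon>>0. \<forall>p\<in>x \<times> x. Q p \<epsilon>"
  proof (rule uniform_positive)
    show "\<exists>\<epsilon>>0. Q p \<epsilon>" for p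
    proof (cases "fst p = snd p")
      case False
      then show ?thesis by (intro exI[of _ "dist (fst p) (snd p) / 2"]) (simp add: Q_def)
    qed (auto simp: Q_def intro: exI[of _ 1])
  qed (use finite_class[OF x] in \<open>auto simp: Q_def\<close>)
  then obtain \<epsilon> where \<epsilon>: "\<epsilon> > 0" "\<forall>p\<in>x \<times> x. Q p \<epsilon>" by blast
  have "good_radius x (min \<delta> \<epsilon>)"
    unfolding good_radius_def
  proof (intro conjI ballI allI impI)
    fix z k t assume "z \<in> x" "k < 4 * g" "t \<in> {0..1}" "dist z (polygon_side g k t) < min \<delta> \<epsilon>"
    then show "z \<in> polygon_side g k ` {0..1}"
      using bspec[OF \<delta>(2), of "(z, k)"] by (auto simp: P_def)
  next
    fix z w assume "z \<in> x" "w \<in> x" "z \<noteq> w"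
    then have "2 * \<epsilon> \<le> dist z w"
      using bspec[OF \<epsilon>(2), of "(z, w)"] by (simp add: Q_def)
    then show "2 * min \<delta> \<epsilon> \<le> dist z w" by linarith
  qed (use \<delta>(1) \<epsilon>(1) in simp)
  then show ?thesis ..
qed

definition radius :: "complex set \<Rightarrow> real" where "radius x = (SOME \<delta>. good_radius x \<delta>)"

lemma good_radius_radius: "x \<in> topspace \<Sigma> \<Longrightarrow> good_radius x (radius x)"
  unfolding radius_def using good_radius_exists by (rule someI_ex)

lemma side_pair_gluing:
  assumes "k < 4 * g" "k mod 4 \<in> {0, 1}" "s \<in> {0..1}"
  shows "(polygon_side g k s, polygon_side g (k + 2) (1 - s)) \<in> surface_gluing g"
proof -
  have "(polygon_side g k s, polygon_side g (k + 2) (1 - s)) \<in> side_pairing g"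
    unfolding side_pairing_def mem_Collect_eq
    by (intro exI[of _ k] exI[of _ s]) (use assms in simp)
  then show ?thesis
    using polygon_side_cball unfolding surface_gluing_def by blast
qed

text \<open>The gluing maps are isometries, so a point near one representative of \<open>x\<close> is only glued to
  points near other representatives.\<close>

lemma move_along_class:
  assumes x: "x \<in> topspace \<Sigma>" and \<delta>: "good_radius x \<delta>" and z: "z \<in> x" "dist z w < \<delta>"
    and ww': "(w, w') \<in> surface_gluing g"
  shows "\<exists>z'\<in>x. dist z' w' < \<delta> \<and> \<kappa> z' \<otimes> inv \<kappa> w' = \<kappa> z \<otimes> inv \<kappa> w"
proof -
  \<comment> \<open>Gluing multiplies both values of \<kappa> by the same right factor, which
    cancels in the quotient.\<close>
  have \<kappa>: "\<kappa> (polygon_side g (k + 2) (1 - s)) \<otimes> inv \<kappa> (polygon_side g (k + 2) (1 - t))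
      = \<kappa> (polygon_side g k s) \<otimes> inv \<kappa> (polygon_side g k t)"
    if "k < 4 * g" "k mod 4 \<in> {0, 1}" "s \<in> {0..1}" "t \<in> {0..1}" for k s t
  proof -
    let ?h = "inv v k \<otimes> v (k + 3)"
    have "?h \<in> carrier G" by (simp add: v_closed)
    then have "\<kappa> (polygon_side g k s) \<otimes> ?h \<otimes> inv (\<kappa> (polygon_side g k t) \<otimes> ?h)
        = \<kappa> (polygon_side g k s) \<otimes> (?h \<otimes> inv ?h) \<otimes> inv \<kappa> (polygon_side g k t)"
      by (simp only: inv_mult_group m_assoc \<kappa>_closed inv_closed m_closed)
    then show ?thesis
      using that \<open>?h \<in> carrier G\<close> by (simp only: \<kappa>_side_pairing r_inv r_one \<kappa>_closed)
  qed
  have near: "\<exists>s\<in>{0..1}. z = polygon_side g k s"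
    if "z \<in> x" "dist z (polygon_side g k t) < \<delta>" "k < 4 * g" "t \<in> {0..1}" for z k t
    using \<delta> that unfolding good_radius_def by blast
  have one_step: "\<exists>z'\<in>x. dist z' w' < \<delta> \<and> \<kappa> z' \<otimes> inv \<kappa> w' = \<kappa> z \<otimes> inv \<kappa> w"
    if z: "z \<in> x" "dist z w < \<delta>" and ww': "(w, w') \<in> side_pairing g \<union> (side_pairing g)\<inverse>" for z w w'
    using ww'
  proof
    assume "(w, w') \<in> side_pairing g"
    then obtain k t where k: "k < 4 * g" "k mod 4 \<in> {0, 1}" "t \<in> {0..1}"
      and w: "w = polygon_side g k t" "w' = polygon_side g (k + 2) (1 - t)"
      by (rule side_pairingE)
    obtain s where s: "s \<in> {0..1}" "z = polygon_side g k s" using near z w k by blast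
    have "polygon_side g (k + 2) (1 - s) \<in> x"
      using class_iff[OF x z(1)] side_pair_gluing[of k s] k s by blast
    then show ?thesis
      using \<kappa>[OF k(1,2) s(1) k(3)] dist_polygon_side[of k s t] z w s by metis
  next
    assume "(w, w') \<in> (side_pairing g)\<inverse>"
    then have "(w', w) \<in> side_pairing g" by simp
    then obtain k t where k: "k < 4 * g" "k mod 4 \<in> {0, 1}" "t \<in> {0..1}"
      and w: "w' = polygon_side g k t" "w = polygon_side g (k + 2) (1 - t)"
      by (rule side_pairingE)
    have "k + 2 < 4 * g" using side_index[OF k(1,2)] by simp
    then obtain s' where s': "s' \<in> {0..1}" "z = polygon_side g (k + 2) s'"
      using near[of z "k + 2" "1 - t"] z w k by auto
    define s where "s = 1 - s'"
    have s: "s \<in> {0..1}" "z = polygon_side g (k + 2) (1 - s)" using s' by (auto simp: s_def)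
    have "(z, polygon_side g k s) \<in> surface_gluing g"
      using equiv_surface_gluing side_pair_gluing[of k s] k s by (auto elim!: equivE dest: symD)
    then have "polygon_side g k s \<in> x"
      using class_iff[OF x z(1)] by blast
    then show ?thesis
      using \<kappa>[OF k(1,2) s(1) k(3)] dist_polygon_side[of k s t] z w s by metis
  qed
  have "(w, w') \<in> (side_pairing g \<union> (side_pairing g)\<inverse>)\<^sup>*"
    using ww' by (simp add: surface_gluing_def)
  then show ?thesis
  proof (induction rule: rtrancl_induct)
    case base
    then show ?case using z by blast
  next
    case (step y u)
    then show ?case using one_step by metis
  qed
qed

definition nhd :: "complex set \<Rightarrow> real \<Rightarrow> complex set set" where
  "nhd x \<delta> = {y \<in> topspace \<Sigma>. \<exists>z\<in>x. \<exists>w\<in>y. dist z w < \<delta>}"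

text \<open>The preimage in the disc is a union of balls around the representatives;
  \<open>move_along_class\<close> shows that this union is closed under gluing.\<close>

lemma openin_nhd:
  assumes x: "x \<in> topspace \<Sigma>" and \<delta>: "good_radius x \<delta>"
  shows "openin \<Sigma> (nhd x \<delta>)"
proof -
  have "{w \<in> cball 0 1. \<pi> w \<in> nhd x \<delta>} = cball 0 1 \<inter> (\<Union>z\<in>x. ball z \<delta>)"
  proof (intro equalityI subsetI)
    fix w assume w: "w \<in> {w \<in> cball 0 1. \<pi> w \<in> nhd x \<delta>}"
    then obtain z w' where "z \<in> x" "dist z w' < \<delta>" "(w, w') \<in> surface_gluing g"
      by (auto simp: nhd_def)
    moreover from this(3) have "(w', w) \<in> surface_gluing g"
      using equiv_surface_gluing by (auto elim!: equivE dest: symD)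
    ultimately show "w \<in> cball 0 1 \<inter> (\<Union>z\<in>x. ball z \<delta>)"
      using move_along_class[OF x \<delta>] w by fastforce
  next
    fix w assume w: "w \<in> cball 0 1 \<inter> (\<Union>z\<in>x. ball z \<delta>)"
    then have "w \<in> \<pi> w" using equiv_class_self[OF equiv_surface_gluing] by blast
    with w show "w \<in> {w \<in> cball 0 1. \<pi> w \<in> nhd x \<delta>}"
      unfolding nhd_def topspace_\<Sigma> by auto
  qed
  then have "openin (top_of_set (cball 0 1)) {w \<in> topspace (top_of_set (cball 0 1)). \<pi> w \<in> nhd x \<delta>}"
    by (auto intro!: openin_open_Int)
  then show ?thesis
    using quotient_map_closed_orientable_surface[of g, unfolded quotient_map_def, THEN conjunct2,
        rule_format, of "nhd x \<delta>"]
    by (simp add: nhd_def)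
qed

lemma self_in_nhd:
  assumes "x \<in> topspace \<Sigma>" "good_radius x \<delta>"
  shows "x \<in> nhd x \<delta>"
proof -
  have "x \<noteq> {}" using assms(1) equiv_class_self[OF equiv_surface_gluing] by (force simp: topspace_\<Sigma>)
  then show ?thesis using assms by (fastforce simp: nhd_def good_radius_def)
qed

section \<open>Parallel transport between nearby points of the surface\<close>

definition transport :: "complex set \<Rightarrow> complex set \<Rightarrow> 'g" where
  "transport x y = (SOME t. \<exists>z\<in>x. \<exists>w\<in>y. dist z w < radius x \<and> t = \<kappa> z \<otimes> inv \<kappa> w)"

text \<open>Moving \<open>w\<close> to the selected \<open>w1\<close> within its class keeps the
  quotient of gauge values and yields a representative of \<open>x\<close> less than
  \<open>2 * radius x\<close> away from the selected \<open>z1\<close>. By separation the two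
  coincide.\<close>

lemma transport_eq:
  assumes x: "x \<in> topspace \<Sigma>" and y: "y \<in> topspace \<Sigma>" and z: "z \<in> x" "w \<in> y" "dist z w < radius x"
  shows "transport x y = \<kappa> z \<otimes> inv \<kappa> w"
proof -
  let ?P = "\<lambda>t. \<exists>z\<in>x. \<exists>w\<in>y. dist z w < radius x \<and> t = \<kappa> z \<otimes> inv \<kappa> w"
  have "?P (transport x y)"
    unfolding transport_def by (rule someI[of ?P "\<kappa> z \<otimes> inv \<kappa> w"]) (use z in blast)
  then obtain z1 w1 where z1: "z1 \<in> x" "w1 \<in> y" "dist z1 w1 < radius x"
    and t: "transport x y = \<kappa> z1 \<otimes> inv \<kappa> w1" by blast
  have "(w, w1) \<in> surface_gluing g" using class_iff[OF y z(2)] z1(2) by blast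
  then obtain z' where z': "z' \<in> x" "dist z' w1 < radius x" "\<kappa> z' \<otimes> inv \<kappa> w1 = \<kappa> z \<otimes> inv \<kappa> w"
    using move_along_class[OF x good_radius_radius[OF x] z(1,3)] by blast
  have "dist z' z1 < 2 * radius x"
    using dist_triangle2[of z' z1 w1] z' z1 by (simp add: dist_commute)
  then have "z' = z1"
    using good_radius_radius[OF x] z' z1 unfolding good_radius_def by force
  with z' t show ?thesis by simp
qed

sublocale local_transport G \<Sigma> "\<lambda>x. nhd x (radius x)" transport
proof unfold_locales
  fix x assume x: "x \<in> topspace \<Sigma>"
  note good = good_radius_radius[OF x]
  show "openin \<Sigma> (nhd x (radius x)) \<and> x \<in> nhd x (radius x)"
    using openin_nhd[OF x good] self_in_nhd[OF x good] by blast
  fix y assume y: "y \<in> nhd x (radius x)"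
  then have yt: "y \<in> topspace \<Sigma>" by (simp add: nhd_def)
  obtain z w where zw: "z \<in> x" "w \<in> y" "dist z w < radius x" using y by (auto simp: nhd_def)
  then show "transport x y \<in> carrier G" using transport_eq[OF x yt] by simp
  \<comment> \<open>A margin common to the finitely many representatives of \<open>y\<close>: moving
    any of them by less than \<delta> stays within \<open>radius x\<close> of the class
    \<open>x\<close>.\<close>
  have "\<exists>\<delta>>0. \<forall>w\<in>y. \<exists>z\<in>x. dist z w + \<delta> \<le> radius x"
  proof (rule uniform_positive)
    fix w' assume "w' \<in> y"
    then have "(w, w') \<in> surface_gluing g" using class_iff[OF yt zw(2)] by blast
    from move_along_class[OF x good zw(1,3) this] obtain z' where "z' \<in> x" "dist z' w' < radius x" by blast
    then show "\<exists>\<delta>>0. \<exists>z\<in>x. dist z w' + \<delta> \<le> radius x"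
      by (intro exI[of _ "radius x - dist z' w'"]) auto
  qed (use finite_class[OF yt] in force)+
  then obtain \<delta> where \<delta>: "\<delta> > 0" "\<And>w. w \<in> y \<Longrightarrow> \<exists>z\<in>x. dist z w + \<delta> \<le> radius x" by blast
  let ?\<epsilon> = "min \<delta> (radius y)"
  have good': "good_radius y ?\<epsilon>"
    by (rule good_radius_mono[OF good_radius_radius[OF yt]])
      (use \<delta>(1) good_radius_radius[OF yt] in \<open>auto simp: good_radius_def\<close>)
  have "u \<in> nhd x (radius x) \<and> u \<in> nhd y (radius y) \<and> transport x u = transport x y \<otimes> transport y u"
    if u: "u \<in> nhd y ?\<epsilon>" for u
  proof -
    obtain w q where q: "w \<in> y" "q \<in> u" "dist w q < ?\<epsilon>" and ut: "u \<in> topspace \<Sigma>"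
      using u by (auto simp: nhd_def)
    obtain z where z: "z \<in> x" "dist z w + \<delta> \<le> radius x" using \<delta>(2) q(1) by blast
    have d: "dist z q < radius x" "dist z w < radius x" "dist w q < radius y"
      using dist_triangle[of z q w] z q \<delta>(1) by auto
    have "transport x u = \<kappa> z \<otimes> inv \<kappa> q" "transport x y = \<kappa> z \<otimes> inv \<kappa> w" "transport y u = \<kappa> w \<otimes> inv \<kappa> q"
      using transport_eq x yt ut z q d by blast+
    then have "transport x u = transport x y \<otimes> transport y u"
      by (simp add: m_assoc) (simp add: m_assoc[symmetric])
    then show ?thesis using q z d ut by (auto simp: nhd_def)
  qed
  then show "\<exists>W. openin \<Sigma> W \<and> y \<in> W \<and> (\<forall>u\<in>W. u \<in> nhd x (radius x) \<and> u \<in> nhd y (radius y) \<and>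
      transport x u = transport x y \<otimes> transport y u)"
    using openin_nhd[OF yt good'] self_in_nhd[OF yt good'] by blast
qed

end


section \<open>Loops through identified points of the polygon\<close>

lemma continuous_map_loop_join:
  fixes A B :: "real \<Rightarrow> real \<Rightarrow> 'a"
  assumes A: "continuous_map (top_of_set ({0..1} \<times> {0..1})) X (\<lambda>z. A (fst z) (snd z))"
    and B: "continuous_map (top_of_set ({0..1} \<times> {0..1})) X (\<lambda>z. B (fst z) (snd z))"
    and eq: "\<And>s. s \<in> {0..1} \<Longrightarrow> A s 1 = B s 0"
  shows "continuous_map (top_of_set ({0..1} \<times> {0..1::real})) X
    (\<lambda>z. loop_join (A (fst z)) (B (fst z)) (snd z))"
  unfolding loop_join_def
proof (rule continuous_map_cases_le)
  show "continuous_map (subtopology (top_of_set ({0..1} \<times> {0..1}))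
      {z \<in> topspace (top_of_set ({0..1} \<times> {0..1})). snd z \<le> 1/2}) X
      (\<lambda>z. A (fst z) (2 * snd z))"
    by (rule continuous_map_compose[of _ _ "\<lambda>z. (fst z, 2 * snd z)", OF _ A,
          unfolded o_def fst_conv snd_conv])
      (auto simp: subtopology_subtopology intro!: continuous_intros)
  show "continuous_map (subtopology (top_of_set ({0..1} \<times> {0..1}))
      {z \<in> topspace (top_of_set ({0..1} \<times> {0..1})). 1/2 \<le> snd z}) X
      (\<lambda>z. B (fst z) (2 * snd z - 1))"
    by (rule continuous_map_compose[of _ _ "\<lambda>z. (fst z, 2 * snd z - 1)", OF _ B,
          unfolded o_def fst_conv snd_conv])
      (auto simp: subtopology_subtopology intro!: continuous_intros)
  fix z :: "real \<times> real"
  assume z: "z \<in> topspace (top_of_set ({0..1} \<times> {0..1}))" "snd z = 1/2"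
  then have "fst z \<in> {0..1}" "2 * snd z = 1" "2 * snd z - 1 = 0" by auto
  then show "A (fst z) (2 * snd z) = B (fst z) (2 * snd z - 1)"
    using eq by metis
qed (auto intro!: continuous_intros)

lemma loop_homotopyI:
  assumes "continuous_map (top_of_set ({0..1} \<times> {0..1})) X (\<lambda>z. H (fst z) (snd z))"
    and "\<And>s::real. s \<in> {0..1} \<Longrightarrow> H s 0 = x \<and> H s 1 = x"
  shows "(H 0, H 1) \<in> loop_homotopy X x"
  unfolding loop_homotopy_def homotopic_with_def mem_Collect_eq case_prod_conv
    prod_topology_subtopology_eu
  by (rule exI[of _ "\<lambda>z. H (fst z) (snd z)"]) (use assms in auto)

lemma loops_at_refl: "(p, p) \<in> loop_homotopy X x \<longleftrightarrow> p \<in> loops_at X x"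
  using equiv_loop_homotopy[of X x] by (auto simp: equiv_def refl_on_def)

lemma continuous_map_surface_projection:
  assumes "continuous_on K f" "\<And>s. s \<in> K \<Longrightarrow> f s \<in> cball 0 1"
  shows "continuous_map (top_of_set K) (closed_orientable_surface g) (\<lambda>s. surface_gluing g `` {f s})"
proof -
  have "continuous_map (top_of_set K) (top_of_set (cball 0 1)) f"
    using assms by auto
  from continuous_map_compose[OF this quotient_imp_continuous_map[OF quotient_map_closed_orientable_surface]]
  show ?thesis by (simp add: o_def)
qed

locale polygon_base_point =
  fixes g :: nat and z\<^sub>0 :: complex
  assumes base: "z\<^sub>0 \<in> cball 0 1"
begin

abbreviation "S \<equiv> closed_orientable_surface g"

abbreviation proj :: "complex \<Rightarrow> complex set" where "proj z \<equiv> surface_gluing g `` {z}"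

text \<open>Straight out to \<open>z\<close> and straight back from \<open>w\<close>; the two halves
  meet in the surface when \<open>z\<close> and \<open>w\<close> are glued.\<close>

definition excursion :: "complex \<Rightarrow> complex \<Rightarrow> real \<Rightarrow> complex set" where
  "excursion z w = loop_join (\<lambda>t. proj (linepath z\<^sub>0 z t)) (\<lambda>t. proj (linepath w z\<^sub>0 t))"

lemma proj_eq: "(z, w) \<in> surface_gluing g \<Longrightarrow> proj z = proj w"
  using equiv_class_eq[OF equiv_surface_gluing] .

lemma linepath_cball:
  assumes "z \<in> cball 0 1" "w \<in> cball 0 1" "t \<in> {0..1}"
  shows "linepath z w t \<in> cball (0::complex) 1"
  using closed_segment_subset[OF assms(1,2) convex_cball] linepath_in_path[OF assms(3)] by blast

lemma continuous_map_proj_linepath: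
  fixes a b :: "real \<Rightarrow> complex"
  assumes "continuous_on {0..1} a" "continuous_on {0..1} b"
    and "\<And>s. s \<in> {0..1} \<Longrightarrow> a s \<in> cball 0 1" "\<And>s. s \<in> {0..1} \<Longrightarrow> b s \<in> cball 0 1"
  shows "continuous_map (top_of_set ({0..1} \<times> {0..1})) S
    (\<lambda>z. proj (linepath (a (fst z)) (b (fst z)) (snd z)))"
proof (rule continuous_map_surface_projection)
  have "continuous_on ({0..1} \<times> {0..1::real}) (\<lambda>z. f (fst z))" if "continuous_on {0..1} f"
    for f :: "real \<Rightarrow> complex"
    using continuous_on_compose[OF continuous_on_fst[OF continuous_on_id], of "{0..1} \<times> {0..1::real}" f] that
    by (auto simp: o_def)
  with assms(1,2) show "continuous_on ({0..1} \<times> {0..1}) (\<lambda>z. linepath (a (fst z)) (b (fst z)) (snd z))"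
    unfolding linepath_def by (intro continuous_intros) auto
qed (use assms linepath_cball in auto)

text \<open>Sliding a glued pair, for instance along two glued sides, deforms the loop with its base
  point fixed.\<close>

lemma excursion_family:
  fixes a b :: "real \<Rightarrow> complex"
  assumes "continuous_on {0..1} a" "continuous_on {0..1} b"
    and ab: "\<And>s. s \<in> {0..1} \<Longrightarrow> (a s, b s) \<in> surface_gluing g"
  shows "(excursion (a 0) (b 0), excursion (a 1) (b 1)) \<in> loop_homotopy S (proj z\<^sub>0)"
proof (rule loop_homotopyI[where H = "\<lambda>s. excursion (a s) (b s)"])
  have cball: "a s \<in> cball 0 1" "b s \<in> cball 0 1" if "s \<in> {0..1}" for s
    using ab[OF that] by (auto simp: surface_gluing_def)
  show "continuous_map (top_of_set ({0..1} \<times> {0..1})) S (\<lambda>z. excursion (a (fst z)) (b (fst z)) (snd z))"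
    unfolding excursion_def
    by (rule continuous_map_loop_join; (rule continuous_map_proj_linepath)?)
      (use assms base cball proj_eq in \<open>auto simp: linepath_0' linepath_1'\<close>)
qed (simp add: excursion_def loop_join_def linepath_0' linepath_1')

lemma excursion_loops_at: "(z, w) \<in> surface_gluing g \<Longrightarrow> excursion z w \<in> loops_at S (proj z\<^sub>0)"
  using excursion_family[of "\<lambda>_. z" "\<lambda>_. w"] by (simp add: loops_at_refl)

text \<open>The middle of the joined loop runs from \<open>w\<close> to \<open>z\<^sub>0\<close> and
  back along the same segment. \<open>M\<close> shrinks this detour towards
  \<open>w\<close>.\<close>

lemma excursion_mult:
  assumes zw: "(z, w) \<in> surface_gluing g" and wy: "(w, y) \<in> surface_gluing g"
  shows "loop_homotopy S (proj z\<^sub>0) `` {loop_join (excursion z w) (excursion w y)}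
    = loop_homotopy S (proj z\<^sub>0) `` {excursion z y}"
proof -
  have cb: "z \<in> cball 0 1" "w \<in> cball 0 1" "y \<in> cball 0 1"
    using zw wy by (auto simp: surface_gluing_def)
  have zy: "(z, y) \<in> surface_gluing g"
    using equivE[OF equiv_surface_gluing] zw wy by (metis transD)
  let ?r = "loop_homotopy S (proj z\<^sub>0)"
  \<comment> \<open>\<open>?f\<close> waits at \<open>1/2\<close> during the two middle quarters,
    where \<open>M 1\<close> rests at the class of \<open>w\<close>.\<close>
  let ?f = "(linepath 0 (1/2) +++ linepath (1/2) (1/2)) +++ (linepath (1/2) (1/2) +++ linepath (1/2) (1::real))"
  define M where "M s = loop_join (loop_join (\<lambda>t. proj (linepath z\<^sub>0 z t)) (\<lambda>t. proj (linepath w (linepath z\<^sub>0 w s) t)))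
    (loop_join (\<lambda>t. proj (linepath (linepath z\<^sub>0 w s) w t)) (\<lambda>t. proj (linepath y z\<^sub>0 t)))" for s
  have "(M 0, M 1) \<in> ?r"
  proof (rule loop_homotopyI)
    have lin: "continuous_on {0..1} (linepath z\<^sub>0 w)" by (rule continuous_on_linepath)
    show "continuous_map (top_of_set ({0..1} \<times> {0..1})) S (\<lambda>z. M (fst z) (snd z))"
      unfolding M_def
      by (rule continuous_map_loop_join; (rule continuous_map_loop_join)?;
          (rule continuous_map_proj_linepath)?)
        (use lin base cb linepath_cball proj_eq[OF zw] proj_eq[OF wy] in
          \<open>auto simp: loop_join_def linepath_0' linepath_1'\<close>)
  qed (simp add: M_def loop_join_def linepath_0' linepath_1')
  moreover have id: "linepath 0 1 t = t" for t :: real by (simp add: linepath_def)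
  moreover have "M 0 = loop_join (excursion z w) (excursion w y)"
    by (simp add: M_def excursion_def linepath_0')
  moreover have "?r `` {M 1} = ?r `` {excursion z y}"
  proof (rule loop_reparametrizes[where p = "excursion z y" and g = "linepath 0 1"
        and f = ?f])
    fix t :: real assume t: "t \<in> {0..1}"
    consider "t \<le> 1/4" | "1/4 < t" "t \<le> 1/2" | "1/2 < t" "t \<le> 3/4" | "3/4 < t" by linarith
    then show "M 1 t = excursion z y (?f t)"
    proof cases
      case 1
      then have "?f t = 2 * t" by (simp add: joinpaths_def linepath_def)
      with 1 show ?thesis by (simp add: M_def excursion_def loop_join_def)
    next
      case 2
      then have f: "?f t = 1/2" by (simp add: joinpaths_def)
      show ?thesis
        unfolding f using 2 proj_eq[OF zw] by (simp add: M_def excursion_def loop_join_def linepath_1')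
    next
      case 3
      then have f: "?f t = 1/2" by (simp add: joinpaths_def)
      show ?thesis
        unfolding f using 3 proj_eq[OF zw] by (simp add: M_def excursion_def loop_join_def linepath_1')
    next
      case 4
      then have "?f t = 2 * t - 1" by (simp add: joinpaths_def linepath_def field_simps)
      with 4 show ?thesis by (simp add: M_def excursion_def loop_join_def)
    qed
  qed (use excursion_loops_at[OF zy] in
      \<open>auto simp: path_image_join closed_segment_eq_real_ivl id simp del: linepath_refl\<close>)
  ultimately show ?thesis
    using equiv_class_eq[OF equiv_loop_homotopy] by metis
qed

abbreviation "\<Gamma> \<equiv> fundamental_group S (proj z\<^sub>0)"

lemma group_\<Gamma>: "group \<Gamma>"
  using base
  by (intro group_fundamental_group)
    (auto simp: closed_orientable_surface_def topspace_quotient_topology equiv_surface_gluing quotientI)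

definition excursion_class :: "complex \<Rightarrow> complex \<Rightarrow> (real \<Rightarrow> complex set) set" where
  "excursion_class z w = loop_homotopy S (proj z\<^sub>0) `` {excursion z w}"

lemma excursion_class_closed: "(z, w) \<in> surface_gluing g \<Longrightarrow> excursion_class z w \<in> carrier \<Gamma>"
  by (simp add: excursion_class_def fundamental_group_def quotientI excursion_loops_at)

lemma excursion_class_mult:
  "(z, w) \<in> surface_gluing g \<Longrightarrow> (w, y) \<in> surface_gluing g \<Longrightarrow> excursion_class z w \<otimes>\<^bsub>\<Gamma>\<^esub> excursion_class w y = excursion_class z y"
  by (simp add: excursion_class_def fundamental_group_mult_class excursion_loops_at excursion_mult)

lemma excursion_class_family:
  fixes a b :: "real \<Rightarrow> complex"
  assumes "continuous_on {0..1} a" "continuous_on {0..1} b"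
    and "\<And>s. s \<in> {0..1} \<Longrightarrow> (a s, b s) \<in> surface_gluing g"
  shows "excursion_class (a 0) (b 0) = excursion_class (a 1) (b 1)"
  unfolding excursion_class_def by (rule equiv_class_eq[OF equiv_loop_homotopy excursion_family[OF assms]])

end

section \<open>Holonomy of excursions\<close>

context surface_bundle
begin

text \<open>Transport along a path in the polygon is by definition a quotient of gauge values, so
  the inverse gauge is parallel. \<kappa> may jump at the boundary; the transport jumps with
  it.\<close>

lemma flat_projection:
  assumes p: "continuous_on K p" "\<And>s. s \<in> K \<Longrightarrow> p s \<in> cball 0 1" and c: "c \<in> carrier G"
  shows "flat K (\<lambda>s. \<pi> (p s)) (\<lambda>s. c \<otimes> inv \<kappa> (p s))"
  unfolding flat_def
proof (intro conjI ballI)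
  fix s assume s: "s \<in> K"
  have self: "p t \<in> \<pi> (p t)" "\<pi> (p t) \<in> topspace \<Sigma>" if "t \<in> K" for t
    using equiv_class_self[OF equiv_surface_gluing p(2)[OF that]] p(2)[OF that]
    by (auto simp: topspace_\<Sigma>)
  have "radius (\<pi> (p s)) > 0"
    using good_radius_radius[OF self(2)[OF s]] by (simp add: good_radius_def)
  then have "\<forall>\<^sub>F t in at s within K. dist (p t) (p s) < radius (\<pi> (p s))"
    using p(1) s unfolding continuous_on_def by (blast intro: tendstoD)
  moreover have "\<forall>\<^sub>F t in at s within K. t \<in> K" by (simp add: eventually_at_filter)
  ultimately show "\<forall>\<^sub>F t in at s within K.
      c \<otimes> inv \<kappa> (p t) = c \<otimes> inv \<kappa> (p s) \<otimes> transport (\<pi> (p s)) (\<pi> (p t))"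
  proof eventually_elim
    case (elim t)
    then have "transport (\<pi> (p s)) (\<pi> (p t)) = \<kappa> (p s) \<otimes> inv \<kappa> (p t)"
      using transport_eq self s by (metis dist_commute)
    then show ?case using c by (simp add: m_assoc) (simp add: m_assoc[symmetric])
  qed
qed (use c in simp)

lemma holonomy_excursion:
  assumes base: "z\<^sub>0 \<in> cball 0 1" and zw: "(z, w) \<in> surface_gluing g"
  shows "holonomy (polygon_base_point.excursion g z\<^sub>0 z w) = \<kappa> z\<^sub>0 \<otimes> inv \<kappa> z \<otimes> \<kappa> w \<otimes> inv \<kappa> z\<^sub>0"
proof -
  interpret polygon_base_point g z\<^sub>0 by unfold_locales (rule base)
  have cb: "z \<in> cball 0 1" "w \<in> cball 0 1" using zw by (auto simp: surface_gluing_def)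
  define p where "p t = linepath z\<^sub>0 z (2 * t)" for t
  define q where "q t = linepath w z\<^sub>0 (2 * t - 1)" for t
  \<comment> \<open>The constant that continues the section across the glued pair: at the midpoint,
    \<open>c \<otimes> inv \<kappa> w = inv \<kappa> z\<close>.\<close>
  define c where "c = inv \<kappa> z \<otimes> \<kappa> w"
  define \<psi> where "\<psi> t = (if t \<le> 1/2 then \<one> \<otimes> inv \<kappa> (p t) else c \<otimes> inv \<kappa> (q t))" for t
  have c: "c \<in> carrier G" by (simp add: c_def)
  have half: "p (1/2) = z" "q (1/2) = w" by (simp_all add: p_def q_def linepath_0' linepath_1')
  have pq: "continuous_on {0..1/2} p" "continuous_on {1/2..1} q"
    unfolding p_def q_def linepath_def by (intro continuous_intros)+
  have in_p: "p t \<in> cball 0 1" if "t \<in> {0..1/2}" for t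
    unfolding p_def by (rule linepath_cball) (use that base cb in auto)
  have in_q: "q t \<in> cball 0 1" if "t \<in> {1/2..1}" for t
    unfolding q_def by (rule linepath_cball) (use that base cb in auto)
  have "flat {0..1/2} (excursion z w) \<psi>"
    by (rule flat_cong[OF flat_projection[OF pq(1) in_p one_closed]])
      (auto simp: excursion_def loop_join_def p_def \<psi>_def)
  moreover have "flat {1/2..1} (excursion z w) \<psi>"
  proof (rule flat_cong[OF flat_projection[OF pq(2) in_q c]])
    fix t :: real assume t: "t \<in> {1/2..1}"
    show "\<pi> (q t) = excursion z w t"
    proof (cases "t = 1/2")
      case True
      then show ?thesis
        unfolding True using proj_eq[OF zw] half by (simp add: excursion_def loop_join_def linepath_1')
    next
      case False
      then show ?thesis using t by (simp add: excursion_def loop_join_def q_def)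
    qed
    have "c \<otimes> inv \<kappa> w = inv \<kappa> z" by (simp add: c_def m_assoc)
    then show "c \<otimes> inv \<kappa> (q t) = \<psi> t"
    proof (cases "t = 1/2")
      case True
      show ?thesis
        unfolding True using \<open>c \<otimes> inv \<kappa> w = inv \<kappa> z\<close> by (simp add: \<psi>_def half)
    next
      case False
      then show ?thesis using t by (simp add: \<psi>_def)
    qed
  qed
  ultimately have "flat ({0..1/2} \<union> {1/2..1}) (excursion z w) \<psi>"
    by (rule flat_Un) auto
  then have "flat {0..1} (excursion z w) \<psi>"
    by (simp add: ivl_disj_un_two_touch)
  moreover have "pathin \<Sigma> (excursion z w)"
    using excursion_loops_at[OF zw] by (simp add: loops_at_def)
  ultimately have "holonomy (excursion z w) = inv (\<psi> 0) \<otimes> \<psi> 1"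
    by (intro holonomy_eq)
  then show ?thesis
    by (simp add: \<psi>_def p_def q_def c_def linepath_0' linepath_1' m_assoc)
qed

lemma surface_group_hom:
  assumes base: "z\<^sub>0 \<in> cball 0 1"
  obtains \<rho> where "\<rho> \<in> hom (fundamental_group \<Sigma> (\<pi> z\<^sub>0)) G"
    "\<And>z w. (z, w) \<in> surface_gluing g \<Longrightarrow>
       \<rho> (polygon_base_point.excursion_class g z\<^sub>0 z w) = \<kappa> z\<^sub>0 \<otimes> inv \<kappa> z \<otimes> \<kappa> w \<otimes> inv \<kappa> z\<^sub>0"
proof -
  interpret polygon_base_point g z\<^sub>0 by unfold_locales (rule base)
  obtain \<rho> where \<rho>: "\<rho> \<in> hom \<Gamma> G"
    "\<And>p. p \<in> loops_at \<Sigma> (\<pi> z\<^sub>0) \<Longrightarrow> \<rho> (loop_homotopy \<Sigma> (\<pi> z\<^sub>0) `` {p}) = holonomy p"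
    using holonomy_hom[of "\<pi> z\<^sub>0"] by blast
  show ?thesis
    by (rule that[OF \<rho>(1)]) (simp add: excursion_class_def \<rho>(2) excursion_loops_at holonomy_excursion[OF base])
qed

end


section \<open>The orientation cocycle\<close>

type_synonym mat = "real \<times> real \<times> real \<times> real"

definition SL2 :: "mat monoid" where
  "SL2 = \<lparr>carrier = {(a, b, c, d). a * d - b * c = 1},
     mult = (\<lambda>(a, b, c, d) (p, q, r, s). (a * p + b * r, a * q + b * s, c * p + d * r, c * q + d * s)),
     one = (1, 0, 0, 1)\<rparr>"

lemma group_SL2: "group SL2"
proof (rule groupI)
  fix x y assume "x \<in> carrier SL2" "y \<in> carrier SL2"
  then obtain a b c d p q r s where xy: "x = (a, b, c, d)" "y = (p, q, r, s)"
    and "a * d - b * c = 1" "p * s - q * r = 1"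
    by (auto simp: SL2_def)
  moreover have "(a * p + b * r) * (c * q + d * s) - (a * q + b * s) * (c * p + d * r)
      = (a * d - b * c) * (p * s - q * r)" by (simp add: algebra_simps)
  ultimately show "x \<otimes>\<^bsub>SL2\<^esub> y \<in> carrier SL2" by (simp add: SL2_def)
next
  fix x assume "x \<in> carrier SL2"
  then show "\<exists>y\<in>carrier SL2. y \<otimes>\<^bsub>SL2\<^esub> x = \<one>\<^bsub>SL2\<^esub>"
    by (cases x, intro bexI[of _ "case x of (a, b, c, d) \<Rightarrow> (d, - b, - c, a)"])
      (auto simp: SL2_def algebra_simps)
qed (auto simp: SL2_def algebra_simps)

fun act :: "mat \<Rightarrow> real \<times> real \<Rightarrow> real \<times> real" where
  "act (a, b, c, d) (x, y) = (a * x + b * y, c * x + d * y)"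

fun det2 :: "real \<times> real \<Rightarrow> real \<times> real \<Rightarrow> real" where
  "det2 (x, y) (z, w) = x * w - y * z"

text \<open>Each vector enters two of the determinants, so rescaling by a nonzero number changes
  nothing: this is the cyclic orientation of three points of the real projective line, zero if two
  coincide.\<close>

definition orientation :: "real \<times> real \<Rightarrow> real \<times> real \<Rightarrow> real \<times> real \<Rightarrow> real" where
  "orientation u v w = sgn (det2 u v * det2 v w * det2 w u)"

lemma act_mult: "act (A \<otimes>\<^bsub>SL2\<^esub> B) u = act A (act B u)"
  by (cases A; cases B; cases u) (simp add: SL2_def algebra_simps)

lemma act_one: "act \<one>\<^bsub>SL2\<^esub> u = u"
  by (cases u) (simp add: SL2_def)

lemma det2_act:
  assumes "A \<in> carrier SL2"
  shows "det2 (act A u) (act A v) = det2 u v"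
proof -
  obtain a b c d x y z w where *: "A = (a, b, c, d)" "u = (x, y)" "v = (z, w)"
    by (cases A; cases u; cases v)
  then have "a * d - b * c = 1" using assms by (simp add: SL2_def)
  moreover have "det2 (act A u) (act A v) = (a * d - b * c) * det2 u v"
    by (simp add: * algebra_simps)
  ultimately show ?thesis by simp
qed

lemma orientation_act:
  "A \<in> carrier SL2 \<Longrightarrow> orientation (act A u) (act A v) (act A w) = orientation u v w"
  by (simp add: orientation_def det2_act)

lemma act_nonzero: "A \<in> carrier SL2 \<Longrightarrow> u \<noteq> (0, 0) \<Longrightarrow> act A u \<noteq> (0, 0)"
proof
  assume A: "A \<in> carrier SL2" and u: "u \<noteq> (0, 0)" and 0: "act A u = (0, 0)"
  have "det2 u v = 0" for v using det2_act[OF A, of u v] by (cases "act A v") (simp add: 0)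
  from this[of "(- snd u, fst u)"] show False
    using u by (cases u) (simp add: power2_eq_square[symmetric] sum_power2_eq_zero_iff)
qed

lemma det2_antisym: "det2 v u = - det2 u v"
  by (cases u; cases v) simp

text \<open>Parallelism passes through \<open>v\<close> only because \<open>v\<close> spans a
  line.\<close>

lemma det2_zero_trans:
  assumes "v \<noteq> (0, 0)" "det2 u v = 0" "det2 v w = 0"
  shows "det2 u w = 0"
proof -
  obtain x y z t p q where *: "u = (x, y)" "v = (z, t)" "w = (p, q)" by (cases u; cases v; cases w)
  then have "x * t = y * z" "z * q = t * p" "z \<noteq> 0 \<or> t \<noteq> 0" using assms by auto
  then have "z * (x * q - y * p) = 0" "t * (x * q - y * p) = 0" by algebra+
  with \<open>z \<noteq> 0 \<or> t \<noteq> 0\<close> show ?thesis by (auto simp: *)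
qed

lemma orientation_bounded: "\<bar>orientation u v w\<bar> \<le> 1"
  by (simp add: orientation_def abs_sgn_eq)

lemma orientation_swap: "orientation u w v = - orientation u v w"
  using det2_antisym[of u v] det2_antisym[of v w] det2_antisym[of w u]
  by (simp add: orientation_def sgn_minus mult.commute mult.left_commute)

lemma det2_zeros:
  assumes "u \<noteq> (0, 0)" "v \<noteq> (0, 0)" "w \<noteq> (0, 0)"
  shows "(det2 u v = 0 \<and> det2 v w = 0 \<longrightarrow> det2 u w = 0) \<and>
    (det2 u v = 0 \<and> det2 u w = 0 \<longrightarrow> det2 v w = 0) \<and>
    (det2 u w = 0 \<and> det2 v w = 0 \<longrightarrow> det2 u v = 0)"
proof -
  have comm: "det2 q p = 0" if "det2 p q = 0" for p q
    using that det2_antisym[of q p] by simp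
  then show ?thesis
    using assms det2_zero_trans by metis
qed

text \<open>
  The sign patterns below are those compatible with the Pluecker relation \<open>a f - b e + c d = 0\<close>
  between the determinants of four nonzero vectors.
\<close>

lemma sign_pattern_identity:
  fixes a b c d e f :: int
  assumes "a = -1 \<or> a = 0 \<or> a = 1" "b = -1 \<or> b = 0 \<or> b = 1" "c = -1 \<or> c = 0 \<or> c = 1"
    "d = -1 \<or> d = 0 \<or> d = 1" "e = -1 \<or> e = 0 \<or> e = 1" "f = -1 \<or> f = 0 \<or> f = 1"
  shows "(a = 0 \<and> d = 0 \<longrightarrow> b = 0) \<and> (a = 0 \<and> b = 0 \<longrightarrow> d = 0) \<and> (b = 0 \<and> d = 0 \<longrightarrow> a = 0) \<and>
    (a = 0 \<and> e = 0 \<longrightarrow> c = 0) \<and> (a = 0 \<and> c = 0 \<longrightarrow> e = 0) \<and> (c = 0 \<and> e = 0 \<longrightarrow> a = 0) \<and>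
    (b = 0 \<and> f = 0 \<longrightarrow> c = 0) \<and> (b = 0 \<and> c = 0 \<longrightarrow> f = 0) \<and> (c = 0 \<and> f = 0 \<longrightarrow> b = 0) \<and>
    (d = 0 \<and> f = 0 \<longrightarrow> e = 0) \<and> (d = 0 \<and> e = 0 \<longrightarrow> f = 0) \<and> (e = 0 \<and> f = 0 \<longrightarrow> d = 0) \<and>
    \<not> (a * f \<ge> 0 \<and> b * e \<le> 0 \<and> c * d \<ge> 0 \<and> a * f - b * e + c * d \<noteq> 0) \<and>
    \<not> (a * f \<le> 0 \<and> b * e \<ge> 0 \<and> c * d \<le> 0 \<and> a * f - b * e + c * d \<noteq> 0) \<longrightarrow>
    d * f * e - b * f * c + a * e * c - a * d * b = 0"
  using assms by (elim disjE) simp_all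

lemma orientation_cocycle:
  assumes nz: "u \<noteq> (0, 0)" "v \<noteq> (0, 0)" "w \<noteq> (0, 0)" "t \<noteq> (0, 0)"
  shows "orientation v w t - orientation u w t + orientation u v t - orientation u v w = 0"
proof -
  define s where "s x = (if x > 0 then 1 else if x = 0 then 0 else - 1 :: int)" for x :: real
  have s: "sgn x = of_int (s x)" "s x = -1 \<or> s x = 0 \<or> s x = 1" for x
    by (simp_all add: s_def sgn_if)
  have zero: "s x = 0 \<longleftrightarrow> x = 0" for x using s(1)[of x] by (metis of_int_eq_0_iff sgn_0_0)
  have prod: "real_of_int (s x * s y) = sgn (x * y)" for x y by (simp add: s(1)[symmetric] sgn_mult)
  have nonneg: "s x * s y \<ge> 0 \<longleftrightarrow> x * y \<ge> 0" for x y
    unfolding of_int_0_le_iff[where 'a = real, symmetric] prod by (simp add: sgn_if)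
  have nonpos: "s x * s y \<le> 0 \<longleftrightarrow> x * y \<le> 0" for x y
    unfolding of_int_le_0_iff[where 'a = real, symmetric] prod by (simp add: sgn_if)
  have null: "s x * s y = 0 \<longleftrightarrow> x * y = 0" for x y by (simp add: zero)
  define a b c d e f where defs: "a = det2 u v" "b = det2 u w" "c = det2 u t"
    "d = det2 v w" "e = det2 v t" "f = det2 w t"
  have plu: "a * f - b * e + c * d = 0"
  proof -
    obtain x1 y1 x2 y2 x3 y3 x4 y4 where *: "u = (x1, y1)" "v = (x2, y2)" "w = (x3, y3)" "t = (x4, y4)"
      by (cases u; cases v; cases w; cases t)
    show ?thesis unfolding defs * det2.simps by algebra
  qed
  \<comment> \<open>If the three terms of \<open>a * f - b * e + c * d = 0\<close> are nonnegative,
    all of them vanish, and so do the products of signs.\<close>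
  have pos: "\<not> (s a * s f \<ge> 0 \<and> s b * s e \<le> 0 \<and> s c * s d \<ge> 0 \<and> s a * s f - s b * s e + s c * s d \<noteq> 0)"
  proof
    assume *: "s a * s f \<ge> 0 \<and> s b * s e \<le> 0 \<and> s c * s d \<ge> 0 \<and> s a * s f - s b * s e + s c * s d \<noteq> 0"
    then have "a * f \<ge> 0" "b * e \<le> 0" "c * d \<ge> 0" by (simp_all only: nonneg nonpos)
    then have "a * f = 0" "b * e = 0" "c * d = 0" using plu by linarith+
    then have "s a * s f = 0" "s b * s e = 0" "s c * s d = 0" by (simp_all only: null)
    with * show False by linarith
  qed
  have neg: "\<not> (s a * s f \<le> 0 \<and> s b * s e \<ge> 0 \<and> s c * s d \<le> 0 \<and> s a * s f - s b * s e + s c * s d \<noteq> 0)"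
  proof
    assume *: "s a * s f \<le> 0 \<and> s b * s e \<ge> 0 \<and> s c * s d \<le> 0 \<and> s a * s f - s b * s e + s c * s d \<noteq> 0"
    then have "a * f \<le> 0" "b * e \<ge> 0" "c * d \<le> 0" by (simp_all only: nonneg nonpos)
    then have "a * f = 0" "b * e = 0" "c * d = 0" using plu by linarith+
    then have "s a * s f = 0" "s b * s e = 0" "s c * s d = 0" by (simp_all only: null)
    with * show False by linarith
  qed
  have "s d * s f * s e - s b * s f * s c + s a * s e * s c - s a * s d * s b = 0"
    using sign_pattern_identity[OF s(2)[of a] s(2)[of b] s(2)[of c] s(2)[of d] s(2)[of e] s(2)[of f], unfolded zero]
      det2_zeros[OF nz(1,2,3), folded defs] det2_zeros[OF nz(1,2,4), folded defs]
      det2_zeros[OF nz(1,3,4), folded defs] det2_zeros[OF nz(2,3,4), folded defs] pos neg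
    by blast
  then have "real_of_int (s d * s f * s e - s b * s f * s c + s a * s e * s c - s a * s d * s b) = 0"
    by (simp only: of_int_0)
  moreover have "orientation v w t = - (sgn d * sgn f * sgn e)" "orientation u w t = - (sgn b * sgn f * sgn c)"
    "orientation u v t = - (sgn a * sgn e * sgn c)" "orientation u v w = - (sgn a * sgn d * sgn b)"
    using det2_antisym[of t v] det2_antisym[of t u] det2_antisym[of w u]
    by (simp_all add: orientation_def defs sgn_mult sgn_minus)
  ultimately show ?thesis by (simp add: s(1))
qed

text \<open>
  Values of \<open>\<kappa>\<close> at the vertices of the polygon for a representation of a genus two surface group with Euler number of
  absolute value two; the remaining handles are mapped to the identity. With
  \<open>a = (3, -1, 1, 0)\<close>, \<open>b = (-4, -1, -3, -1)\<close>, \<open>c = (0, -4, 1/4, 3)\<close>, \<open>d = (-1, 12, 1/4, -4)\<close> and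
  \<open>h = a b\<^sup>-\<^sup>1 a\<^sup>-\<^sup>1 b\<close> they are \<open>1, a b\<^sup>-\<^sup>1 a\<^sup>-\<^sup>1, a b\<^sup>-\<^sup>1, a, h, h c d\<^sup>-\<^sup>1 c\<^sup>-\<^sup>1, h c d\<^sup>-\<^sup>1, h c\<close>.
\<close>

definition vertex_matrix :: "nat \<Rightarrow> mat" where
  "vertex_matrix k = (if k < 8 then
     [(1, 0, 0, 1), (-7, 15, -1, 2), (-6, 7, -1, 1), (3, -1, 1, 0), (-17, -8, -2, -1),
      (-4, -12, -1/4, -1), (-3, -20, -1/4, -2), (-2, 44, -1/4, 5)] ! k else (1, 0, 0, 1))"

lemma inv_SL2: "(a, b, c, d) \<in> carrier SL2 \<Longrightarrow> inv\<^bsub>SL2\<^esub> (a, b, c, d) = (d, - b, - c, a)"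
  by (rule group.inv_equality[OF group_SL2]) (auto simp: SL2_def algebra_simps)

lemma vertex_matrix_small:
  "vertex_matrix 0 = (1, 0, 0, 1)" "vertex_matrix (Suc 0) = (-7, 15, -1, 2)"
  "vertex_matrix (Suc (Suc 0)) = (-6, 7, -1, 1)" "vertex_matrix (Suc (Suc (Suc 0))) = (3, -1, 1, 0)"
  "vertex_matrix 1 = (-7, 15, -1, 2)"
  "vertex_matrix 2 = (-6, 7, -1, 1)" "vertex_matrix 3 = (3, -1, 1, 0)"
  "vertex_matrix 4 = (-17, -8, -2, -1)" "vertex_matrix 5 = (-4, -12, -1/4, -1)"
  "vertex_matrix 6 = (-3, -20, -1/4, -2)" "vertex_matrix 7 = (-2, 44, -1/4, 5)"
  by (simp_all add: vertex_matrix_def)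

lemma vertex_matrix_large: "k \<ge> 8 \<Longrightarrow> vertex_matrix k = (1, 0, 0, 1)"
  by (simp add: vertex_matrix_def)

lemma vertex_matrix_closed: "vertex_matrix k \<in> carrier SL2"
proof -
  consider "k \<ge> 8" | "k \<in> {0, 1, 2, 3, 4, 5, 6, 7}" by force
  then show ?thesis
    by cases (auto simp: vertex_matrix_large vertex_matrix_small SL2_def)
qed

text \<open>The explicit relations live in the first two handles. The one at \<open>k = 5\<close>
  involves vertex 8, where the value is again the identity: the product of the two commutators is
  trivial.\<close>

lemma surface_bundle_vertex_matrix:
  assumes "g \<ge> 2"
  shows "surface_bundle SL2 g vertex_matrix"
proof (intro surface_bundle.intro group_SL2 surface_bundle_axioms.intro vertex_matrix_closed)
  show "vertex_matrix (4 * g) = vertex_matrix 0"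
    using assms by (simp add: vertex_matrix_large vertex_matrix_small)
  fix k assume "k < 4 * g" "k mod 4 \<in> {0, 1}"
  have SL2: "(a, b, c, d) \<in> carrier SL2 \<longleftrightarrow> a * d - b * c = 1" for a b c d by (simp add: SL2_def)
  consider "k \<ge> 8" | "k \<in> {0, 1, 4, 5}" | "k \<in> {2, 3, 6, 7}" by force
  then show "inv\<^bsub>SL2\<^esub> (vertex_matrix k) \<otimes>\<^bsub>SL2\<^esub> vertex_matrix (k + 3)
      = inv\<^bsub>SL2\<^esub> (vertex_matrix (k + 1)) \<otimes>\<^bsub>SL2\<^esub> vertex_matrix (k + 2)"
  proof cases
    case 2
    then show ?thesis
      by (auto simp: vertex_matrix_small vertex_matrix_large inv_SL2 SL2) (simp_all add: SL2_def)
  next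
    case 3
    then show ?thesis using \<open>k mod 4 \<in> {0, 1}\<close> by auto
  qed (simp add: vertex_matrix_large)
qed (use assms in simp)

text \<open>The first two handles contribute -3 and -1. In every further handle all vectors equal
  \<open>(1, 0)\<close>, and the contribution is zero.\<close>

lemma vertex_matrix_sum:
  assumes "g \<ge> 2"
  defines "p \<equiv> \<lambda>k. act (vertex_matrix k) (1, 0)"
  shows "(\<Sum>i<g. orientation (p (4 * i + 3)) (p (4 * i)) (1, 0) - orientation (p (4 * i + 3)) (p (4 * i + 2)) (1, 0)
    - orientation (p (4 * i + 2)) (p (4 * i + 1)) (1, 0) + orientation (p (4 * i + 4)) (p (4 * i + 1)) (1, 0)) \<noteq> 0"
proof -
  let ?f = "\<lambda>i. orientation (p (4 * i + 3)) (p (4 * i)) (1, 0) - orientation (p (4 * i + 3)) (p (4 * i + 2)) (1, 0)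
    - orientation (p (4 * i + 2)) (p (4 * i + 1)) (1, 0) + orientation (p (4 * i + 4)) (p (4 * i + 1)) (1, 0)"
  have large: "?f i = 0" if "i \<ge> 2" for i
    using that by (simp add: p_def vertex_matrix_large orientation_def)
  have "sum ?f {..<g} = sum ?f {..<2}"
    using assms(1) large by (intro sum.mono_neutral_right) auto
  also have "\<dots> = ?f 0 + ?f 1" by (simp add: numeral_2_eq_2)
  also have "\<dots> \<noteq> 0"
    by (simp add: p_def vertex_matrix_small vertex_matrix_large orientation_def)
  finally show ?thesis .
qed

text \<open>
  Along the closed path through the vertices \<open>4i, 4i + 3, 4i + 2, 4i + 1, 4i + 4\<close> for \<open>i < g\<close>, a
  coboundary sums to zero because the steps \<open>4i \<rightarrow> 4i + 3\<close> and \<open>4i + 1 \<rightarrow> 4i + 2\<close> represent the same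
  loop, as do \<open>4i + 2 \<rightarrow> 4i + 3\<close> and \<open>4i + 1 \<rightarrow> 4i + 4\<close>. The orientation cocycle sums to twice the
  Euler number up to sign.
\<close>

lemma surface_group_cocycle:
  assumes g: "g \<ge> 2" and x: "x \<in> topspace (closed_orientable_surface g)"
  defines "\<Gamma> \<equiv> fundamental_group (closed_orientable_surface g) x"
  obtains e :: "_ \<Rightarrow> _ \<Rightarrow> _ \<Rightarrow> real" where "\<And>a b c. \<bar>e a b c\<bar> \<le> 1" "\<And>a b c. e a c b = - e a b c"
    "\<And>a b c d. \<lbrakk>a \<in> carrier \<Gamma>; b \<in> carrier \<Gamma>; c \<in> carrier \<Gamma>; d \<in> carrier \<Gamma>\<rbrakk> \<Longrightarrow>
       e b c d - e a c d + e a b d - e a b c = 0"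
    "\<And>h a b c. \<lbrakk>h \<in> carrier \<Gamma>; a \<in> carrier \<Gamma>; b \<in> carrier \<Gamma>; c \<in> carrier \<Gamma>\<rbrakk> \<Longrightarrow>
       e (h \<otimes>\<^bsub>\<Gamma>\<^esub> a) (h \<otimes>\<^bsub>\<Gamma>\<^esub> b) (h \<otimes>\<^bsub>\<Gamma>\<^esub> c) = e a b c"
    "\<And>b. \<exists>h\<in>carrier \<Gamma>. \<exists>k\<in>carrier \<Gamma>. e (h \<otimes>\<^bsub>\<Gamma>\<^esub> k) h \<one>\<^bsub>\<Gamma>\<^esub> \<noteq> b h + b k - b (h \<otimes>\<^bsub>\<Gamma>\<^esub> k)"
proof -
  interpret surface_bundle SL2 g vertex_matrix by (rule surface_bundle_vertex_matrix[OF g])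
  obtain z\<^sub>0 where z0: "z\<^sub>0 \<in> cball 0 1" "x = \<pi> z\<^sub>0" using x by (auto simp: topspace_\<Sigma>)
  interpret polygon_base_point g z\<^sub>0 by unfold_locales (rule z0)
  have \<Gamma>: "\<Gamma> = fundamental_group \<Sigma> (\<pi> z\<^sub>0)" by (simp add: \<Gamma>_def z0(2))
  interpret \<Gamma>: group \<Gamma> unfolding \<Gamma> by (rule group_\<Gamma>)
  obtain \<rho> where \<rho>: "\<rho> \<in> hom \<Gamma> SL2"
    and \<rho>_cls: "\<And>z w. (z, w) \<in> surface_gluing g \<Longrightarrow> \<rho> (excursion_class z w) =
      \<kappa> z\<^sub>0 \<otimes>\<^bsub>SL2\<^esub> inv\<^bsub>SL2\<^esub> \<kappa> z \<otimes>\<^bsub>SL2\<^esub> \<kappa> w \<otimes>\<^bsub>SL2\<^esub> inv\<^bsub>SL2\<^esub> \<kappa> z\<^sub>0"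
    unfolding \<Gamma> using surface_group_hom[OF z0(1)] by blast
  have \<rho>_closed: "\<rho> h \<in> carrier SL2" if "h \<in> carrier \<Gamma>" for h using \<rho> that by (auto simp: hom_def)
  have \<rho>_mult: "\<rho> (h \<otimes>\<^bsub>\<Gamma>\<^esub> k) = \<rho> h \<otimes>\<^bsub>SL2\<^esub> \<rho> k" if "h \<in> carrier \<Gamma>" "k \<in> carrier \<Gamma>" for h k
    using \<rho> that by (auto simp: hom_def)
  have \<rho>_one: "\<rho> \<one>\<^bsub>\<Gamma>\<^esub> = \<one>\<^bsub>SL2\<^esub>" using hom_one[OF \<rho> \<Gamma>.group_axioms group_SL2] .
  \<comment> \<open>With this vector the factor \<open>\<kappa> z\<^sub>0\<close> becomes common to
    all points compared below, and invariance of the orientation removes it.\<close>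
  define \<xi> where "\<xi> = act (\<kappa> z\<^sub>0) (1, 0)"
  define e where "e a b c = orientation (act (\<rho> a) \<xi>) (act (\<rho> b) \<xi>) (act (\<rho> c) \<xi>)" for a b c
  have \<xi>: "\<xi> \<noteq> (0, 0)" unfolding \<xi>_def by (rule act_nonzero) auto
  have not_coboundary: "\<exists>h\<in>carrier \<Gamma>. \<exists>k\<in>carrier \<Gamma>. e (h \<otimes>\<^bsub>\<Gamma>\<^esub> k) h \<one>\<^bsub>\<Gamma>\<^esub> \<noteq> b h + b k - b (h \<otimes>\<^bsub>\<Gamma>\<^esub> k)" for b
  proof (rule ccontr)
    assume "\<not> ?thesis"
    then have cob: "e (h \<otimes>\<^bsub>\<Gamma>\<^esub> k) h \<one>\<^bsub>\<Gamma>\<^esub> = b h + b k - b (h \<otimes>\<^bsub>\<Gamma>\<^esub> k)"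
      if "h \<in> carrier \<Gamma>" "k \<in> carrier \<Gamma>" for h k using that by blast
    define V where "V k = polygon_side g k 0" for k
    define w where "w k = excursion_class (V 0) (V k)" for k
    define p where "p k = act (vertex_matrix k) (1, 0)" for k
    have pair: "(polygon_side g k s, polygon_side g (k + 2) (1 - s)) \<in> surface_gluing g"
      if "k < 4 * g" "k mod 4 \<in> {0, 1}" "s \<in> {0..1}" for k s
      using that by (rule side_pair_gluing)
    have family: "excursion_class (V k) (V (k + 3)) = excursion_class (V (k + 1)) (V (k + 2))"
      "(V k, V (k + 3)) \<in> surface_gluing g" "(V (k + 1), V (k + 2)) \<in> surface_gluing g"
      if k: "k < 4 * g" "k mod 4 \<in> {0, 1}" for k
    proof -
      have "excursion_class (polygon_side g k 0) (polygon_side g (k + 2) (1 - 0))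
          = excursion_class (polygon_side g k 1) (polygon_side g (k + 2) (1 - 1))"
        by (rule excursion_class_family[OF _ _ pair[OF k]])
          (use genus in \<open>auto simp: polygon_side_def intro!: continuous_intros\<close>)
      then show "excursion_class (V k) (V (k + 3)) = excursion_class (V (k + 1)) (V (k + 2))"
        using polygon_side_1[of k] polygon_side_1[of "k + 2"] by (simp add: V_def numeral_3_eq_3)
      show "(V k, V (k + 3)) \<in> surface_gluing g" "(V (k + 1), V (k + 2)) \<in> surface_gluing g"
        using pair[OF k, of 0] pair[OF k, of 1] polygon_side_1[of k] polygon_side_1[of "k + 2"]
        by (simp_all add: V_def numeral_3_eq_3)
    qed
    have sym: "(b, a) \<in> surface_gluing g" if "(a, b) \<in> surface_gluing g" for a b
      using equiv_surface_gluing[of g] that by (auto elim!: equivE dest: symD)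
    have trans: "(a, c) \<in> surface_gluing g" if "(a, b) \<in> surface_gluing g" "(b, c) \<in> surface_gluing g" for a b c
      using equiv_surface_gluing[of g] that by (auto elim!: equivE dest: transD)
    have index: "4 * i + 1 + 1 = 4 * i + 2" "4 * i + 1 + 2 = 4 * i + 3" "4 * i + 1 + 3 = 4 * i + 4" for i :: nat
      by simp_all
    \<comment> \<open>Within a handle the gluing links the vertices in the chain \<open>4i\<close>,
      \<open>4i + 3\<close>, \<open>4i + 2\<close>, \<open>4i + 1\<close>, \<open>4i + 4\<close>,
      and the last one starts the next handle.\<close>
    have handle: "(V (4 * i), V (4 * i + j)) \<in> surface_gluing g" if "i < g" "j \<in> {1, 2, 3, 4}" for i j
    proof -
      have "4 * i < 4 * g" "4 * i mod 4 \<in> {0, 1}" "4 * i + 1 < 4 * g" "(4 * i + 1) mod 4 \<in> {0, 1}"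
        using that(1) by auto
      note f = family(2,3)[OF this(1,2)] family(2,3)[OF this(3,4)]
      have "(V (4 * i), V (4 * i + 3)) \<in> surface_gluing g" "(V (4 * i + 1), V (4 * i + 2)) \<in> surface_gluing g"
        "(V (4 * i + 1), V (4 * i + 4)) \<in> surface_gluing g" "(V (4 * i + 2), V (4 * i + 3)) \<in> surface_gluing g"
        using f unfolding index by blast+
      then show ?thesis using that(2) sym trans by blast
    qed
    have V0: "(V 0, V (4 * i)) \<in> surface_gluing g" if "i \<le> g" for i
      using that
    proof (induction i)
      case 0
      then show ?case using polygon_side_cball by (simp add: V_def surface_gluing_def)
    next
      case (Suc i)
      have "4 * Suc i = 4 * i + 4" by simp
      then show ?case
        by (simp only:) (rule trans[OF Suc.IH handle]; use Suc.prems in simp)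
    qed
    have V: "(V 0, V (4 * i + j)) \<in> surface_gluing g" if "i < g" "j \<in> {0, 1, 2, 3, 4}" for i j
    proof (cases "j = 0")
      case True
      then show ?thesis using V0[of i] that by simp
    next
      case False
      show ?thesis by (rule trans[OF V0 handle]) (use that False in simp_all)
    qed
    have VV: "(V (4 * i + j), V (4 * i + l)) \<in> surface_gluing g"
      if "i < g" "j \<in> {0, 1, 2, 3, 4}" "l \<in> {0, 1, 2, 3, 4}" for i j l
      using trans[OF sym[OF V[OF that(1,2)]] V[OF that(1,3)]] .
    have cls_carrier: "excursion_class a b \<in> carrier \<Gamma>" if "(a, b) \<in> surface_gluing g" for a b
      using excursion_class_closed[OF that] by (simp add: \<Gamma>)
    \<comment> \<open>The coboundary equation for \<open>w (4 * i + j)\<close> and the excursion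
      from vertex \<open>4 * i + j\<close> to \<open>4 * i + l\<close>; their product is
      \<open>w (4 * i + l)\<close>.\<close>
    have step: "e (w (4 * i + l)) (w (4 * i + j)) \<one>\<^bsub>\<Gamma>\<^esub>
        = b (w (4 * i + j)) + b (excursion_class (V (4 * i + j)) (V (4 * i + l))) - b (w (4 * i + l))"
      if "i < g" "j \<in> {0, 1, 2, 3, 4}" "l \<in> {0, 1, 2, 3, 4}" for i j l
      using cob[of "w (4 * i + j)" "excursion_class (V (4 * i + j)) (V (4 * i + l))"]
        excursion_class_mult[OF V[OF that(1,2)] VV[OF that]] cls_carrier[OF V[OF that(1,2)]] cls_carrier[OF VV[OF that]]
      by (simp add: w_def \<Gamma>)
    \<comment> \<open>The gauge is trivial at \<open>V 0\<close>, so the holonomy of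
      \<open>w k\<close> is \<open>vertex_matrix k\<close> conjugated by
      \<open>\<kappa> z\<^sub>0\<close>, and \<xi> undoes the inner factor.\<close>
    have point: "act (\<rho> (w k)) \<xi> = act (\<kappa> z\<^sub>0) (p k)" if "(V 0, V k) \<in> surface_gluing g" "k \<le> 4 * g" for k
    proof -
      have "\<kappa> (V 0) = \<one>\<^bsub>SL2\<^esub>" using \<kappa>_vertex[of 0] by (simp add: V_def vertex_matrix_small SL2_def)
      then have "\<rho> (w k) = \<kappa> z\<^sub>0 \<otimes>\<^bsub>SL2\<^esub> (vertex_matrix k \<otimes>\<^bsub>SL2\<^esub> inv\<^bsub>SL2\<^esub> \<kappa> z\<^sub>0)"
        using \<rho>_cls[OF that(1)] \<kappa>_vertex[OF that(2)]
        by (simp add: w_def V_def m_assoc vertex_matrix_closed)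
      then show ?thesis
        unfolding \<xi>_def p_def
        by (simp add: act_mult) (simp add: act_mult[symmetric] act_one)
    qed
    have pointwise: "e (w (4 * i + l)) (w (4 * i + j)) \<one>\<^bsub>\<Gamma>\<^esub> = orientation (p (4 * i + l)) (p (4 * i + j)) (1, 0)"
      if "i < g" "j \<in> {0, 1, 2, 3, 4}" "l \<in> {0, 1, 2, 3, 4}" for i j l
    proof -
      have "4 * i + j \<le> 4 * g" "4 * i + l \<le> 4 * g" using that by auto
      then have "act (\<rho> (w (4 * i + l))) \<xi> = act (\<kappa> z\<^sub>0) (p (4 * i + l))"
        "act (\<rho> (w (4 * i + j))) \<xi> = act (\<kappa> z\<^sub>0) (p (4 * i + j))"
        using point V that by simp_all
      moreover have "act (\<rho> \<one>\<^bsub>\<Gamma>\<^esub>) \<xi> = act (\<kappa> z\<^sub>0) (1, 0)"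
        by (simp add: \<rho>_one act_one \<xi>_def)
      ultimately show ?thesis by (simp add: e_def orientation_act)
    qed
    \<comment> \<open>The signs are those of the steps along the path. The values of
      \<open>b\<close> at the inner vertices cancel, as do those at the two pairs of equal
      excursions, leaving a telescoping difference.\<close>
    have term_eq: "orientation (p (4 * i + 3)) (p (4 * i)) (1, 0) - orientation (p (4 * i + 3)) (p (4 * i + 2)) (1, 0)
        - orientation (p (4 * i + 2)) (p (4 * i + 1)) (1, 0) + orientation (p (4 * i + 4)) (p (4 * i + 1)) (1, 0)
        = b (w (4 * i)) - b (w (4 * Suc i))" if i: "i < g" for i
    proof -
      have "4 * i < 4 * g" "4 * i mod 4 \<in> {0, 1}" "4 * i + 1 < 4 * g" "(4 * i + 1) mod 4 \<in> {0, 1}"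
        using i by auto
      from family(1)[OF this(1,2)] family(1)[OF this(3,4)]
      have "excursion_class (V (4 * i)) (V (4 * i + 3)) = excursion_class (V (4 * i + 1)) (V (4 * i + 2))"
        "excursion_class (V (4 * i + 1)) (V (4 * i + 4)) = excursion_class (V (4 * i + 2)) (V (4 * i + 3))"
        unfolding index by blast+
      then show ?thesis
        using pointwise[OF i, of 0 3] pointwise[OF i, of 2 3] pointwise[OF i, of 1 2] pointwise[OF i, of 1 4]
          step[OF i, of 0 3] step[OF i, of 2 3] step[OF i, of 1 2] step[OF i, of 1 4]
        by (simp add: add.commute)
    qed
    have "(\<Sum>i<g. b (w (4 * i)) - b (w (4 * Suc i))) = b (w (4 * 0)) - b (w (4 * g))"
      by (rule sum_lessThan_telescope')
    also have "w (4 * g) = w (4 * 0)"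
      using polygon_side_cyclic by (simp add: w_def V_def)
    finally show False
      using vertex_matrix_sum[OF g] term_eq by (simp add: p_def)
  qed
  show ?thesis
  proof (rule that)
    show "\<bar>e a b c\<bar> \<le> 1" "e a c b = - e a b c" for a b c
      unfolding e_def by (rule orientation_bounded, rule orientation_swap)
    show "e b c d - e a c d + e a b d - e a b c = 0"
      if "a \<in> carrier \<Gamma>" "b \<in> carrier \<Gamma>" "c \<in> carrier \<Gamma>" "d \<in> carrier \<Gamma>" for a b c d
      unfolding e_def by (intro orientation_cocycle act_nonzero \<rho>_closed that \<xi>)
    show "e (h \<otimes>\<^bsub>\<Gamma>\<^esub> a) (h \<otimes>\<^bsub>\<Gamma>\<^esub> b) (h \<otimes>\<^bsub>\<Gamma>\<^esub> c) = e a b c"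
      if "h \<in> carrier \<Gamma>" "a \<in> carrier \<Gamma>" "b \<in> carrier \<Gamma>" "c \<in> carrier \<Gamma>" for h a b c
      using that by (simp add: e_def \<rho>_mult act_mult orientation_act \<rho>_closed)
  qed (rule not_coboundary)
qed

theorem corollary1p4:
  fixes n g :: nat and x :: "complex set"
  assumes "n \<ge> 2" and "g \<ge> 2"
    and "x \<in> topspace (closed_orientable_surface g)"
  shows "\<not> L1_measure_equivalent TYPE('x) (free_group n)
            (fundamental_group (closed_orientable_surface g) x)"
proof
  let ?\<Gamma> = "fundamental_group (closed_orientable_surface g) x" and ?F = "free_group n"
  assume "L1_measure_equivalent TYPE('x) ?F ?\<Gamma>"
  then obtain S M \<phi> \<psi> D E where S: "finite_generating_set ?F S"
    and coupling: "measure_equivalence_coupling ?F ?\<Gamma> (M :: 'x measure) \<phi> \<psi> D E"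
    and int: "\<And>h. h \<in> carrier ?\<Gamma> \<Longrightarrow>
        (\<integral>\<^sup>+y\<in>D. of_nat (word_length ?F S (coupling_cocycle ?F \<phi> D \<psi> h y)) \<partial>M) < \<infinity>"
    unfolding L1_measure_equivalent_def by blast
  from surface_group_cocycle[OF assms(2,3)] obtain e where
    e: "\<And>a b c. \<bar>e a b c\<bar> \<le> (1 :: real)" "\<And>a b c. e a c b = - e a b c"
      "\<And>a b c d. \<lbrakk>a \<in> carrier ?\<Gamma>; b \<in> carrier ?\<Gamma>; c \<in> carrier ?\<Gamma>; d \<in> carrier ?\<Gamma>\<rbrakk> \<Longrightarrow>
         e b c d - e a c d + e a b d - e a b c = 0"
      "\<And>h a b c. \<lbrakk>h \<in> carrier ?\<Gamma>; a \<in> carrier ?\<Gamma>; b \<in> carrier ?\<Gamma>; c \<in> carrier ?\<Gamma>\<rbrakk> \<Longrightarrow>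
         e (h \<otimes>\<^bsub>?\<Gamma>\<^esub> a) (h \<otimes>\<^bsub>?\<Gamma>\<^esub> b) (h \<otimes>\<^bsub>?\<Gamma>\<^esub> c) = e a b c"
    and not_cob: "\<And>b. \<exists>h\<in>carrier ?\<Gamma>. \<exists>k\<in>carrier ?\<Gamma>. e (h \<otimes>\<^bsub>?\<Gamma>\<^esub> k) h \<one>\<^bsub>?\<Gamma>\<^esub> \<noteq> b h + b k - b (h \<otimes>\<^bsub>?\<Gamma>\<^esub> k)"
    by blast
  have "free_group_coupling n ?\<Gamma> M \<phi> \<psi> D E e 1"
    by (rule free_group_coupling.intro) (fact coupling e)+
  from free_group_coupling.bounded_cocycle_is_coboundary[OF this S int]
  obtain b where "\<And>h k. h \<in> carrier ?\<Gamma> \<Longrightarrow> k \<in> carrier ?\<Gamma> \<Longrightarrow>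
      e (h \<otimes>\<^bsub>?\<Gamma>\<^esub> k) h \<one>\<^bsub>?\<Gamma>\<^esub> = b h + b k - b (h \<otimes>\<^bsub>?\<Gamma>\<^esub> k)" by blast
  with not_cob[of b] show False by blast
qed

end
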